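(* For any constants $c\in(0,1/2)$, $p\in(0,1)$ and $h\in\mathbb{N}$, there are functions $\alpha=\alpha_{h,p,c}$ and $\phi=\phi_{h,p,c}$ of $n$ with $\lim_{n\to\infty}\alpha(n)=0$ and $\lim_{n\to\infty}\phi(n)=\infty$, such that for every $n$ the random graph $G\in\mathbb{G}(n,p)$ is $\left(c,n^{\alpha(n)+1-h},h\right)$-dispersed with probability at least $1-n^{-\phi(n)}$.
   Context: $\mathbb{G}(n,p)$ is the binomial random graph on vertex set $\{1,\dots,n\}$ in which each pair of vertices is an edge independently with probability $p$. For $c\in(0,1/2)$ and $q\in(0,1)$, an $n$-vertex graph $G$ is called $(c,q,h)$-dispersed if for every integer $k$ with $cn\le k\le(1-c)n$ and every integer $\ell$, the number of $k$-vertex subsets $U\subseteq V(G)$ such that the induced subgraph $G[U]$ contains exactly $\ell$ copies of $K_h$ (sets of $h$ pairwise adjacent vertices) is at most $\binom{n}{k}q$. *)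

theory Defs
  imports "HOL-Probability.Product_PMF"
begin

text \<open>A graph is a pair of a vertex set and a set of edges, each edge being a two-element set of
  vertices.\<close>

type_synonym 'a sgraph = "'a set \<times> 'a set set"

abbreviation vertices :: "'a sgraph \<Rightarrow> 'a set" where
  "vertices G \<equiv> fst G"

abbreviation edges :: "'a sgraph \<Rightarrow> 'a set set" where
  "edges G \<equiv> snd G"

definition all_pairs :: "'a set \<Rightarrow> 'a set set" where
  "all_pairs V = {e. e \<subseteq> V \<and> card e = 2}"

definition induced :: "'a sgraph \<Rightarrow> 'a set \<Rightarrow> 'a sgraph" where
  "induced G U = (U, {e \<in> edges G. e \<subseteq> U})"

definition clique_copies :: "nat \<Rightarrow> 'a sgraph \<Rightarrow> 'a set set" where
  "clique_copies h G =
     {W. W \<subseteq> vertices G \<and> finite W \<and> card W = h \<and>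
         (\<forall>x\<in>W. \<forall>y\<in>W. x \<noteq> y \<longrightarrow> {x, y} \<in> edges G)}"

text \<open>No restriction \<open>0 < q < 1\<close> is built in: the bound is meaningful, though vacuous, for
  \<open>q \<ge> 1\<close>. Negative integers \<open>k\<close> and \<open>l\<close> can be left out, since \<open>k \<ge> c n \<ge> 0\<close> and the number
  of copies is never negative.\<close>

definition dispersed :: "real \<Rightarrow> real \<Rightarrow> nat \<Rightarrow> 'a sgraph \<Rightarrow> bool" where
  "dispersed c q h G \<longleftrightarrow>
     (let n = card (vertices G) in
      \<forall>k l :: nat. c * real n \<le> real k \<and> real k \<le> (1 - c) * real n \<longrightarrow>
        real (card {U. U \<subseteq> vertices G \<and> card U = k \<and>
                       card (clique_copies h (induced G U)) = l})
          \<le> real (n choose k) * q)"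

text \<open>The binomial random graph: one independent Bernoulli variable for each pair of vertices.\<close>

definition random_graph :: "nat \<Rightarrow> real \<Rightarrow> nat sgraph pmf" where
  "random_graph n p =
     map_pmf (\<lambda>f. ({1..n}, {e \<in> all_pairs {1..n}. f e}))
       (Pi_pmf (all_pairs {1..n}) False (\<lambda>_. bernoulli_pmf p))"

end

theory Submission
  imports Defs "HOL-Probability.Probability" "HOL-Real_Asymp.Real_Asymp"
begin

text \<open>The proof is by induction on \<open>h\<close>. By the moment method it suffices to show that, for a fixed
  number \<open>m\<close> of independent random \<open>k\<close>-sets \<open>U\<close>, the probability that all of them contain exactly
  \<open>l\<close> copies of \<open>K_h\<close> is about \<open>n powr (m * (1 - h))\<close>. Each such set has many vertices that lie in no
  other one; pick one of them, \<open>v\<close>, and a set \<open>W\<close> of nearly linear size, and resample only the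
  pairs at \<open>v\<close> and inside \<open>W\<close>, which makes the \<open>m\<close> events independent. The copies in \<open>U\<close> are those
  in \<open>U - {v}\<close> plus the copies of \<open>K_(h - 1)\<close> in the neighbourhood of \<open>v\<close>. The latter number is
  determined by the degree of \<open>v\<close> up to \<open>n powr (h - 2 + o(1))\<close>, so the copies in \<open>U - {v}\<close> have to
  fall into a window of this length. Every pair inside \<open>W\<close> influences their number by order
  \<open>n ^ (h - 2)\<close>, so by the Erdos-Littlewood-Offord argument (LYM) this has probability
  \<open>n powr (o(1) - 1)\<close>. Given the degree, the neighbourhood of \<open>v\<close> is a uniformly random set in a graph
  that is dispersed for \<open>h - 1\<close>, so it yields the exact required number with probability
  \<open>n powr (2 - h + o(1))\<close>.\<close>

section \<open>Resampling and concentration for product measures\<close>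

text \<open>Two scales match. A pair inside \<open>W\<close> lies in about n ^ (h - 2) copies of
  K_h. The number of K_(h - 1) in a neighbourhood depends on about n ^ 2 pairs, each of influence n
  ^ (h - 3), so it also fluctuates by about n ^ (h - 2). The window is thus hardly longer than a
  single increment and costs only a small power of n. The star of \<open>v\<close> and the pairs
  inside \<open>W\<close> are disjoint sources of randomness, so their gains multiply.

  The obstacle is the union bound over all \<open>k\<close> and \<open>l\<close>: the mean of the
  bad proportion yields, by Markov, only a failure probability n powr (-\<epsilon>). Its
  \<open>m\<close>-th moment yields about n powr (-\<epsilon> * m), with \<open>m\<close> free. The
  price is that the \<open>m\<close> sets overlap and share one graph, so \<open>v\<close> and
  \<open>W\<close> have to avoid all the other sets.

  A neighbourhood in \<open>U\<close> has about p * card U vertices. The induction hypothesis is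
  therefore needed for another \<open>c\<close>, on other vertex sets, with a smaller error exponent
  and a larger \<open>K\<close>; all of these are quantified inside the induction.\<close>

lemma Pi_pmf_resample:
  assumes "finite E" "F \<subseteq> E"
  shows "Pi_pmf E d p = bind_pmf (Pi_pmf E d p) (\<lambda>f. map_pmf (\<lambda>g. override_on f g F) (Pi_pmf F d p))"
proof -
  let ?h = "\<lambda>(f, g) x. if x \<in> F then f x else g x"
  have "Pi_pmf (F \<union> (E - F)) d p = map_pmf ?h (pair_pmf (Pi_pmf F d p) (Pi_pmf (E - F) d p))"
    using assms by (intro Pi_pmf_union) (auto dest: finite_subset)
  moreover have "F \<union> (E - F) = E" using assms by auto
  ultimately have *: "Pi_pmf E d p = map_pmf ?h (pair_pmf (Pi_pmf F d p) (Pi_pmf (E - F) d p))" by simp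
  have o: "override_on (?h x) g F = ?h (g, snd x)" for x g
    by (cases x) (auto simp: override_on_def fun_eq_iff)
  have "bind_pmf (Pi_pmf E d p) (\<lambda>f. map_pmf (\<lambda>g. override_on f g F) (Pi_pmf F d p))
      = bind_pmf (pair_pmf (Pi_pmf F d p) (Pi_pmf (E - F) d p))
          (\<lambda>x. map_pmf (\<lambda>g. ?h (g, snd x)) (Pi_pmf F d p))"
    unfolding * bind_map_pmf o ..
  also have "\<dots> = bind_pmf (Pi_pmf (E - F) d p) (\<lambda>y. map_pmf (\<lambda>g. ?h (g, y)) (Pi_pmf F d p))"
    unfolding pair_pmf_def bind_assoc_pmf bind_return_pmf snd_conv by (rule bind_pmf_const)
  also have "\<dots> = map_pmf ?h (pair_pmf (Pi_pmf F d p) (Pi_pmf (E - F) d p))"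
    unfolding pair_pmf_def map_pmf_def bind_assoc_pmf bind_return_pmf
    by (rule bind_commute_pmf)
  finally show ?thesis using * by simp
qed

text \<open>Conditioning on the coordinates outside \<open>F\<close> takes this form:
  \<open>override_on f g F\<close> keeps \<open>f\<close> off \<open>F\<close> and has fresh values
  on \<open>F\<close>, and an inequality valid for every frozen \<open>f\<close> survives averaging.
  The event \<open>Q\<close> on the right allows resampling steps to be chained.\<close>

lemma prob_resample_mono:
  assumes "finite E" "F \<subseteq> E" "0 \<le> c"
    and le: "\<And>f. measure_pmf.prob (Pi_pmf F d p) {g. P (override_on f g F)}
      \<le> c * measure_pmf.prob (Pi_pmf F d p) {g. Q (override_on f g F)}"
  shows "measure_pmf.prob (Pi_pmf E d p) {f. P f} \<le> c * measure_pmf.prob (Pi_pmf E d p) {f. Q f}"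
proof -
  let ?M = "Pi_pmf E d p" and ?N = "Pi_pmf F d p"
  have eq: "emeasure ?M {f. R f} = (\<integral>\<^sup>+f. emeasure ?N {g. R (override_on f g F)} \<partial>?M)" for R
  proof -
    have "emeasure ?M {f. R f} =
        emeasure (bind_pmf ?M (\<lambda>f. map_pmf (\<lambda>g. override_on f g F) ?N)) {f. R f}"
      using Pi_pmf_resample[OF assms(1,2), of d p] by simp
    also have "\<dots> = (\<integral>\<^sup>+f. emeasure ?N {g. R (override_on f g F)} \<partial>?M)"
      by (simp add: vimage_def)
    finally show ?thesis .
  qed
  have "emeasure ?M {f. P f} \<le> (\<integral>\<^sup>+f. ennreal c * emeasure ?N {g. Q (override_on f g F)} \<partial>?M)"
    unfolding eq[of P]
  proof (rule nn_integral_mono)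
    fix f
    show "emeasure ?N {g. P (override_on f g F)} \<le> ennreal c * emeasure ?N {g. Q (override_on f g F)}"
      unfolding measure_pmf.emeasure_eq_measure using le[of f] assms(3)
      by (simp add: ennreal_mult[symmetric])
  qed
  also have "\<dots> = ennreal c * emeasure ?M {f. Q f}"
    unfolding eq[of Q] by (rule nn_integral_cmult) simp
  finally show ?thesis
    unfolding measure_pmf.emeasure_eq_measure using assms(3)
    by (simp add: ennreal_mult[symmetric])
qed

corollary prob_resample_le:
  assumes "finite E" "F \<subseteq> E" "0 \<le> c"
    and "\<And>f. measure_pmf.prob (Pi_pmf F d p) {g. P (override_on f g F)} \<le> c"
  shows "measure_pmf.prob (Pi_pmf E d p) {f. P f} \<le> c"
  using prob_resample_mono[OF assms(1-3), of d p P "\<lambda>_. True"] assms(4) by simp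

text \<open>The proportion of \<open>x\<close> with \<open>P f x\<close> is a random variable in
  \<open>f\<close>. Its mean is computed with the two averages exchanged: a fixed \<open>x\<close>
  outside \<open>B\<close> contributes at most \<open>b\<close>, and all of \<open>B\<close> at most
  \<open>\<beta>\<close>. Then Markov's inequality applies.\<close>

lemma prob_ge_swap_Markov:
  fixes M :: "'a pmf" and N :: "'b pmf"
  assumes "0 < a" "0 \<le> b"
    and good: "\<And>x. x \<in> set_pmf N \<Longrightarrow> x \<notin> B \<Longrightarrow> measure_pmf.prob M {f. P f x} \<le> b"
    and bad: "measure_pmf.prob N B \<le> \<beta>"
  shows "measure_pmf.prob M {f. a \<le> measure_pmf.prob N {x. P f x}} \<le> (b + \<beta>) / a"
proof -
  have \<beta>: "0 \<le> \<beta>" using bad measure_nonneg[of N B] by linarith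
  \<comment> \<open>The truth value of \<open>P\<close> under both orders of sampling; commuting the
    binds serves as Fubini.\<close>
  let ?A = "bind_pmf M (\<lambda>f. bind_pmf N (\<lambda>x. return_pmf (P f x)))"
  let ?B = "bind_pmf N (\<lambda>x. bind_pmf M (\<lambda>f. return_pmf (P f x)))"
  have AB: "?A = ?B" by (rule bind_commute_pmf)
  have map: "bind_pmf N (\<lambda>x. return_pmf (Q x)) = map_pmf Q N" for N :: "'c pmf" and Q :: "'c \<Rightarrow> bool"
    by (simp add: map_pmf_def)
  have eA: "emeasure ?A {True} = (\<integral>\<^sup>+f. emeasure N {x. P f x} \<partial>M)"
    unfolding map by (simp add: vimage_def)
  have eB: "emeasure ?B {True} = (\<integral>\<^sup>+x. emeasure M {f. P f x} \<partial>N)"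
    unfolding map by (simp add: vimage_def)
  have "(\<integral>\<^sup>+x. emeasure M {f. P f x} \<partial>N) \<le> (\<integral>\<^sup>+x. ennreal b + indicator B x \<partial>N)"
  proof (rule nn_integral_mono_AE, unfold AE_measure_pmf_iff, intro ballI)
    fix x assume x: "x \<in> set_pmf N"
    show "emeasure M {f. P f x} \<le> ennreal b + indicator B x"
    proof (cases "x \<in> B")
      case True
      have "emeasure M {f. P f x} \<le> 1" by (rule measure_pmf.emeasure_le_1)
      also have "\<dots> \<le> ennreal b + indicator B x" using True by simp
      finally show ?thesis .
    next
      case False
      then show ?thesis using good[OF x] assms(2) by (simp add: measure_pmf.emeasure_eq_measure)
    qed
  qed
  also have "\<dots> = ennreal b + emeasure N B"
    by (subst nn_integral_add) (auto simp: measure_pmf.emeasure_eq_measure)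
  also have "\<dots> \<le> ennreal (b + \<beta>)"
    using bad assms(2) \<beta> by (simp add: measure_pmf.emeasure_eq_measure ennreal_plus[symmetric] del: ennreal_plus)
  finally have le: "(\<integral>\<^sup>+f. emeasure N {x. P f x} \<partial>M) \<le> ennreal (b + \<beta>)"
    using eA eB AB by simp
  have "ennreal a * emeasure M {f. a \<le> measure_pmf.prob N {x. P f x}}
      = (\<integral>\<^sup>+f. ennreal a * indicator {f. a \<le> measure_pmf.prob N {x. P f x}} f \<partial>M)"
    by (simp add: nn_integral_cmult)
  also have "\<dots> \<le> (\<integral>\<^sup>+f. emeasure N {x. P f x} \<partial>M)"
    by (rule nn_integral_mono) (auto simp: indicator_def measure_pmf.emeasure_eq_measure)
  also note le
  finally have "a * measure_pmf.prob M {f. a \<le> measure_pmf.prob N {x. P f x}} \<le> b + \<beta>"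
    using assms(1,2) \<beta> by (simp add: measure_pmf.emeasure_eq_measure ennreal_mult[symmetric] del: ennreal_plus)
  then show ?thesis using assms(1) by (simp add: field_simps)
qed

lemma prob_Pi_pmf_all:
  assumes "finite I"
  shows "measure_pmf.prob (Pi_pmf I d (\<lambda>_. N)) {x. \<forall>i\<in>I. P (x i)} = measure_pmf.prob N {x. P x} ^ card I"
proof -
  have "{x. \<forall>i\<in>I. P (x i)} = Pi I (\<lambda>_. {x. P x})" by auto
  then show ?thesis using measure_Pi_pmf_Pi[OF assms, of d "\<lambda>_. N" "\<lambda>_. {x. P x}"] by simp
qed

section \<open>Bounded differences inequality for independent Bernoulli variables\<close>

lemma finite_set_Pi_bernoulli [simp]:
  assumes "finite E"
  shows "finite (set_pmf (Pi_pmf E False (\<lambda>_. bernoulli_pmf p)))"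
proof -
  have "finite (PiE_dflt E False (\<lambda>_. UNIV :: bool set))" using assms by (intro finite_PiE_dflt) auto
  moreover have "set_pmf (Pi_pmf E False (\<lambda>_. bernoulli_pmf p)) \<subseteq> PiE_dflt E False (\<lambda>_. UNIV)"
    using set_Pi_pmf_subset[OF assms, of False "\<lambda>_. bernoulli_pmf p"] by (auto simp: PiE_dflt_def subset_iff)
  ultimately show ?thesis by (rule rev_finite_subset)
qed

lemma expectation_Pi_bernoulli_insert:
  fixes f :: "('a \<Rightarrow> bool) \<Rightarrow> real"
  assumes "finite E" "e \<notin> E" "0 \<le> p" "p \<le> 1"
  shows "measure_pmf.expectation (Pi_pmf (insert e E) False (\<lambda>_. bernoulli_pmf p)) f =
    p * measure_pmf.expectation (Pi_pmf E False (\<lambda>_. bernoulli_pmf p)) (\<lambda>g. f (g(e := True))) +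
    (1 - p) * measure_pmf.expectation (Pi_pmf E False (\<lambda>_. bernoulli_pmf p)) (\<lambda>g. f (g(e := False)))"
proof -
  let ?N = "Pi_pmf E False (\<lambda>_. bernoulli_pmf p)"
  have eq: "Pi_pmf (insert e E) False (\<lambda>_. bernoulli_pmf p) =
      bind_pmf (bernoulli_pmf p) (\<lambda>y. map_pmf (\<lambda>g. g(e := y)) ?N)"
    using assms(1,2) by (simp add: Pi_pmf_insert' map_pmf_def)
  have "measure_pmf.expectation (bind_pmf (bernoulli_pmf p) (\<lambda>y. map_pmf (\<lambda>g. g(e := y)) ?N)) f =
    (\<Sum>a\<in>UNIV. pmf (bernoulli_pmf p) a *\<^sub>R measure_pmf.expectation (map_pmf (\<lambda>g. g(e := a)) ?N) f)"
    using assms by (intro pmf_expectation_bind) auto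
  then show ?thesis unfolding eq using assms by (simp add: UNIV_bool)
qed

text \<open>This is Hoeffding's lemma for a two-point variable: after centring, only the spread
  \<open>u - v\<close> matters. If \<open>v > u\<close>, the values and the weights
  \<open>p\<close>, \<open>1 - p\<close> trade places.\<close>

lemma bernoulli_mgf_le:
  fixes p u v :: real
  assumes "0 \<le> p" "p \<le> 1"
  shows "p * exp (u - (p * u + (1 - p) * v)) + (1 - p) * exp (v - (p * u + (1 - p) * v))
    \<le> exp ((u - v)\<^sup>2 / 8)"
proof -
  have *: "p * exp (u - (p * u + (1 - p) * v)) + (1 - p) * exp (v - (p * u + (1 - p) * v))
    \<le> exp ((u - v)\<^sup>2 / 8)" if "0 \<le> p" "p \<le> 1" "v \<le> u" for p u v :: real
  proof -
    define h where "h = u - v"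
    have h: "h \<ge> 0" using that by (simp add: h_def)
    have pos: "1 + p * (exp h - 1) > 0"
      using that h by (smt (verit) mult_nonneg_nonneg one_le_exp_iff)
    have "p * exp (u - (p * u + (1 - p) * v)) + (1 - p) * exp (v - (p * u + (1 - p) * v))
       = exp (- h * p) * (1 + p * (exp h - 1))"
      by (simp add: h_def algebra_simps exp_diff exp_add exp_minus) (simp add: field_simps)
    also have "\<dots> = exp (- h * p + ln (1 + p * (exp h - 1)))"
      using pos by (simp only: exp_add exp_ln)
    also have "\<dots> \<le> exp (h\<^sup>2 / 8)"
      using Hoeffdings_lemma_aux[OF h that(1)] by simp
    finally show ?thesis by (simp add: h_def)
  qed
  show ?thesis
  proof (cases "v \<le> u")
    case True then show ?thesis using * assms by blast
  next
    case False
    then show ?thesis using *[of "1 - p" u v] assms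
      by (simp add: add.commute power2_commute)
  qed
qed

text \<open>The coordinates are split off one by one. Given the value at \<open>x\<close>, the
  conditional mean is a two-point variable of spread at most \<open>c x\<close>, which Hoeffding's
  lemma handles; the fluctuation around each conditional mean is covered by the induction
  hypothesis.\<close>

lemma bounded_differences_mgf:
  fixes f :: "('a \<Rightarrow> bool) \<Rightarrow> real"
  assumes "finite E" "0 \<le> p" "p \<le> 1"
    and "\<And>e g. e \<in> E \<Longrightarrow> \<bar>f (g(e := True)) - f (g(e := False))\<bar> \<le> c e"
  defines "N \<equiv> \<lambda>E. Pi_pmf E False (\<lambda>_. bernoulli_pmf p)"
  shows "measure_pmf.expectation (N E) (\<lambda>g. exp (f g - measure_pmf.expectation (N E) f))
    \<le> exp ((\<Sum>e\<in>E. (c e)\<^sup>2) / 8)"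
  using assms(1,4)
proof (induction E arbitrary: f rule: finite_induct)
  case empty
  then show ?case by (simp add: N_def)
next
  case (insert x E)
  define F where "F = (\<lambda>b g. f (g(x := b)))"
  define \<mu> where "\<mu> b = measure_pmf.expectation (N E) (F b)" for b
  let ?\<mu> = "measure_pmf.expectation (N (insert x E)) f"
  have ins: "measure_pmf.expectation (N (insert x E)) k = p * measure_pmf.expectation (N E) (\<lambda>g. k (g(x := True))) +
    (1 - p) * measure_pmf.expectation (N E) (\<lambda>g. k (g(x := False)))" for k :: "_ \<Rightarrow> real"
    unfolding N_def by (rule expectation_Pi_bernoulli_insert[OF insert(1,2) assms(2,3)])
  have \<mu>: "?\<mu> = p * \<mu> True + (1 - p) * \<mu> False" unfolding ins by (simp add: \<mu>_def F_def)
  have fin: "finite (set_pmf (N E))" unfolding N_def using insert(1) by simp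
  \<comment> \<open>The two conditional means are compared on the same sample of the remaining
    coordinates.\<close>
  have diff: "\<bar>\<mu> True - \<mu> False\<bar> \<le> c x"
  proof -
    have "\<mu> True - \<mu> False = measure_pmf.expectation (N E) (\<lambda>g. F True g - F False g)"
      unfolding \<mu>_def using fin by (subst Bochner_Integration.integral_diff) (auto intro: integrable_measure_pmf_finite)
    moreover have "\<bar>\<dots>\<bar> \<le> c x"
    proof -
      have "\<bar>measure_pmf.expectation (N E) (\<lambda>g. F True g - F False g)\<bar>
          \<le> measure_pmf.expectation (N E) (\<lambda>g. \<bar>F True g - F False g\<bar>)"
        by (rule integral_abs_bound)
      also have "\<dots> \<le> measure_pmf.expectation (N E) (\<lambda>g. c x)"
        using fin insert.prems by (intro integral_mono integrable_measure_pmf_finite) (auto simp: F_def simp del: fun_upd_apply)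
      finally show ?thesis by simp
    qed
    ultimately show ?thesis by simp
  qed
  have IH: "measure_pmf.expectation (N E) (\<lambda>g. exp (F b g - \<mu> b)) \<le> exp ((\<Sum>e\<in>E. (c e)\<^sup>2) / 8)" for b
    unfolding \<mu>_def
  proof (rule insert.IH)
    fix e g assume e: "e \<in> E"
    then have "e \<noteq> x" using insert by auto
    then show "\<bar>F b (g(e := True)) - F b (g(e := False))\<bar> \<le> c e"
      using insert.prems[of e "g(x := b)"] e by (simp add: F_def fun_upd_twist del: fun_upd_apply)
  qed
  have step: "measure_pmf.expectation (N E) (\<lambda>g. exp (F b g - ?\<mu>))
      \<le> exp (\<mu> b - ?\<mu>) * exp ((\<Sum>e\<in>E. (c e)\<^sup>2) / 8)" for b
  proof -
    have "measure_pmf.expectation (N E) (\<lambda>g. exp (F b g - ?\<mu>)) =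
       measure_pmf.expectation (N E) (\<lambda>g. exp (\<mu> b - ?\<mu>) * exp (F b g - \<mu> b))"
      by (simp add: exp_diff)
    also have "\<dots> = exp (\<mu> b - ?\<mu>) * measure_pmf.expectation (N E) (\<lambda>g. exp (F b g - \<mu> b))"
      by simp
    finally show ?thesis using IH[of b] by simp
  qed
  have "measure_pmf.expectation (N (insert x E)) (\<lambda>g. exp (f g - ?\<mu>)) =
     p * measure_pmf.expectation (N E) (\<lambda>g. exp (F True g - ?\<mu>)) +
     (1 - p) * measure_pmf.expectation (N E) (\<lambda>g. exp (F False g - ?\<mu>))"
    by (subst ins) (simp add: F_def)
  also have "\<dots> \<le> p * (exp (\<mu> True - ?\<mu>) * exp ((\<Sum>e\<in>E. (c e)\<^sup>2) / 8)) +
     (1 - p) * (exp (\<mu> False - ?\<mu>) * exp ((\<Sum>e\<in>E. (c e)\<^sup>2) / 8))"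
    using assms(2,3) by (intro add_mono mult_left_mono step) auto
  also have "\<dots> = (p * exp (\<mu> True - ?\<mu>) + (1 - p) * exp (\<mu> False - ?\<mu>)) * exp ((\<Sum>e\<in>E. (c e)\<^sup>2) / 8)"
    by (simp add: algebra_simps)
  also have "\<dots> \<le> exp ((\<mu> True - \<mu> False)\<^sup>2 / 8) * exp ((\<Sum>e\<in>E. (c e)\<^sup>2) / 8)"
    unfolding \<mu> using assms(2,3) by (intro mult_right_mono bernoulli_mgf_le) auto
  also have "\<dots> \<le> exp ((c x)\<^sup>2 / 8) * exp ((\<Sum>e\<in>E. (c e)\<^sup>2) / 8)"
    using diff by (intro mult_right_mono) (auto simp: abs_le_square_iff[symmetric])
  also have "\<dots> = exp ((\<Sum>e\<in>insert x E. (c e)\<^sup>2) / 8)"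
    using insert(1,2) by (simp add: exp_add[symmetric] add_divide_distrib)
  finally show ?case .
qed

lemma McDiarmid_bernoulli:
  fixes f :: "('a \<Rightarrow> bool) \<Rightarrow> real"
  assumes "finite E" "0 \<le> p" "p \<le> 1" "0 \<le> t"
    and "\<And>e g. e \<in> E \<Longrightarrow> \<bar>f (g(e := True)) - f (g(e := False))\<bar> \<le> c e"
    and S: "(\<Sum>e\<in>E. (c e)\<^sup>2) \<le> S" "0 < S"
  defines "N \<equiv> Pi_pmf E False (\<lambda>_. bernoulli_pmf p)"
  shows "measure_pmf.prob N {g. t \<le> f g - measure_pmf.expectation N f} \<le> exp (- 2 * t\<^sup>2 / S)"
proof -
  \<comment> \<open>This value minimises the Chernoff exponent
    \<open>l\<^sup>2 * S / 8 - l * t\<close>.\<close>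
  define l where "l = 4 * t / S"
  have l: "l \<ge> 0" using S assms by (simp add: l_def)
  have fin: "finite (set_pmf N)" unfolding N_def using assms(1) by simp
  define \<mu> where "\<mu> = measure_pmf.expectation N f"
  have mgf: "measure_pmf.expectation N (\<lambda>g. exp (l * (f g - \<mu>))) \<le> exp (l\<^sup>2 * S / 8)"
  proof -
    have "measure_pmf.expectation N (\<lambda>g. exp (l * f g - measure_pmf.expectation N (\<lambda>g. l * f g)))
       \<le> exp ((\<Sum>e\<in>E. (l * c e)\<^sup>2) / 8)"
      unfolding N_def
    proof (rule bounded_differences_mgf[OF assms(1-3)])
      fix e g assume "e \<in> E"
      from mult_left_mono[OF assms(5)[OF this, of g] l]
      show "\<bar>l * f (g(e := True)) - l * f (g(e := False))\<bar> \<le> l * c e"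
        using l by (simp add: right_diff_distrib[symmetric] abs_mult)
    qed
    also have "(\<Sum>e\<in>E. (l * c e)\<^sup>2) = l\<^sup>2 * (\<Sum>e\<in>E. (c e)\<^sup>2)"
      by (simp add: power_mult_distrib sum_distrib_left)
    also have "exp (l\<^sup>2 * (\<Sum>e\<in>E. (c e)\<^sup>2) / 8) \<le> exp (l\<^sup>2 * S / 8)"
      using S by (simp add: mult_left_mono)
    finally show ?thesis by (simp add: \<mu>_def algebra_simps)
  qed
  have "measure_pmf.prob N {g. t \<le> f g - \<mu>} \<le> measure_pmf.prob N {g. exp (l * t) \<le> exp (l * (f g - \<mu>))}"
    using l by (intro measure_pmf.finite_measure_mono) (auto intro: mult_left_mono)
  also have "\<dots> \<le> measure_pmf.expectation N (\<lambda>g. exp (l * (f g - \<mu>))) / exp (l * t)"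
    using integral_Markov_inequality_measure[of "measure_pmf N" "\<lambda>g. exp (l * (f g - \<mu>))" UNIV "exp (l * t)"] fin
    by (auto intro: integrable_measure_pmf_finite)
  also have "\<dots> \<le> exp (l\<^sup>2 * S / 8) / exp (l * t)"
    by (intro divide_right_mono mgf) auto
  also have "\<dots> = exp (- 2 * t\<^sup>2 / S)"
    using S by (simp add: exp_diff[symmetric] l_def power2_eq_square field_simps)
  finally show ?thesis by (simp add: \<mu>_def)
qed

corollary McDiarmid_bernoulli_abs:
  fixes f :: "('a \<Rightarrow> bool) \<Rightarrow> real"
  assumes "finite E" "0 \<le> p" "p \<le> 1" "0 \<le> t"
    and "\<And>e g. e \<in> E \<Longrightarrow> \<bar>f (g(e := True)) - f (g(e := False))\<bar> \<le> c e"
    and "(\<Sum>e\<in>E. (c e)\<^sup>2) \<le> S" "0 < S"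
  defines "N \<equiv> Pi_pmf E False (\<lambda>_. bernoulli_pmf p)"
  shows "measure_pmf.prob N {g. t \<le> \<bar>f g - measure_pmf.expectation N f\<bar>} \<le> 2 * exp (- 2 * t\<^sup>2 / S)"
proof -
  let ?\<mu> = "measure_pmf.expectation N f"
  have m: "measure_pmf.expectation N (\<lambda>g. - f g) = - ?\<mu>" by simp
  have "measure_pmf.prob N {g. t \<le> \<bar>f g - ?\<mu>\<bar>}
     \<le> measure_pmf.prob N ({g. t \<le> f g - ?\<mu>} \<union> {g. t \<le> - f g - measure_pmf.expectation N (\<lambda>g. - f g)})"
    unfolding m by (intro measure_pmf.finite_measure_mono) auto
  also have "\<dots> \<le> measure_pmf.prob N {g. t \<le> f g - ?\<mu>}
     + measure_pmf.prob N {g. t \<le> - f g - measure_pmf.expectation N (\<lambda>g. - f g)}"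
    by (intro measure_Un_le) auto
  also have "\<dots> \<le> exp (- 2 * t\<^sup>2 / S) + exp (- 2 * t\<^sup>2 / S)"
    unfolding N_def
    using McDiarmid_bernoulli[OF assms(1-4), of "\<lambda>g. - f g" c S] McDiarmid_bernoulli[OF assms(1-7)]
    by (intro add_mono) (use assms(5-7) in \<open>auto simp: abs_minus_commute\<close>)
  finally show ?thesis by simp
qed

section \<open>Bernoulli events as weighted families of sets\<close>

lemma prob_Pi_bernoulli_all:
  assumes "finite E" "D \<subseteq> E" "0 \<le> p" "p \<le> 1"
  shows "measure_pmf.prob (Pi_pmf E False (\<lambda>_. bernoulli_pmf p)) {g. \<forall>e\<in>D. g e} = p ^ card D"
proof -
  let ?B = "\<lambda>e. if e \<in> D then {True} else UNIV"
  have "{g. \<forall>e\<in>D. g e} = Pi E ?B" using assms(2) by (auto simp: Pi_def)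
  then have "measure_pmf.prob (Pi_pmf E False (\<lambda>_. bernoulli_pmf p)) {g. \<forall>e\<in>D. g e} =
      (\<Prod>e\<in>E. measure_pmf.prob (bernoulli_pmf p) (?B e))"
    using assms(1) by (simp only: measure_Pi_pmf_Pi)
  also have "\<dots> = (\<Prod>e\<in>E. if e \<in> D then p else 1)"
    using assms by (intro prod.cong) (auto simp: measure_pmf_single)
  also have "\<dots> = p ^ card D"
    using assms by (simp add: prod.If_cases Int_absorb1)
  finally show ?thesis .
qed

text \<open>The weight of a set depends only on its size. Both the LYM bound and the conditioning on
  a degree rest on this.\<close>

lemma prob_Pi_bernoulli_set:
  assumes "finite E" "0 \<le> p" "p \<le> 1"
  shows "measure_pmf.prob (Pi_pmf E False (\<lambda>_. bernoulli_pmf p)) {g. P {e\<in>E. g e}} =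
    (\<Sum>S | S \<subseteq> E \<and> P S. p ^ card S * (1 - p) ^ (card E - card S))"
proof -
  let ?N = "Pi_pmf E False (\<lambda>_. bernoulli_pmf p)"
  have fin: "finite {S. S \<subseteq> E \<and> P S}" using assms(1) by simp
  have "{g. P {e\<in>E. g e}} = (\<Union>S\<in>{S. S \<subseteq> E \<and> P S}. {g. {e\<in>E. g e} = S})" by auto
  then have "measure_pmf.prob ?N {g. P {e\<in>E. g e}} =
      (\<Sum>S | S \<subseteq> E \<and> P S. measure_pmf.prob ?N {g. {e\<in>E. g e} = S})"
    using fin by (auto simp: disjoint_family_on_def intro!: measure_pmf.finite_measure_finite_Union)
  also have "\<dots> = (\<Sum>S | S \<subseteq> E \<and> P S. p ^ card S * (1 - p) ^ (card E - card S))"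
  proof (intro sum.cong refl)
    fix S assume "S \<in> {S. S \<subseteq> E \<and> P S}"
    then have S: "S \<subseteq> E" by auto
    let ?B = "\<lambda>e. {e \<in> S}"
    have "{g. {e\<in>E. g e} = S} = Pi E ?B" using S by (auto simp: Pi_def)
    then have "measure_pmf.prob ?N {g. {e\<in>E. g e} = S} =
        (\<Prod>e\<in>E. measure_pmf.prob (bernoulli_pmf p) (?B e))"
      using assms(1) by (simp only: measure_Pi_pmf_Pi)
    also have "\<dots> = (\<Prod>e\<in>E. if e \<in> S then p else 1 - p)"
      using assms by (intro prod.cong) (auto simp: measure_pmf_single)
    also have "\<dots> = p ^ card S * (1 - p) ^ (card E - card S)"
      using assms S finite_subset[OF S]
      by (simp add: prod.If_cases Int_absorb1 Diff_eq[symmetric] card_Diff_subset)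
    finally show "measure_pmf.prob ?N {g. {e\<in>E. g e} = S} = p ^ card S * (1 - p) ^ (card E - card S)" .
  qed
  finally show ?thesis .
qed

lemma prob_Pi_bernoulli_image:
  assumes "finite U" "inj_on m U" "0 \<le> p" "p \<le> 1"
  shows "measure_pmf.prob (Pi_pmf (m ` U) False (\<lambda>_. bernoulli_pmf p)) {g. P {u\<in>U. g (m u)}} =
    (\<Sum>N | N \<subseteq> U \<and> P N. p ^ card N * (1 - p) ^ (card U - card N))"
proof -
  let ?Q = "\<lambda>S. P {u\<in>U. m u \<in> S}"
  have eq: "P {u\<in>U. g (m u)} \<longleftrightarrow> ?Q {e\<in>m ` U. g e}" for g by (rule arg_cong[of _ _ P]) auto
  have "measure_pmf.prob (Pi_pmf (m ` U) False (\<lambda>_. bernoulli_pmf p)) {g. P {u\<in>U. g (m u)}} =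
    measure_pmf.prob (Pi_pmf (m ` U) False (\<lambda>_. bernoulli_pmf p)) {g. ?Q {e\<in>m ` U. g e}}"
    by (rule arg_cong[OF Collect_cong[OF eq]])
  also have "\<dots> = (\<Sum>S | S \<subseteq> m ` U \<and> ?Q S. p ^ card S * (1 - p) ^ (card (m ` U) - card S))"
    by (rule prob_Pi_bernoulli_set[OF finite_imageI[OF assms(1)] assms(3,4)])
  also have "{S. S \<subseteq> m ` U \<and> ?Q S} = (\<lambda>N. m ` N) ` {N. N \<subseteq> U \<and> P N}"
  proof -
    have inv: "{u\<in>U. m u \<in> m ` N} = N" if "N \<subseteq> U" for N
      using that assms(2) by (auto simp: inj_on_def)
    have "S \<in> (\<lambda>N. m ` N) ` {N. N \<subseteq> U \<and> P N}" if S: "S \<subseteq> m ` U" "?Q S" for S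
    proof -
      from S(1) obtain N where "N \<subseteq> U" "S = m ` N" unfolding subset_image_iff by blast
      then show ?thesis using S(2) inv[of N] by auto
    qed
    moreover have "m ` N \<subseteq> m ` U \<and> ?Q (m ` N)" if "N \<subseteq> U" "P N" for N
      using that inv[of N] by auto
    ultimately show ?thesis by blast
  qed
  also have "(\<Sum>S\<in>(\<lambda>N. m ` N) ` {N. N \<subseteq> U \<and> P N}. p ^ card S * (1 - p) ^ (card (m ` U) - card S)) =
      (\<Sum>N | N \<subseteq> U \<and> P N. p ^ card N * (1 - p) ^ (card U - card N))"
  proof (subst sum.reindex)
    show "inj_on ((`) m) {N. N \<subseteq> U \<and> P N}"
      using inj_on_image_eq_iff[OF assms(2)] by (auto intro!: inj_onI)
  qed (use assms(2) in \<open>auto intro!: sum.cong simp: card_image inj_on_subset\<close>)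
  finally show ?thesis .
qed

text \<open>Since the sets \<open>D y\<close> are disjoint, one coordinate affects at most one
  \<open>y\<close>, so the sum of the squared influences is at most \<open>card Y * j\<close>. The
  free bound \<open>S\<close> keeps the exponent meaningful when \<open>j = 0\<close>.\<close>

lemma count_deviation:
  assumes "finite E" "finite Y" "0 \<le> p" "p \<le> 1" "0 \<le> t"
    and D: "\<And>y. y \<in> Y \<Longrightarrow> D y \<subseteq> E" "\<And>y. y \<in> Y \<Longrightarrow> card (D y) = j" "disjoint_family_on D Y"
    and S: "real (card Y) * real j \<le> S" "0 < S"
  shows "measure_pmf.prob (Pi_pmf E False (\<lambda>_. bernoulli_pmf p))
      {g. t \<le> \<bar>real (card {y\<in>Y. \<forall>e\<in>D y. g e}) - real (card Y) * p ^ j\<bar>} \<le> 2 * exp (- 2 * t\<^sup>2 / S)"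
proof -
  let ?N = "Pi_pmf E False (\<lambda>_. bernoulli_pmf p)"
  let ?f = "\<lambda>g. real (card {y\<in>Y. \<forall>e\<in>D y. g e})"
  define c :: "'a \<Rightarrow> real" where "c e = (if e \<in> \<Union> (D ` Y) then 1 else 0)" for e
  have f: "?f g = (\<Sum>y\<in>Y. indicator {g. \<forall>e\<in>D y. g e} g)" for g
  proof -
    have "?f g = (\<Sum>y\<in>{y\<in>Y. \<forall>e\<in>D y. g e}. 1)" by simp
    also have "\<dots> = (\<Sum>y\<in>Y. if \<forall>e\<in>D y. g e then 1 else 0)"
      using assms(2) by (rule sum.inter_filter)
    also have "\<dots> = (\<Sum>y\<in>Y. indicator {g. \<forall>e\<in>D y. g e} g)"
      by (intro sum.cong) (auto simp: indicator_def)
    finally show ?thesis .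
  qed
  have "measure_pmf.expectation ?N ?f =
      (\<Sum>y\<in>Y. measure_pmf.expectation ?N (indicator {g. \<forall>e\<in>D y. g e}))"
    unfolding f using assms(1) by (simp add: Bochner_Integration.integral_sum integrable_measure_pmf_finite)
  also have "\<dots> = (\<Sum>y\<in>Y. p ^ j)"
    using prob_Pi_bernoulli_all[OF assms(1) D(1) assms(3,4)] D(2) by (intro sum.cong) auto
  finally have E: "measure_pmf.expectation ?N ?f = real (card Y) * p ^ j" by simp
  have "(\<Sum>e\<in>E. (c e)\<^sup>2) = (\<Sum>e\<in>E. if e \<in> \<Union> (D ` Y) then 1 else 0)"
    by (intro sum.cong) (auto simp: c_def)
  also have "\<dots> = real (card (E \<inter> \<Union> (D ` Y)))" (is "_ = real (card (E \<inter> ?D))")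
    using sum.If_cases[OF assms(1), of "\<lambda>e. e \<in> ?D" "\<lambda>_. 1 :: real" "\<lambda>_. 0"]
    by (simp only: Collect_mem_eq) simp
  also have "E \<inter> \<Union> (D ` Y) = \<Union> (D ` Y)" using D(1) by auto
  also have "card (\<Union> (D ` Y)) \<le> (\<Sum>y\<in>Y. card (D y))" using assms(2) by (rule card_UN_le)
  also have "\<dots> = card Y * j" using D(2) by simp
  finally have S': "(\<Sum>e\<in>E. (c e)\<^sup>2) \<le> S" using S by simp
  have diff: "\<bar>?f (g(e := True)) - ?f (g(e := False))\<bar> \<le> c e" for e g
  proof -
    let ?T = "{y\<in>Y. \<forall>e'\<in>D y. (g(e := True)) e'}" and ?F = "{y\<in>Y. \<forall>e'\<in>D y. (g(e := False)) e'}"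
    have fin: "finite ?T" "finite ?F" using assms(2) by auto
    have sub: "?F \<subseteq> ?T" by auto
    have "?T - ?F \<subseteq> {y\<in>Y. e \<in> D y}" by (auto split: if_splits)
    then have le: "card (?T - ?F) \<le> card {y\<in>Y. e \<in> D y}" using assms(2) by (intro card_mono) auto
    have "real (card {y\<in>Y. e \<in> D y}) \<le> c e"
    proof (cases "e \<in> \<Union> (D ` Y)")
      case True
      then obtain y where "y \<in> Y" "e \<in> D y" by auto
      with D(3) have "{y\<in>Y. e \<in> D y} = {y}" by (auto simp: disjoint_family_on_def)
      then show ?thesis using True by (simp add: c_def)
    next
      case False
      then have none: "{y\<in>Y. e \<in> D y} = {}" by auto
      show ?thesis unfolding none by (simp add: c_def)
    qed
    moreover have "\<bar>real (card ?T) - real (card ?F)\<bar> = real (card (?T - ?F))"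
      using sub fin card_mono[OF fin(1) sub] by (simp add: card_Diff_subset of_nat_diff)
    ultimately show ?thesis using le by linarith
  qed
  show ?thesis
    using McDiarmid_bernoulli_abs[OF assms(1,3,4,5) diff S' S(2)] unfolding E .
qed

section \<open>Small ball probabilities for monotone functions\<close>

lemma mono_of_increments:
  fixes \<phi> :: "'a set \<Rightarrow> real"
  assumes "finite B" "A \<subseteq> B" "0 \<le> \<Delta>"
    and "\<And>C e. C \<subseteq> B \<Longrightarrow> e \<in> B - C \<Longrightarrow> \<phi> C + \<Delta> \<le> \<phi> (insert e C)"
  shows "\<phi> A \<le> \<phi> B"
proof -
  have "\<phi> A \<le> \<phi> (A \<union> D)" if "finite D" "D \<subseteq> B - A" for D
    using that
  proof (induction D rule: finite_induct)
    case (insert x D)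
    then have "\<phi> (A \<union> D) + \<Delta> \<le> \<phi> (insert x (A \<union> D))" using assms(2) by (intro assms(4)) auto
    then show ?case using insert assms(3) by simp
  qed simp
  from this[of "B - A"] show ?thesis using assms(1,2) by (simp add: Un_absorb1)
qed

text \<open>\<open>1 / (card E choose card A)\<close> is the probability that a random maximal chain
  of subsets of \<open>E\<close> passes through \<open>A\<close>. Such a chain deletes a uniform
  \<open>x\<close> from \<open>E\<close> and continues inside \<open>E - {x}\<close>; it can meet
  the proper subset \<open>A\<close> only if \<open>x\<close> is not in \<open>A\<close>.\<close>

lemma inverse_binomial_average:
  assumes "finite E" "A \<subset> E"
  shows "1 / real (card E choose card A) = (\<Sum>x\<in>E - A. 1 / (real (card E) * real (card (E - {x}) choose card A)))"
proof -
  have lt: "card A < card E" using assms by (rule psubset_card_mono)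
  then obtain N where N: "card E = Suc N" by (cases "card E") auto
  have le: "card A \<le> N" using lt N by simp
  have "(\<Sum>x\<in>E - A. 1 / (real (card E) * real (card (E - {x}) choose card A)))
      = (\<Sum>x\<in>E - A. 1 / (real (Suc N) * real (N choose card A)))"
    using assms N by (intro sum.cong) auto
  also have "\<dots> = real (Suc N - card A) / (real (Suc N) * real (N choose card A))"
  proof -
    have "finite A" using assms by (auto dest: finite_subset)
    then have "card (E - A) = Suc N - card A" using assms N by (simp add: card_Diff_subset psubset_imp_subset)
    then show ?thesis by simp
  qed
  also have "\<dots> = 1 / real (Suc N choose card A)"
  proof -
    have "Suc N * (N choose card A) = (Suc N - card A) * (Suc N choose card A)"
      using binomial_absorb_comp[of "Suc N" "card A"] by simp
    then have "real (Suc N) * real (N choose card A) = real (Suc N - card A) * real (Suc N choose card A)"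
      by (metis of_nat_mult)
    moreover have "real (Suc N - card A) \<noteq> 0" using le by simp
    ultimately show ?thesis by (simp add: divide_simps)
  qed
  finally show ?thesis using N by simp
qed

text \<open>A family whose members have \<open>\<phi>\<close>-values in a window of length less than \<open>L * \<Delta>\<close> contains no
  chain of length \<open>L + 1\<close>; this is the LYM inequality for such a family.\<close>

lemma LYM_increments:
  fixes \<phi> :: "'a set \<Rightarrow> real"
  assumes "finite E" "0 < \<Delta>" "b < a + real L * \<Delta>"
    and "\<And>C e. C \<subseteq> E \<Longrightarrow> e \<in> E - C \<Longrightarrow> \<phi> C + \<Delta> \<le> \<phi> (insert e C)"
  shows "(\<Sum>A | A \<subseteq> E \<and> a \<le> \<phi> A \<and> \<phi> A \<le> b. 1 / real (card E choose card A)) \<le> real L"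
  using assms(1,3,4)
proof (induction E arbitrary: b L rule: finite_psubset_induct)
  case (psubset E)
  define fam where "fam D b = {A. A \<subseteq> D \<and> a \<le> \<phi> A \<and> \<phi> A \<le> b}" for D b
  have fin: "finite (fam D b)" if "finite D" for D b using that by (simp add: fam_def)
  \<comment> \<open>The proper members are averaged over the deleted element. The end point
    \<open>b'\<close> and the length \<open>L'\<close> stay free because the window shrinks when
    \<open>E\<close> itself is a member.\<close>
  have proper: "(\<Sum>A\<in>fam E b - {E}. 1 / real (card E choose card A)) \<le> real L'"
    if b': "b' < a + real L' * \<Delta>" and sub: "\<And>x. x \<in> E \<Longrightarrow> fam (E - {x}) b \<subseteq> fam (E - {x}) b'" for b' L'
  proof (cases "E = {}")
    case True
    then have "fam E b - {E} = {}" by (auto simp: fam_def)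
    then show ?thesis by (simp only: sum.empty of_nat_0_le_iff)
  next
    case False
    let ?w = "\<lambda>x A. 1 / (real (card E) * real (card (E - {x}) choose card A))"
    have "(\<Sum>A\<in>fam E b - {E}. 1 / real (card E choose card A)) = (\<Sum>A\<in>fam E b - {E}. \<Sum>x\<in>E - A. ?w x A)"
      using psubset(1) by (intro sum.cong inverse_binomial_average) (auto simp: fam_def)
    also have "\<dots> = (\<Sum>x\<in>E. \<Sum>A\<in>{A \<in> fam E b - {E}. x \<notin> A}. ?w x A)"
    proof -
      have "(\<Sum>A\<in>fam E b - {E}. \<Sum>x\<in>E - A. ?w x A) = (\<Sum>A\<in>fam E b - {E}. \<Sum>x\<in>{x\<in>E. x \<notin> A}. ?w x A)"
        by (intro sum.cong) auto
      then show ?thesis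
        using sum.swap_restrict[of "fam E b - {E}" E "\<lambda>A x. ?w x A" "\<lambda>A x. x \<notin> A"] fin[of E b] psubset(1)
        by simp
    qed
    also have "\<dots> \<le> (\<Sum>x\<in>E. real L' / real (card E))"
    proof (intro sum_mono)
      fix x assume x: "x \<in> E"
      have "{A \<in> fam E b - {E}. x \<notin> A} = fam (E - {x}) b" using x by (auto simp: fam_def)
      also have "\<dots> \<subseteq> fam (E - {x}) b'" using sub x by blast
      finally have "(\<Sum>A\<in>{A \<in> fam E b - {E}. x \<notin> A}. ?w x A) \<le> (\<Sum>A\<in>fam (E - {x}) b'. ?w x A)"
        using psubset(1) fin by (intro sum_mono2) auto
      also have "\<dots> = (\<Sum>A\<in>fam (E - {x}) b'. 1 / real (card (E - {x}) choose card A)) / real (card E)"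
        by (simp add: sum_divide_distrib mult.commute)
      also have "\<dots> \<le> real L' / real (card E)"
        unfolding fam_def using x psubset.prems b'
        by (intro divide_right_mono psubset.IH) auto
      finally show "(\<Sum>A\<in>{A \<in> fam E b - {E}. x \<notin> A}. ?w x A) \<le> real L' / real (card E)" .
    qed
    also have "\<dots> = real L'" using False psubset(1) by simp
    finally show ?thesis .
  qed
  show ?case
  proof (cases "E \<in> fam E b")
    case False
    then have "(\<Sum>A\<in>fam E b. 1 / real (card E choose card A)) \<le> real L"
      using proper[of b L] psubset.prems(1) by simp
    then show ?thesis by (simp add: fam_def)
  next
    case True
    then have E: "a \<le> \<phi> E" "\<phi> E \<le> b" by (auto simp: fam_def)
    with psubset.prems(1) have "L \<noteq> 0" by (cases "L = 0") auto
    then obtain L' where L: "L = Suc L'" by (cases L) auto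
    \<comment> \<open>\<open>E\<close> has LYM weight 1. Every other member lies at least
      \<open>\<Delta>\<close> below \<open>\<phi> E\<close>, so the window can be shortened by
      \<open>\<Delta>\<close>, and the length lost pays for \<open>E\<close>.\<close>
    have "(\<Sum>A\<in>fam E b - {E}. 1 / real (card E choose card A)) \<le> real L'"
    proof (rule proper[of "b - \<Delta>"])
      show "b - \<Delta> < a + real L' * \<Delta>" using psubset.prems(1) L by (simp add: algebra_simps)
      fix x assume x: "x \<in> E"
      show "fam (E - {x}) b \<subseteq> fam (E - {x}) (b - \<Delta>)"
      proof
        fix A assume A: "A \<in> fam (E - {x}) b"
        have "\<phi> A \<le> \<phi> (E - {x})"
          using A psubset(1) psubset.prems(2) assms(2)
          by (intro mono_of_increments[of _ _ \<Delta>]) (auto simp: fam_def)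
        also have "\<phi> (E - {x}) + \<Delta> \<le> \<phi> (insert x (E - {x}))" using x by (intro psubset.prems(2)) auto
        also have "insert x (E - {x}) = E" using x by auto
        finally have "\<phi> A \<le> b - \<Delta>" using E by linarith
        then show "A \<in> fam (E - {x}) (b - \<Delta>)" using A by (auto simp: fam_def)
      qed
    qed
    then have "(\<Sum>A\<in>fam E b. 1 / real (card E choose card A)) \<le> real L"
      using sum.remove[OF fin[OF psubset(1), of b] True, of "\<lambda>A. 1 / real (card E choose card A)"] L by simp
    then show ?thesis by (simp add: fam_def)
  qed
qed

text \<open>Starting from \<open>j\<close>, the binomial probabilities stay within a factor of two for about
  \<open>sqrt N\<close> steps in the direction of the mean.\<close>

lemma binomial_point_bound_aux:
  fixes p :: real
  assumes "0 < p" "p < 1" "1 \<le> N" "real j \<le> real N * p"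
  shows "real (N choose j) * p ^ j * (1 - p) ^ (N - j) \<le> 4 / sqrt (p * (1 - p)) / sqrt (real N)"
proof -
  define \<beta> where "\<beta> i = real (N choose i) * p ^ i * (1 - p) ^ (N - i)" for i
  define V where "V = real N * p * (1 - p)"
  have V: "V > 0" using assms by (simp add: V_def)
  define x where "x = sqrt V"
  have x: "x > 0" "x * x = V" using V by (simp_all add: x_def)
  \<comment> \<open>Half the standard deviation, rounded down.\<close>
  define s where "s = nat \<lfloor>x / 2\<rfloor>"
  have s: "real s \<le> x / 2" "x / 2 < real s + 1" using x unfolding s_def by linarith+
  have ss: "real s * (real s + 1) \<le> V / 2"
  proof (cases "s = 0")
    case True then show ?thesis using V by simp
  next
    case False
    then have "real s + 1 \<le> x" using s by linarith
    then have "real s * (real s + 1) \<le> x / 2 * x" using s x by (intro mult_mono) auto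
    then show ?thesis using x by simp
  qed
  \<comment> \<open>A bound for the relative loss of one step taken no further than \<open>s\<close>
    beyond the mean; \<open>s\<close> such steps together lose at most one half.\<close>
  define \<delta> where "\<delta> = (real s + 1) / V"
  have \<delta>: "0 \<le> \<delta>" "real s * \<delta> \<le> 1 / 2" using ss V by (simp_all add: \<delta>_def field_simps)
  have \<beta>0: "0 \<le> \<beta> i" for i using assms by (simp add: \<beta>_def)
  \<comment> \<open>The ratio of consecutive terms, multiplied out so that it also holds for
    \<open>m \<ge> N\<close>, where both sides vanish.\<close>
  have rec: "\<beta> (Suc m) * (real (Suc m) * (1 - p)) = \<beta> m * ((real N - real m) * p)" for m
  proof (cases "m < N")
    case True
    have "Suc m * (N choose Suc m) = (N - m) * (N choose m)"
      using binomial_absorption[of m "N"] binomial_absorb_comp[of N m] by simp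
    then have e: "real (Suc m) * real (N choose Suc m) = (real N - real m) * real (N choose m)"
      using True by (metis of_nat_diff of_nat_mult less_imp_le)
    have q: "(1 - p) ^ (N - m) = (1 - p) * (1 - p) ^ (N - Suc m)"
      using True by (metis Suc_diff_Suc power_Suc)
    have "\<beta> (Suc m) * (real (Suc m) * (1 - p)) =
      (real (Suc m) * real (N choose Suc m)) * p ^ Suc m * ((1 - p) * (1 - p) ^ (N - Suc m))"
      by (simp only: \<beta>_def mult_ac)
    also have "\<dots> = \<beta> m * ((real N - real m) * p)"
      unfolding e q[symmetric] \<beta>_def by (simp add: mult_ac)
    finally show ?thesis .
  next
    case False
    then show ?thesis by (cases "m = N") (simp_all add: \<beta>_def binomial_eq_0)
  qed
  have step: "(1 - \<delta>) * \<beta> m \<le> \<beta> (Suc m)" if m: "real m \<le> real N * p + real s" for m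
  proof -
    have "(1 - \<delta>) * (real (Suc m) * (1 - p)) \<le> (real N - real m) * p"
    proof (cases "real m + 1 \<le> real N * p")
      case True
      have "0 \<le> \<delta> * (real (Suc m) * (1 - p))" using \<delta> assms by simp
      then have "(1 - \<delta>) * (real (Suc m) * (1 - p)) \<le> real (Suc m) * (1 - p)"
        by (simp add: algebra_simps)
      also have "\<dots> \<le> (real N - real m) * p" using True assms(1) by (simp add: algebra_simps)
      finally show ?thesis .
    next
      case False
      then have "real N * p * (1 - p) \<le> (real m + 1) * (1 - p)" using assms by (intro mult_right_mono) auto
      then have "\<delta> * V \<le> \<delta> * (real (Suc m) * (1 - p))" unfolding V_def using \<delta> by (intro mult_left_mono) (auto simp: add.commute)
      moreover have "\<delta> * V = real s + 1" using V by (simp add: \<delta>_def)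
      moreover have "real (Suc m) * (1 - p) - (real N - real m) * p = real m + 1 - p - real N * p"
        by (simp add: algebra_simps)
      ultimately show ?thesis using m assms(1) by (simp add: left_diff_distrib)
    qed
    then have "\<beta> m * ((1 - \<delta>) * (real (Suc m) * (1 - p))) \<le> \<beta> (Suc m) * (real (Suc m) * (1 - p))"
      unfolding rec using \<beta>0 by (intro mult_left_mono) auto
    then have "((1 - \<delta>) * \<beta> m) * (real (Suc m) * (1 - p)) \<le> \<beta> (Suc m) * (real (Suc m) * (1 - p))"
      by (simp only: mult_ac)
    moreover have "real (Suc m) * (1 - p) > 0" using assms by simp
    ultimately show ?thesis by (simp only: mult_le_cancel_right_pos)
  qed
  have iter: "(1 - real i * \<delta>) * \<beta> j \<le> \<beta> (j + i)" if "i \<le> s" for i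
    using that
  proof (induction i)
    case (Suc i)
    have 1: "0 \<le> real i * \<delta>" using \<delta> by simp
    have "real (Suc i) * \<delta> \<le> real s * \<delta>" using Suc \<delta> by (intro mult_right_mono) auto
    moreover have "real (Suc i) * \<delta> = real i * \<delta> + \<delta>" by (simp add: algebra_simps)
    ultimately have 2: "\<delta> \<le> 1" using 1 \<delta> by linarith
    have "(1 - real (Suc i) * \<delta>) \<le> (1 - \<delta>) * (1 - real i * \<delta>)" using \<delta> 1 by (simp add: algebra_simps)
    then have "(1 - real (Suc i) * \<delta>) * \<beta> j \<le> (1 - \<delta>) * (1 - real i * \<delta>) * \<beta> j"
      using \<beta>0 by (intro mult_right_mono) auto
    also have "\<dots> = (1 - \<delta>) * ((1 - real i * \<delta>) * \<beta> j)" by simp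
    also have "\<dots> \<le> (1 - \<delta>) * \<beta> (j + i)" using Suc 2 by (intro mult_left_mono) auto
    also have "\<dots> \<le> \<beta> (Suc (j + i))" using Suc.prems assms(4) by (intro step) auto
    finally show ?case by simp
  qed simp
  \<comment> \<open>The \<open>s + 1\<close> terms starting at \<open>j\<close> are each at least
    \<open>\<beta> j / 2\<close>, and the total mass is 1.\<close>
  have "real (Suc s) * (\<beta> j / 2) = (\<Sum>i\<le>s. \<beta> j / 2)" by simp
  also have "\<dots> \<le> (\<Sum>i\<le>s. \<beta> (j + i))"
  proof (intro sum_mono)
    fix i assume "i \<in> {..s}"
    then have i: "i \<le> s" by simp
    have "real i * \<delta> \<le> real s * \<delta>" using i \<delta> by (intro mult_right_mono) auto
    then have "1 / 2 * \<beta> j \<le> (1 - real i * \<delta>) * \<beta> j" using \<beta>0 \<delta> by (intro mult_right_mono) auto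
    with iter[OF i] show "\<beta> j / 2 \<le> \<beta> (j + i)" by simp
  qed
  also have "\<dots> = sum \<beta> ((+) j ` {..s})" by (subst sum.reindex) auto
  also have "\<dots> \<le> sum \<beta> {..N}"
  proof -
    have "sum \<beta> ((+) j ` {..s}) = sum \<beta> ((+) j ` {..s} \<inter> {..N})"
      by (rule sum.mono_neutral_right) (auto simp: \<beta>_def)
    also have "\<dots> \<le> sum \<beta> {..N}" using \<beta>0 by (intro sum_mono2) auto
    finally show ?thesis .
  qed
  also have "\<dots> = (p + (1 - p)) ^ N" unfolding \<beta>_def by (subst binomial_ring) (simp add: mult_ac)
  also have "\<dots> = 1" by simp
  finally have "real (Suc s) * \<beta> j \<le> 2" by simp
  moreover have "x / 2 * \<beta> j \<le> real (Suc s) * \<beta> j" using s \<beta>0 by (intro mult_right_mono) auto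
  ultimately have "x * \<beta> j \<le> 4" by linarith
  then have "\<beta> j \<le> 4 / x" using x by (simp add: field_simps)
  also have "x = sqrt (p * (1 - p)) * sqrt (real N)" by (simp add: x_def V_def real_sqrt_mult mult_ac)
  finally show ?thesis by (simp add: \<beta>_def)
qed

lemma binomial_point_bound:
  fixes p :: real
  assumes "0 < p" "p < 1" "1 \<le> N" "j \<le> N"
  shows "real (N choose j) * p ^ j * (1 - p) ^ (N - j) \<le> 4 / sqrt (p * (1 - p)) / sqrt (real N)"
proof (cases "real j \<le> real N * p")
  case True
  then show ?thesis using binomial_point_bound_aux assms by blast
next
  case False
  then have "real (N - j) \<le> real N * (1 - p)" using assms by (simp add: algebra_simps)
  from binomial_point_bound_aux[OF _ _ assms(3) this] assms
  show ?thesis by (simp add: binomial_symmetric[of j N] mult_ac)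
qed

text \<open>The probability of a set is its LYM weight times a binomial point probability, and the
  latter is at most of order \<open>1 / sqrt (card E)\<close> for every size. Bounding the LYM sum
  rather than the number of sets is what makes the argument work for biased
  \<open>p\<close>.\<close>

lemma small_ball_increments:
  fixes \<phi> :: "'a set \<Rightarrow> real" and p :: real
  assumes "finite E" "E \<noteq> {}" "0 < p" "p < 1" "0 < \<Delta>" "b < a + real L * \<Delta>"
    and "\<And>C e. C \<subseteq> E \<Longrightarrow> e \<in> E - C \<Longrightarrow> \<phi> C + \<Delta> \<le> \<phi> (insert e C)"
  shows "measure_pmf.prob (Pi_pmf E False (\<lambda>_. bernoulli_pmf p)) {g. a \<le> \<phi> {e\<in>E. g e} \<and> \<phi> {e\<in>E. g e} \<le> b}
    \<le> real L * (4 / sqrt (p * (1 - p)) / sqrt (real (card E)))"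
proof -
  let ?N = "card E" and ?K = "4 / sqrt (p * (1 - p)) / sqrt (real (card E))"
  let ?F = "{A. A \<subseteq> E \<and> a \<le> \<phi> A \<and> \<phi> A \<le> b}"
  have N: "1 \<le> ?N" using assms(1,2) by (simp add: Suc_le_eq card_gt_0_iff)
  have "measure_pmf.prob (Pi_pmf E False (\<lambda>_. bernoulli_pmf p)) {g. a \<le> \<phi> {e\<in>E. g e} \<and> \<phi> {e\<in>E. g e} \<le> b}
     = (\<Sum>A\<in>?F. p ^ card A * (1 - p) ^ (?N - card A))"
    using prob_Pi_bernoulli_set[OF assms(1), of p "\<lambda>A. a \<le> \<phi> A \<and> \<phi> A \<le> b"] assms by simp
  also have "\<dots> \<le> (\<Sum>A\<in>?F. 1 / real (?N choose card A) * ?K)"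
  proof (intro sum_mono)
    fix A assume "A \<in> ?F"
    then have le: "card A \<le> ?N" using assms(1) by (auto intro: card_mono)
    then have pos: "0 < real (?N choose card A)" by simp
    from binomial_point_bound[OF assms(3,4) N le]
    have "real (?N choose card A) * (p ^ card A * (1 - p) ^ (?N - card A)) \<le> ?K" by (simp only: mult_ac)
    then have "p ^ card A * (1 - p) ^ (?N - card A) \<le> ?K / real (?N choose card A)"
      using pos by (simp only: pos_le_divide_eq mult.commute)
    then show "p ^ card A * (1 - p) ^ (?N - card A) \<le> 1 / real (?N choose card A) * ?K" by (simp add: mult_ac)
  qed
  also have "\<dots> = (\<Sum>A\<in>?F. 1 / real (?N choose card A)) * ?K" by (rule sum_distrib_right[symmetric])
  also have "\<dots> \<le> real L * ?K"
    using assms by (intro mult_right_mono LYM_increments[of _ \<Delta>]) auto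
  finally show ?thesis .
qed

section \<open>Counting cliques\<close>

text \<open>The graph is given by a Boolean function on pairs rather than by an edge set, so that
  samples of the product measure can be used directly and only their values inside \<open>U\<close>
  matter.\<close>

definition cliques :: "nat \<Rightarrow> ('a set \<Rightarrow> bool) \<Rightarrow> 'a set \<Rightarrow> 'a set set" where
  "cliques h f U = {T. T \<subseteq> U \<and> card T = h \<and> (\<forall>e\<in>all_pairs T. f e)}"

abbreviation ncl :: "nat \<Rightarrow> ('a set \<Rightarrow> bool) \<Rightarrow> 'a set \<Rightarrow> nat" where
  "ncl h f U \<equiv> card (cliques h f U)"

text \<open>Excluding \<open>S\<close> makes every clique found here disjoint from \<open>S\<close>,
  so that joining the two adds up their sizes.\<close>

definition common_nbrs :: "('a set \<Rightarrow> bool) \<Rightarrow> 'a set \<Rightarrow> 'a set \<Rightarrow> 'a set" where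
  "common_nbrs f Y S = {y \<in> Y - S. \<forall>s\<in>S. f {s, y}}"

lemma all_pairs_mono: "S \<subseteq> T \<Longrightarrow> all_pairs S \<subseteq> all_pairs T"
  by (auto simp: all_pairs_def)

lemma finite_all_pairs [simp]: "finite U \<Longrightarrow> finite (all_pairs U)"
  by (simp add: all_pairs_def)

lemma card_all_pairs: "finite U \<Longrightarrow> card (all_pairs U) = card U choose 2"
  by (simp add: all_pairs_def n_subsets)

lemma all_pairs_iff: "e \<in> all_pairs U \<longleftrightarrow> (\<exists>x y. e = {x, y} \<and> x \<noteq> y \<and> x \<in> U \<and> y \<in> U)"
  by (auto simp: all_pairs_def card_2_iff)

lemma doubleton_in_all_pairs [simp]: "{x, y} \<in> all_pairs U \<longleftrightarrow> x \<noteq> y \<and> x \<in> U \<and> y \<in> U"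
  by (auto simp: all_pairs_def card_2_iff doubleton_eq_iff)

lemma all_pairs_insert: "all_pairs (insert v T) = all_pairs T \<union> (\<lambda>u. {v, u}) ` (T - {v})"
proof (intro equalityI subsetI)
  fix e assume "e \<in> all_pairs (insert v T)"
  then obtain x y where e: "e = {x, y}" "x \<noteq> y" "x \<in> insert v T" "y \<in> insert v T"
    unfolding all_pairs_iff by blast
  show "e \<in> all_pairs T \<union> (\<lambda>u. {v, u}) ` (T - {v})"
  proof (cases "x = v \<or> y = v")
    case True
    then have "\<exists>u\<in>T - {v}. e = {v, u}" using e by (auto simp: insert_commute)
    then show ?thesis by blast
  qed (use e in auto)
qed (use all_pairs_mono[of T "insert v T"] in auto)

lemma finite_cliques [simp]: "finite U \<Longrightarrow> finite (cliques h f U)"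
  by (simp add: cliques_def)

lemma cliques_cong: "(\<And>e. e \<in> all_pairs U \<Longrightarrow> f e = g e) \<Longrightarrow> cliques h f U = cliques h g U"
  unfolding cliques_def using all_pairs_mono by blast

lemma cliques_mono: "(\<And>e. e \<in> all_pairs U \<Longrightarrow> f e \<Longrightarrow> g e) \<Longrightarrow> cliques h f U \<subseteq> cliques h g U"
  unfolding cliques_def using all_pairs_mono by blast

lemma ncl_le: "finite U \<Longrightarrow> ncl h f U \<le> card U choose h"
  using card_mono[of "{T. T \<subseteq> U \<and> card T = h}" "cliques h f U"]
  by (auto simp: n_subsets cliques_def)

text \<open>Deleting \<open>v\<close> turns the cliques through \<open>v\<close> into the cliques of
  its neighbourhood with one vertex less. This is the recursion behind the induction on the clique
  size.\<close>

lemma ncl_remove: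
  assumes "finite U" "v \<in> U"
  shows "ncl (Suc h) f U = ncl (Suc h) f (U - {v}) + ncl h f {u \<in> U - {v}. f {v, u}}"
proof -
  let ?N = "{u \<in> U - {v}. f {v, u}}"
  have "cliques (Suc h) f U = cliques (Suc h) f (U - {v}) \<union> insert v ` cliques h f ?N"
  proof (intro equalityI subsetI)
    fix T assume T: "T \<in> cliques (Suc h) f U"
    show "T \<in> cliques (Suc h) f (U - {v}) \<union> insert v ` cliques h f ?N"
    proof (cases "v \<in> T")
      case False
      then show ?thesis using T by (auto simp: cliques_def)
    next
      case True
      have fin: "finite T" using T assms by (auto simp: cliques_def dest: finite_subset)
      have "T - {v} \<in> cliques h f ?N"
        using T True fin all_pairs_mono[of "T - {v}" T] by (auto simp: cliques_def)
      moreover have "T = insert v (T - {v})" using True by auto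
      ultimately show ?thesis by blast
    qed
  next
    fix T assume "T \<in> cliques (Suc h) f (U - {v}) \<union> insert v ` cliques h f ?N"
    then consider "T \<in> cliques (Suc h) f (U - {v})" | T' where "T = insert v T'" "T' \<in> cliques h f ?N" by blast
    then show "T \<in> cliques (Suc h) f U"
    proof cases
      case 1 then show ?thesis by (auto simp: cliques_def)
    next
      case 2
      then have "finite T'" "v \<notin> T'" using assms by (auto simp: cliques_def dest: finite_subset)
      then show ?thesis using 2 assms(2) by (auto simp: cliques_def all_pairs_insert)
    qed
  qed
  moreover have "cliques (Suc h) f (U - {v}) \<inter> insert v ` cliques h f ?N = {}"
    by (auto simp: cliques_def)
  moreover have "inj_on (insert v) (cliques h f ?N)"
    by (rule inj_on_inverseI[of _ "\<lambda>X. X - {v}"]) (auto simp: cliques_def)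
  ultimately show ?thesis using assms by (simp add: card_Un_disjoint card_image)
qed

text \<open>Removing the pair leaves an arbitrary set of \<open>h - 2\<close> vertices. The quotient
  of powers replaces an exponent \<open>h - 2\<close>, which would be truncated for
  \<open>h < 2\<close>, where no such set exists.\<close>

lemma card_supersets_of_pair_le:
  assumes "finite S" "e \<in> all_pairs S" "card S \<le> n"
  shows "real (card {T. T \<subseteq> S \<and> card T = h \<and> e \<subseteq> T}) \<le> real n ^ h / (real n)\<^sup>2"
proof -
  let ?F = "{T. T \<subseteq> S \<and> card T = h \<and> e \<subseteq> T}"
  have e: "e \<subseteq> S" "card e = 2" "finite e" using assms by (auto simp: all_pairs_def dest: finite_subset)
  have "2 \<le> card S" using e assms(1) card_mono[of S e] by simp
  then have n: "n > 0" using assms(3) by simp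
  show ?thesis
  proof (cases "h < 2")
    case True
    have "?F = {}"
    proof (rule ccontr)
      assume "?F \<noteq> {}"
      then obtain T where "T \<subseteq> S" "card T = h" "e \<subseteq> T" by blast
      then have "card e \<le> h" using assms(1) by (metis card_mono finite_subset)
      then show False using e True by simp
    qed
    then show ?thesis by (simp only: card.empty of_nat_0) simp
  next
    case False
    then obtain j where h: "h = j + 2" by (metis add.commute le_Suc_ex not_less)
    have "inj_on (\<lambda>T. T - e) ?F" by (auto simp: inj_on_def)
    moreover have "(\<lambda>T. T - e) ` ?F \<subseteq> {R. R \<subseteq> S \<and> card R = j}"
      using e h by (auto simp: card_Diff_subset)
    ultimately have "card ?F \<le> card {R. R \<subseteq> S \<and> card R = j}"
      using assms(1) by (intro card_inj_on_le) auto
    also have "\<dots> = card S choose j" using assms(1) by (rule n_subsets)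
    also have "\<dots> \<le> n ^ j"
      using binomial_le_pow[of j "card S"] power_mono[OF assms(3), of j] binomial_eq_0[of "card S" j]
      by (cases "j \<le> card S") (auto simp del: binomial_eq_0_iff)
    finally have "real (card ?F) \<le> real n ^ j" by (metis of_nat_le_iff of_nat_power)
    also have "\<dots> = real n ^ h / (real n)\<^sup>2" using n by (simp only: h power_add) simp
    finally show ?thesis .
  qed
qed

lemma ncl_bounded_differences:
  assumes "finite S" "card S \<le> n" "e \<in> all_pairs S"
  shows "\<bar>real (ncl h (g(e := True)) S) - real (ncl h (g(e := False)) S)\<bar> \<le> real n ^ h / (real n)\<^sup>2"
proof -
  let ?T = "cliques h (g(e := True)) S" and ?F = "cliques h (g(e := False)) S"
  have sub: "?F \<subseteq> ?T" by (rule cliques_mono) auto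
  have "?T - ?F \<subseteq> {T. T \<subseteq> S \<and> card T = h \<and> e \<subseteq> T}"
    by (auto simp: cliques_def all_pairs_def split: if_splits)
  then have "card (?T - ?F) \<le> card {T. T \<subseteq> S \<and> card T = h \<and> e \<subseteq> T}"
    using assms by (intro card_mono) auto
  then have "real (card (?T - ?F)) \<le> real n ^ h / (real n)\<^sup>2"
    using card_supersets_of_pair_le[OF assms(1,3,2), of h] by linarith
  moreover have "card ?F \<le> card ?T" using sub assms by (intro card_mono) auto
  ultimately show ?thesis using sub assms by (simp add: card_Diff_subset of_nat_diff)
qed

lemma expectation_ncl:
  assumes "finite E" "finite S" "all_pairs S \<subseteq> E" "0 \<le> p" "p \<le> 1"
  shows "measure_pmf.expectation (Pi_pmf E False (\<lambda>_. bernoulli_pmf p)) (\<lambda>g. real (ncl h g S))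
    = real (card S choose h) * p ^ (h choose 2)"
proof -
  let ?N = "Pi_pmf E False (\<lambda>_. bernoulli_pmf p)"
  let ?A = "{T. T \<subseteq> S \<and> card T = h}"
  have fin: "finite ?A" using assms by simp
  have "real (ncl h g S) = (\<Sum>T\<in>?A. indicator {g. \<forall>e\<in>all_pairs T. g e} g)" for g
  proof -
    have "cliques h g S = {T \<in> ?A. \<forall>e\<in>all_pairs T. g e}" by (auto simp: cliques_def)
    then have "real (ncl h g S) = (\<Sum>T\<in>{T \<in> ?A. \<forall>e\<in>all_pairs T. g e}. 1)" by simp
    also have "\<dots> = (\<Sum>T\<in>?A. if \<forall>e\<in>all_pairs T. g e then 1 else 0)"
      using fin by (rule sum.inter_filter)
    also have "\<dots> = (\<Sum>T\<in>?A. indicator {g. \<forall>e\<in>all_pairs T. g e} g)"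
      by (intro sum.cong) (auto simp: indicator_def)
    finally show ?thesis .
  qed
  then have "measure_pmf.expectation ?N (\<lambda>g. real (ncl h g S)) =
      (\<Sum>T\<in>?A. measure_pmf.expectation ?N (indicator {g. \<forall>e\<in>all_pairs T. g e}))"
    using assms(1) by (simp add: Bochner_Integration.integral_sum integrable_measure_pmf_finite)
  also have "\<dots> = (\<Sum>T\<in>?A. p ^ (h choose 2))"
  proof (intro sum.cong refl)
    fix T assume T: "T \<in> ?A"
    then have "finite T" "all_pairs T \<subseteq> E"
      using assms all_pairs_mono[of T S] by (auto dest: finite_subset)
    then show "measure_pmf.expectation ?N (indicator {g. \<forall>e\<in>all_pairs T. g e}) = p ^ (h choose 2)"
      using T prob_Pi_bernoulli_all[OF assms(1) _ assms(4,5), of "all_pairs T"]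
      by (simp add: card_all_pairs)
  qed
  also have "\<dots> = real (card S choose h) * p ^ (h choose 2)" using assms(2) by (simp add: n_subsets)
  finally show ?thesis .
qed

text \<open>Adding the pair completes every \<open>h\<close>-clique in the common neighbourhood of
  \<open>a\<close> and \<open>b\<close>. For \<open>Y = U - W\<close> and \<open>a\<close>,
  \<open>b\<close> in \<open>W\<close>, these new cliques use no other pair inside \<open>W\<close>,
  so the lower bound is unaffected by the rest of the sample on \<open>W\<close>.\<close>

lemma ncl_add_edge:
  assumes "finite U" "Y \<subseteq> U" "a \<in> U" "b \<in> U" "a \<noteq> b" "\<not> f {a, b}"
  shows "ncl (h + 2) f U + ncl h f (common_nbrs f Y {a, b}) \<le> ncl (h + 2) (f({a, b} := True)) U"
proof -
  let ?e = "{a, b}" and ?C = "common_nbrs f Y {a, b}"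
  have disj: "cliques (h + 2) f U \<inter> (\<union>) ?e ` cliques h f ?C = {}"
  proof -
    have "?e \<union> T \<notin> cliques (h + 2) f U" for T
      using assms by (auto simp: cliques_def)
    then show ?thesis by blast
  qed
  have inj: "inj_on ((\<union>) ?e) (cliques h f ?C)"
    by (rule inj_on_inverseI[of _ "\<lambda>X. X - ?e"]) (auto simp: cliques_def common_nbrs_def)
  have "(\<union>) ?e ` cliques h f ?C \<subseteq> cliques (h + 2) (f(?e := True)) U"
  proof safe
    fix T assume T: "T \<in> cliques h f ?C"
    have "T \<subseteq> U" using T assms(2) by (auto simp: cliques_def common_nbrs_def)
    then have fin: "finite T" using assms(1) by (rule finite_subset)
    have d: "a \<notin> T" "b \<notin> T" and C: "T \<subseteq> ?C" using T by (auto simp: cliques_def common_nbrs_def)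
    have "card (insert a (insert b T)) = h + 2" using fin d assms(5) T by (simp add: cliques_def)
    moreover have "insert a (insert b T) \<subseteq> U" using C assms by (auto simp: common_nbrs_def)
    moreover have "\<forall>e\<in>all_pairs (insert a (insert b T)). (f(?e := True)) e"
      using T C by (auto simp: all_pairs_insert cliques_def common_nbrs_def subset_iff)
    ultimately show "?e \<union> T \<in> cliques (h + 2) (f(?e := True)) U" by (simp add: cliques_def)
  qed
  moreover have "cliques (h + 2) f U \<subseteq> cliques (h + 2) (f(?e := True)) U"
    by (rule cliques_mono) auto
  ultimately have "card (cliques (h + 2) f U \<union> (\<union>) ?e ` cliques h f ?C) \<le> ncl (h + 2) (f(?e := True)) U"
    using assms by (intro card_mono) auto
  moreover have "finite ?C" using assms by (auto simp: common_nbrs_def dest: finite_subset)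
  ultimately show ?thesis
    using card_Un_disjoint[OF _ _ disj] card_image[OF inj] assms(1) by simp
qed

text \<open>Double counting of pairs of a clique and one of its vertices: \<open>y\<close> together
  with a clique in the smaller common neighbourhood is a clique of size \<open>Suc h\<close> with a
  marked vertex.\<close>

lemma sum_ncl_common_nbrs_le:
  assumes "finite Y"
  shows "(\<Sum>y\<in>common_nbrs f Y S. ncl h f (common_nbrs f Y (insert y S)))
    \<le> Suc h * ncl (Suc h) f (common_nbrs f Y S)"
proof -
  let ?C = "common_nbrs f Y S" and ?D = "\<lambda>y. common_nbrs f Y (insert y S)"
  have fin: "finite ?C" "finite (?D y)" for y using assms by (auto simp: common_nbrs_def)
  let ?A = "SIGMA y:?C. cliques h f (?D y)" and ?B = "SIGMA T:cliques (Suc h) f ?C. T"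
  let ?k = "\<lambda>(y, T). (insert y T, y)"
  have "inj_on ?k ?A"
    by (rule inj_on_inverseI[of _ "\<lambda>(X, y). (y, X - {y})"]) (auto simp: cliques_def common_nbrs_def)
  moreover have "?k ` ?A \<subseteq> ?B"
  proof clarify
    fix y T assume y: "y \<in> ?C" and T: "T \<in> cliques h f (?D y)"
    have "y \<notin> T" "T \<subseteq> ?D y" "finite T"
      using T fin(2)[of y] by (auto simp: cliques_def common_nbrs_def dest: finite_subset)
    then show "insert y T \<in> cliques (Suc h) f ?C \<and> y \<in> insert y T"
      using y T by (auto simp: cliques_def all_pairs_insert common_nbrs_def)
  qed
  moreover have finB: "finite ?B"
  proof (intro finite_SigmaI)
    show "finite (cliques (Suc h) f ?C)" using fin by simp
    fix T assume "T \<in> cliques (Suc h) f ?C"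
    then show "finite T" using fin(1) by (auto simp: cliques_def dest: finite_subset)
  qed
  ultimately have "card ?A \<le> card ?B" by (rule card_inj_on_le)
  moreover have "card ?A = (\<Sum>y\<in>?C. ncl h f (?D y))"
    using fin by (intro card_SigmaI) auto
  moreover have "card ?B = (\<Sum>T\<in>cliques (Suc h) f ?C. card T)"
    using fin by (intro card_SigmaI) (auto simp: cliques_def dest: finite_subset)
  moreover have "\<dots> = Suc h * ncl (Suc h) f ?C"
    by (subst sum.cong[OF refl, of _ card "\<lambda>_. Suc h"]) (auto simp: cliques_def)
  ultimately show ?thesis by simp
qed

text \<open>The vertices of a clique are chosen greedily, each in at least \<open>t\<close> ways,
  because every partial choice together with \<open>S\<close> still has \<open>t\<close> common
  neighbours. A clique arises from at most \<open>h!\<close> orders.\<close>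

lemma ncl_common_nbrs_ge:
  fixes t :: real
  assumes "finite Y" "finite S" "0 \<le> t"
    and "\<And>R. R \<subseteq> S \<union> Y \<Longrightarrow> card R < card S + h \<Longrightarrow> t \<le> real (card (common_nbrs f Y R))"
  shows "t ^ h \<le> fact h * real (ncl h f (common_nbrs f Y S))"
  using assms(2,4)
proof (induction h arbitrary: S)
  case 0
  have "cliques 0 f (common_nbrs f Y S) = {{}}"
    using assms(1) by (auto simp: cliques_def all_pairs_def common_nbrs_def dest: finite_subset)
  then show ?case by simp
next
  case (Suc h)
  let ?C = "common_nbrs f Y S"
  have "t * t ^ h \<le> real (card ?C) * t ^ h"
    using Suc.prems(2)[of S] assms(3) by (intro mult_right_mono) auto
  also have "\<dots> = (\<Sum>y\<in>?C. t ^ h)" by simp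
  also have "\<dots> \<le> (\<Sum>y\<in>?C. fact h * real (ncl h f (common_nbrs f Y (insert y S))))"
  proof (intro sum_mono Suc.IH)
    fix y R assume y: "y \<in> ?C" and R: "R \<subseteq> insert y S \<union> Y" "card R < card (insert y S) + h"
    show "t \<le> real (card (common_nbrs f Y R))"
      using y R Suc.prems(1) by (intro Suc.prems(2)) (auto simp: common_nbrs_def)
  qed (use Suc.prems in auto)
  also have "\<dots> = fact h * real (\<Sum>y\<in>?C. ncl h f (common_nbrs f Y (insert y S)))"
    by (simp add: sum_distrib_left)
  also have "\<dots> \<le> fact h * real (Suc h * ncl (Suc h) f ?C)"
    using sum_ncl_common_nbrs_le[OF assms(1), of h f S] by (intro mult_left_mono) (auto simp only: of_nat_le_iff fact_ge_zero)
  finally show ?case by (simp add: algebra_simps)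
qed

section \<open>Conditional anticoncentration of the clique count\<close>

text \<open>The counterpart of \<open>dispersed\<close> for a Boolean function on pairs and an
  arbitrary vertex set. The induction needs it on sets \<open>U - {v}\<close>, not only on an
  initial segment of the integers.\<close>

definition clique_dispersed :: "real \<Rightarrow> real \<Rightarrow> nat \<Rightarrow> ('a set \<Rightarrow> bool) \<Rightarrow> 'a set \<Rightarrow> bool" where
  "clique_dispersed c q h f V \<longleftrightarrow>
     (\<forall>k l :: nat. c * real (card V) \<le> real k \<and> real k \<le> (1 - c) * real (card V) \<longrightarrow>
        real (card {U. U \<subseteq> V \<and> card U = k \<and> ncl h f U = l}) \<le> real (card V choose k) * q)"

definition nbrs :: "('a set \<Rightarrow> bool) \<Rightarrow> 'a set \<Rightarrow> 'a \<Rightarrow> 'a set" where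
  "nbrs f U v = {u \<in> U. f {v, u}}"

text \<open>The common neighbours are sought outside \<open>W\<close>, while \<open>R\<close> may
  meet \<open>W\<close>: every pair inspected then has an end outside \<open>W\<close>, so the
  property persists when the pairs inside \<open>W\<close> are resampled.\<close>

definition many_common_nbrs :: "real \<Rightarrow> nat \<Rightarrow> ('a set \<Rightarrow> bool) \<Rightarrow> 'a set \<Rightarrow> 'a set \<Rightarrow> bool" where
  "many_common_nbrs t h f U W \<longleftrightarrow> (\<forall>R. R \<subseteq> U \<and> card R \<le> h \<longrightarrow> t \<le> real (card (common_nbrs f (U - W) R)))"

abbreviation star :: "'a \<Rightarrow> 'a set \<Rightarrow> 'a set set" where
  "star v U \<equiv> (\<lambda>u. {v, u}) ` U"

abbreviation edge_pmf :: "real \<Rightarrow> 'a set set \<Rightarrow> ('a set \<Rightarrow> bool) pmf" where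
  "edge_pmf p E \<equiv> Pi_pmf E False (\<lambda>_. bernoulli_pmf p)"

lemma inj_on_star: "v \<notin> U \<Longrightarrow> inj_on (\<lambda>u. {v, u}) U"
  by (auto simp: inj_on_def doubleton_eq_iff)

lemma star_disjoint_all_pairs: "v \<notin> U \<Longrightarrow> e \<in> star v U' \<Longrightarrow> e \<notin> all_pairs U"
  by (auto simp: all_pairs_def)

lemma clique_dispersed_cong:
  assumes "\<And>e. e \<in> all_pairs V \<Longrightarrow> f e = g e"
  shows "clique_dispersed c q h f V = clique_dispersed c q h g V"
proof -
  have "ncl h f U = ncl h g U" if "U \<subseteq> V" for U
    using assms all_pairs_mono[OF that] by (intro arg_cong[of _ _ card] cliques_cong) blast
  then have "{U. U \<subseteq> V \<and> card U = k \<and> ncl h f U = l} = {U. U \<subseteq> V \<and> card U = k \<and> ncl h g U = l}" for k l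
    by auto
  then show ?thesis unfolding clique_dispersed_def by simp
qed

lemma common_nbrs_cong:
  assumes "\<And>s y. s \<in> R \<Longrightarrow> y \<in> Y - R \<Longrightarrow> f {s, y} = g {s, y}"
  shows "common_nbrs f Y R = common_nbrs g Y R"
  using assms by (auto simp: common_nbrs_def)

lemma many_common_nbrs_cong:
  assumes "\<And>e. e \<in> all_pairs U - all_pairs W \<Longrightarrow> f e = g e"
  shows "many_common_nbrs t h f U W = many_common_nbrs t h g U W"
proof -
  have "common_nbrs f (U - W) R = common_nbrs g (U - W) R" if "R \<subseteq> U" for R
    using that by (intro common_nbrs_cong assms) auto
  then show ?thesis unfolding many_common_nbrs_def by simp
qed

text \<open>Given the degree of \<open>v\<close>, its neighbourhood is a uniformly random set of that size.\<close>

lemma prob_star_ncl_le: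
  assumes "finite U" "v \<notin> U" "0 \<le> p" "p \<le> 1" and disp: "clique_dispersed c q h f U" "0 \<le> q"
  shows "measure_pmf.prob (edge_pmf p (star v U))
      {g. c * real (card U) \<le> real (card (nbrs g U v)) \<and> real (card (nbrs g U v)) \<le> (1 - c) * real (card U) \<and>
          ncl h f (nbrs g U v) = x \<and> R (card (nbrs g U v))}
    \<le> q * measure_pmf.prob (edge_pmf p (star v U)) {g. R (card (nbrs g U v))}"
proof -
  let ?n = "card U"
  define w where "w d = p ^ d * (1 - p) ^ (?n - d)" for d
  have w: "0 \<le> w d" for d using assms by (simp add: w_def)
  \<comment> \<open>The condition \<open>R\<close> concerns the degree alone and is kept on the
    right-hand side: it will carry the window for the count in the remaining vertices.\<close>
  define ok where "ok d \<longleftrightarrow> c * real ?n \<le> real d \<and> real d \<le> (1 - c) * real ?n \<and> R d" for d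
  have split: "(\<Sum>N | N \<subseteq> U \<and> Q N. w (card N)) = (\<Sum>d\<le>?n. w d * real (card {N. N \<subseteq> U \<and> card N = d \<and> Q N}))" for Q
  proof -
    have "(\<Sum>N | N \<subseteq> U \<and> Q N. w (card N)) = (\<Sum>d\<in>{..?n}. \<Sum>N\<in>{N \<in> {N. N \<subseteq> U \<and> Q N}. card N = d}. w (card N))"
      using assms(1) by (intro sum.group[symmetric]) (auto intro: card_mono)
    also have "\<dots> = (\<Sum>d\<le>?n. w d * real (card {N. N \<subseteq> U \<and> card N = d \<and> Q N}))"
    proof (intro sum.cong refl)
      fix d
      have "{N \<in> {N. N \<subseteq> U \<and> Q N}. card N = d} = {N. N \<subseteq> U \<and> card N = d \<and> Q N}" by auto
      moreover have "(\<Sum>N\<in>{N. N \<subseteq> U \<and> card N = d \<and> Q N}. w (card N)) = (\<Sum>N\<in>{N. N \<subseteq> U \<and> card N = d \<and> Q N}. w d)"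
        by (intro sum.cong) auto
      ultimately show "(\<Sum>N\<in>{N \<in> {N. N \<subseteq> U \<and> Q N}. card N = d}. w (card N)) = w d * real (card {N. N \<subseteq> U \<and> card N = d \<and> Q N})"
        by simp
    qed
    finally show ?thesis .
  qed
  have pr: "measure_pmf.prob (edge_pmf p (star v U)) {g. Q (nbrs g U v)} =
      (\<Sum>d\<le>?n. w d * real (card {N. N \<subseteq> U \<and> card N = d \<and> Q N}))" for Q
    unfolding nbrs_def using prob_Pi_bernoulli_image[OF assms(1) inj_on_star[OF assms(2)] assms(3,4), of Q] split[of Q]
    by (simp add: w_def)
  have "measure_pmf.prob (edge_pmf p (star v U)) {g. ok (card (nbrs g U v)) \<and> ncl h f (nbrs g U v) = x}
     = (\<Sum>d\<le>?n. w d * real (card {N. N \<subseteq> U \<and> card N = d \<and> ok (card N) \<and> ncl h f N = x}))"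
    by (rule pr)
  also have "\<dots> \<le> (\<Sum>d\<le>?n. q * (w d * real (card {N. N \<subseteq> U \<and> card N = d \<and> R (card N)})))"
  proof (intro sum_mono)
    fix d
    have "real (card {N. N \<subseteq> U \<and> card N = d \<and> ok (card N) \<and> ncl h f N = x})
      \<le> q * real (card {N. N \<subseteq> U \<and> card N = d \<and> R (card N)})"
    proof (cases "ok d")
      case True
      then have "{N. N \<subseteq> U \<and> card N = d \<and> ok (card N) \<and> ncl h f N = x} = {N. N \<subseteq> U \<and> card N = d \<and> ncl h f N = x}"
        "{N. N \<subseteq> U \<and> card N = d \<and> R (card N)} = {N. N \<subseteq> U \<and> card N = d}"
        by (auto simp: ok_def)
      then show ?thesis using disp(1) True n_subsets[OF assms(1), of d]
        by (simp add: clique_dispersed_def ok_def mult.commute)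
    next
      case False
      then have "{N. N \<subseteq> U \<and> card N = d \<and> ok (card N) \<and> ncl h f N = x} = {}" by auto
      then show ?thesis using disp(2) by (simp only: card.empty) simp
    qed
    from mult_left_mono[OF this w[of d]]
    show "w d * real (card {N. N \<subseteq> U \<and> card N = d \<and> ok (card N) \<and> ncl h f N = x})
      \<le> q * (w d * real (card {N. N \<subseteq> U \<and> card N = d \<and> R (card N)}))"
      by (simp only: mult.left_commute)
  qed
  also have "\<dots> = q * measure_pmf.prob (edge_pmf p (star v U)) {g. R (card (nbrs g U v))}"
    using pr[of "\<lambda>N. R (card N)"] by (simp add: sum_distrib_left)
  finally show ?thesis by (simp add: ok_def conj_ac)
qed

text \<open>Conditioned on the pairs outside \<open>W\<close>, each new pair inside \<open>W\<close> creates at least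
  \<open>t ^ h / fact h\<close> cliques with vertices in \<open>U - W\<close>, so the clique count is spread out.\<close>

lemma prob_ncl_window_le:
  assumes "finite U" "W \<subseteq> U" "2 \<le> card W" "0 < p" "p < 1" "0 < t"
    and cn: "many_common_nbrs t (Suc h) f U W"
    and L: "b < a + real L * (t ^ h / fact h)"
  shows "measure_pmf.prob (edge_pmf p (all_pairs W))
      {g. a \<le> real (ncl (h + 2) (override_on f g (all_pairs W)) U) \<and>
          real (ncl (h + 2) (override_on f g (all_pairs W)) U) \<le> b}
    \<le> real L * (4 / sqrt (p * (1 - p)) / sqrt (real (card W choose 2)))"
proof -
  let ?E = "all_pairs W"
  define \<phi> where "\<phi> A = real (ncl (h + 2) (override_on f (\<lambda>e. e \<in> A) ?E) U)" for A
  have fW: "finite W" using assms by (auto dest: finite_subset)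
  have EU: "?E \<subseteq> all_pairs U" using assms(2) by (rule all_pairs_mono)
  have \<phi>: "real (ncl (h + 2) (override_on f g ?E) U) = \<phi> {e\<in>?E. g e}" for g
  proof -
    have "override_on f g ?E = override_on f (\<lambda>e. e \<in> {e\<in>?E. g e}) ?E"
      by (auto simp: override_on_def fun_eq_iff)
    then show ?thesis by (simp add: \<phi>_def)
  qed
  have inc: "\<phi> A + t ^ h / fact h \<le> \<phi> (insert e A)" if A: "A \<subseteq> ?E" and e: "e \<in> ?E - A" for A e
  proof -
    let ?f = "override_on f (\<lambda>e. e \<in> A) ?E"
    obtain x y where xy: "e = {x, y}" "x \<noteq> y" "x \<in> W" "y \<in> W" using DiffD1[OF e] unfolding all_pairs_iff by blast
    have "t ^ h \<le> fact h * real (ncl h ?f (common_nbrs ?f (U - W) {x, y}))"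
    proof (rule ncl_common_nbrs_ge)
      fix R assume R: "R \<subseteq> {x, y} \<union> (U - W)" "card R < card {x, y} + h"
      have "many_common_nbrs t (Suc h) ?f U W"
        using cn by (subst many_common_nbrs_cong[of _ _ _ f]) (auto simp: override_on_def)
      moreover have "R \<subseteq> U" using R xy assms(2) by auto
      \<comment> \<open>\<open>R\<close> has fewer than \<open>2 + h\<close> elements; hence
        \<open>Suc h\<close> in the assumption on common neighbours.\<close>
      moreover have "card R \<le> Suc h" using R xy by simp
      ultimately show "t \<le> real (card (common_nbrs ?f (U - W) R))"
        unfolding many_common_nbrs_def by blast
    qed (use assms in auto)
    then have "t ^ h / fact h \<le> real (ncl h ?f (common_nbrs ?f (U - W) {x, y}))"
      by (simp add: field_simps)
    moreover have "ncl (h + 2) ?f U + ncl h ?f (common_nbrs ?f (U - W) {x, y}) \<le> ncl (h + 2) (?f({x, y} := True)) U"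
      using assms xy e by (intro ncl_add_edge) (auto simp: override_on_def)
    moreover have "?f({x, y} := True) = override_on f (\<lambda>e'. e' \<in> insert e A) ?E"
      using e xy by (auto simp: override_on_def fun_eq_iff)
    ultimately show ?thesis unfolding \<phi>_def by simp
  qed
  have "card ?E = card W choose 2" using fW by (rule card_all_pairs)
  moreover have "0 < card W choose 2" using assms(3) by simp
  ultimately have "?E \<noteq> {}" by force
  then show ?thesis
    unfolding \<phi> using small_ball_increments[of ?E p "t ^ h / fact h" b a L \<phi>] fW assms inc card_all_pairs[OF fW]
    by simp
qed

text \<open>One factor \<open>q\<close> comes from the neighbourhood of \<open>v\<close>, which decides the exact count, and one
  from the pairs inside \<open>W\<close>, which spread the count on the scale of \<open>w\<close>.\<close>

lemma prob_ncl_eq_conditional_le: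
  fixes A :: "('a set \<Rightarrow> bool) \<Rightarrow> bool"
  assumes "finite E" "finite U" "v \<in> U" "all_pairs U \<subseteq> E"
  defines "U' \<equiv> U - {v}"
  assumes "W \<subseteq> U'" "2 \<le> card W" "0 < p" "p < 1" "0 < t" "0 \<le> q"
    and L: "2 * w < real L * (t ^ h / fact h)"
    and A: "\<And>f g. (\<And>e. e \<notin> star v U' \<Longrightarrow> e \<notin> all_pairs W \<Longrightarrow> f e = g e) \<Longrightarrow> A f = A g"
  shows "measure_pmf.prob (edge_pmf p E)
      {f. A f \<and> ncl (h + 2) f U = l \<and>
          \<bar>real (ncl (Suc h) f (nbrs f U' v)) - \<mu> (card (nbrs f U' v))\<bar> \<le> w \<and>
          c * real (card U') \<le> real (card (nbrs f U' v)) \<and> real (card (nbrs f U' v)) \<le> (1 - c) * real (card U') \<and>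
          clique_dispersed c q (Suc h) f U' \<and> many_common_nbrs t (Suc h) f U' W}
    \<le> q * (real L * (4 / sqrt (p * (1 - p)) / sqrt (real (card W choose 2)))) *
      measure_pmf.prob (edge_pmf p E) {f. A f}" (is "?P \<le> _")
proof -
  \<comment> \<open>What is left of the event once the star at \<open>v\<close> has been averaged
    out: the exact count is gone, and the count in \<open>U'\<close> is confined to a window of
    length \<open>2 * w\<close> placed by the degree of \<open>v\<close>.\<close>
  define C where "C f \<longleftrightarrow> A f \<and> many_common_nbrs t (Suc h) f U' W \<and>
    \<bar>real l - real (ncl (h + 2) f U') - \<mu> (card (nbrs f U' v))\<bar> \<le> w" for f
  let ?q2 = "real L * (4 / sqrt (p * (1 - p)) / sqrt (real (card W choose 2)))"
  have fU': "finite U'" and vU': "v \<notin> U'" using assms(2) by (auto simp: U'_def)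
  have fW: "finite W" using assms(6) fU' by (rule finite_subset)
  have "star v U' \<subseteq> all_pairs U" using assms(3) by (auto simp: U'_def)
  then have starE: "star v U' \<subseteq> E" using assms(4) by (rule subset_trans)
  have WE: "all_pairs W \<subseteq> E"
    using assms(4,6) all_pairs_mono[of W U] by (auto simp: U'_def)
  have rem: "ncl (h + 2) f U = ncl (h + 2) f U' + ncl (Suc h) f (nbrs f U' v)" for f
    using ncl_remove[OF assms(2,3), of "Suc h" f] by (simp add: U'_def nbrs_def)
  have p01: "0 \<le> p" "p \<le> 1" using assms(8,9) by auto
  have 1: "?P \<le> q * measure_pmf.prob (edge_pmf p E) {f. C f}"
  proof (rule prob_resample_mono[OF assms(1) starE assms(11)])
    fix f
    let ?o = "\<lambda>g :: 'a set \<Rightarrow> bool. override_on f g (star v U')"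
    have inv: "f e = ?o g e" if "e \<in> all_pairs U'" for g e
      using star_disjoint_all_pairs[OF vU'] that by (auto simp: override_on_def)
    have A': "A (?o g) = A f" for g by (rule A) (auto simp: override_on_def)
    have n1: "ncl (h + 2) (?o g) U' = ncl (h + 2) f U'" for g
      by (intro arg_cong[of _ _ card] cliques_cong) (simp add: inv[symmetric])
    have nb: "nbrs (?o g) U' v = nbrs g U' v" for g
      by (auto simp: nbrs_def override_on_def)
    have n2: "ncl (Suc h) (?o g) (nbrs g U' v) = ncl (Suc h) f (nbrs g U' v)" for g
    proof (intro arg_cong[of _ _ card] cliques_cong)
      fix e assume "e \<in> all_pairs (nbrs g U' v)"
      moreover have "all_pairs (nbrs g U' v) \<subseteq> all_pairs U'" by (intro all_pairs_mono) (auto simp: nbrs_def)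
      ultimately show "?o g e = f e" using inv by blast
    qed
    have cd: "clique_dispersed c q (Suc h) (?o g) U' = clique_dispersed c q (Suc h) f U'" for g
      by (intro clique_dispersed_cong) (simp add: inv[symmetric])
    have mc: "many_common_nbrs t (Suc h) (?o g) U' W = many_common_nbrs t (Suc h) f U' W" for g
      by (intro many_common_nbrs_cong) (simp add: inv[symmetric])
    show "measure_pmf.prob (edge_pmf p (star v U'))
        {g. A (?o g) \<and> ncl (h + 2) (?o g) U = l \<and>
          \<bar>real (ncl (Suc h) (?o g) (nbrs (?o g) U' v)) - \<mu> (card (nbrs (?o g) U' v))\<bar> \<le> w \<and>
          c * real (card U') \<le> real (card (nbrs (?o g) U' v)) \<and> real (card (nbrs (?o g) U' v)) \<le> (1 - c) * real (card U') \<and>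
          clique_dispersed c q (Suc h) (?o g) U' \<and> many_common_nbrs t (Suc h) (?o g) U' W}
      \<le> q * measure_pmf.prob (edge_pmf p (star v U')) {g. C (?o g)}" (is "measure_pmf.prob ?M ?S \<le> _")
    proof (cases "A f \<and> clique_dispersed c q (Suc h) f U' \<and> many_common_nbrs t (Suc h) f U' W")
      case False
      then have "?S = {}" unfolding A' cd mc by blast
      then show ?thesis using assms(11) by (simp only: measure_empty) simp
    next
      case True
      define R where "R d \<longleftrightarrow> \<bar>real l - real (ncl (h + 2) f U') - \<mu> d\<bar> \<le> w" for d
      \<comment> \<open>Truncated subtraction is harmless: on the event, \<open>l\<close> is a sum
        with \<open>ncl (h + 2) f U'\<close> as one summand.\<close>
      define x where "x = l - ncl (h + 2) f U'"
      have "?S \<subseteq> {g. c * real (card U') \<le> real (card (nbrs g U' v)) \<and> real (card (nbrs g U' v)) \<le> (1 - c) * real (card U') \<and>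
          ncl (Suc h) f (nbrs g U' v) = x \<and> R (card (nbrs g U' v))}"
        unfolding nb n2 R_def x_def
      proof (intro subsetI CollectI, elim CollectE conjE)
        fix g assume l: "ncl (h + 2) (?o g) U = l"
          and "\<bar>real (ncl (Suc h) f (nbrs g U' v)) - \<mu> (card (nbrs g U' v))\<bar> \<le> w"
          "c * real (card U') \<le> real (card (nbrs g U' v))" "real (card (nbrs g U' v)) \<le> (1 - c) * real (card U')"
        moreover have "l = ncl (h + 2) f U' + ncl (Suc h) f (nbrs g U' v)"
          using rem[of "?o g"] l unfolding nb n1 n2 by simp
        ultimately show "c * real (card U') \<le> real (card (nbrs g U' v)) \<and> real (card (nbrs g U' v)) \<le> (1 - c) * real (card U') \<and>
          ncl (Suc h) f (nbrs g U' v) = l - ncl (h + 2) f U' \<and>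
          \<bar>real l - real (ncl (h + 2) f U') - \<mu> (card (nbrs g U' v))\<bar> \<le> w"
          by simp
      qed
      then have "measure_pmf.prob ?M ?S \<le> measure_pmf.prob ?M {g. c * real (card U') \<le> real (card (nbrs g U' v)) \<and> real (card (nbrs g U' v)) \<le> (1 - c) * real (card U') \<and>
          ncl (Suc h) f (nbrs g U' v) = x \<and> R (card (nbrs g U' v))}"
        by (rule measure_pmf.finite_measure_mono) simp
      also have "\<dots> \<le> q * measure_pmf.prob ?M {g. R (card (nbrs g U' v))}"
        using True assms(11) by (intro prob_star_ncl_le[OF fU' vU' p01]) auto
      also have "{g. R (card (nbrs g U' v))} = {g. C (?o g)}"
        unfolding C_def A' mc nb n1 R_def using True by simp
      finally show ?thesis .
    qed
  qed
  have 2: "measure_pmf.prob (edge_pmf p E) {f. C f} \<le> ?q2 * measure_pmf.prob (edge_pmf p E) {f. A f}"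
  proof (rule prob_resample_mono[OF assms(1) WE])
    show q2: "0 \<le> ?q2" using assms(8,9) by simp
    fix f
    let ?o = "\<lambda>g :: 'a set \<Rightarrow> bool. override_on f g (all_pairs W)"
    have A': "A (?o g) = A f" for g by (rule A) (auto simp: override_on_def)
    have nb: "nbrs (?o g) U' v = nbrs f U' v" for g
      using vU' assms(6) by (auto simp: nbrs_def override_on_def)
    have mc: "many_common_nbrs t (Suc h) (?o g) U' W = many_common_nbrs t (Suc h) f U' W" for g
      by (intro many_common_nbrs_cong) (auto simp: override_on_def)
    show "measure_pmf.prob (edge_pmf p (all_pairs W)) {g. C (?o g)}
      \<le> ?q2 * measure_pmf.prob (edge_pmf p (all_pairs W)) {g. A (?o g)}"
    proof (cases "A f \<and> many_common_nbrs t (Suc h) f U' W")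
      case False
      then have "{g. C (?o g)} = {}" unfolding C_def A' mc by blast
      then show ?thesis using mult_nonneg_nonneg[OF q2 measure_nonneg] by (simp only: measure_empty)
    next
      case True
      \<comment> \<open>As \<open>v\<close> lies outside \<open>W\<close>, its degree is frozen, so
        the window does not move with the resampled pairs.\<close>
      define a where "a = real l - \<mu> (card (nbrs f U' v)) - w"
      have "{g. C (?o g)} \<subseteq> {g. a \<le> real (ncl (h + 2) (?o g) U') \<and> real (ncl (h + 2) (?o g) U') \<le> a + 2 * w}"
        unfolding C_def nb a_def by auto
      then have "measure_pmf.prob (edge_pmf p (all_pairs W)) {g. C (?o g)} \<le>
          measure_pmf.prob (edge_pmf p (all_pairs W)) {g. a \<le> real (ncl (h + 2) (?o g) U') \<and> real (ncl (h + 2) (?o g) U') \<le> a + 2 * w}"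
        by (rule measure_pmf.finite_measure_mono) simp
      also have "\<dots> \<le> ?q2"
        using True L by (intro prob_ncl_window_le[OF fU' assms(6-10)]) auto
      finally show ?thesis using True by (simp add: A')
    qed
  qed
  show ?thesis
    by (rule order_trans[OF 1]) (use mult_left_mono[OF 2 assms(11)] in \<open>simp only: mult.assoc\<close>)
qed

section \<open>Tail bounds\<close>

text \<open>With this \<open>c\<close>, both \<open>p - c\<close> and \<open>1 - p - c\<close> are
  at least \<open>c\<close>, so a degree outside the range deviates from its mean by at least
  \<open>c * card U\<close>.\<close>

lemma prob_degree_bad_le:
  fixes p :: real
  assumes "finite E" "finite U" "U \<noteq> {}" "v \<notin> U" "star v U \<subseteq> E" "0 < p" "p < 1"
  defines "c \<equiv> min p (1 - p) / 2"
  shows "measure_pmf.prob (edge_pmf p E)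
      {f. \<not> (c * real (card U) \<le> real (card (nbrs f U v)) \<and> real (card (nbrs f U v)) \<le> (1 - c) * real (card U))}
    \<le> 2 * exp (- 2 * c\<^sup>2 * real (card U))"
proof -
  let ?n = "real (card U)"
  have c: "0 < c" "2 * c \<le> p" "2 * c \<le> 1 - p" using assms(6,7) by (auto simp: c_def)
  have n: "0 < ?n" using assms(2,3) by (simp add: card_gt_0_iff)
  have D: "{u\<in>U. \<forall>e\<in>{{v, u}}. f e} = nbrs f U v" for f by (simp add: nbrs_def)
  have "measure_pmf.prob (edge_pmf p E)
      {f. \<not> (c * ?n \<le> real (card (nbrs f U v)) \<and> real (card (nbrs f U v)) \<le> (1 - c) * ?n)}
    \<le> measure_pmf.prob (edge_pmf p E) {f. c * ?n \<le> \<bar>real (card {u\<in>U. \<forall>e\<in>{{v, u}}. f e}) - ?n * p ^ 1\<bar>}"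
  proof (intro measure_pmf.finite_measure_mono subsetI CollectI)
    fix f
    assume "f \<in> {f. \<not> (c * ?n \<le> real (card (nbrs f U v)) \<and> real (card (nbrs f U v)) \<le> (1 - c) * ?n)}"
    moreover have "2 * c * ?n \<le> p * ?n" "2 * c * ?n \<le> (1 - p) * ?n" using c n by (intro mult_right_mono; simp)+
    ultimately show "c * ?n \<le> \<bar>real (card {u\<in>U. \<forall>e\<in>{{v, u}}. f e}) - ?n * p ^ 1\<bar>"
      unfolding D by (auto simp: algebra_simps)
  qed simp
  also have "\<dots> \<le> 2 * exp (- 2 * (c * ?n)\<^sup>2 / ?n)"
    using assms c n inj_on_star[OF assms(4)]
    by (intro count_deviation) (auto simp: disjoint_family_on_def doubleton_eq_iff)
  also have "- 2 * (c * ?n)\<^sup>2 / ?n = - 2 * c\<^sup>2 * ?n" using n by (simp add: power2_eq_square)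
  finally show ?thesis .
qed

text \<open>Only the pairs inside \<open>U\<close> are resampled, so the neighbourhood of
  \<open>v\<close> is a fixed set and the mean is explicit. At most \<open>n\<^sup>2\<close> pairs
  of influence \<open>n ^ h / n\<^sup>2\<close> give the denominator in the exponent.\<close>

lemma prob_ncl_nbrs_deviation_le:
  fixes p :: real
  assumes "finite E" "finite U" "v \<notin> U" "all_pairs U \<subseteq> E" "0 < p" "p < 1" "0 \<le> w" "card U \<le> n" "0 < n"
  shows "measure_pmf.prob (edge_pmf p E)
      {f. \<not> \<bar>real (ncl h f (nbrs f U v)) - real (card (nbrs f U v) choose h) * p ^ (h choose 2)\<bar> \<le> w}
    \<le> 2 * exp (- 2 * w\<^sup>2 / ((real n)\<^sup>2 * (real n ^ h / (real n)\<^sup>2)\<^sup>2))"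
proof (rule prob_resample_le[OF assms(1,4)])
  fix f :: "'a set \<Rightarrow> bool"
  let ?o = "\<lambda>g :: 'a set \<Rightarrow> bool. override_on f g (all_pairs U)"
  define N where "N = nbrs f U v"
  have N: "N \<subseteq> U" by (auto simp: N_def nbrs_def)
  then have fN: "finite N" and cN: "card N \<le> n"
    using assms(2,8) card_mono[of U N] by (auto dest: finite_subset)
  have NU: "all_pairs N \<subseteq> all_pairs U" using N by (rule all_pairs_mono)
  have nb: "nbrs (?o g) U v = N" for g
    using assms(3) by (auto simp: nbrs_def override_on_def N_def)
  have cl: "ncl h (?o g) N = ncl h g N" for g
    using NU by (intro arg_cong[of _ _ card] cliques_cong) (auto simp: override_on_def)
  define c where "c = real n ^ h / (real n)\<^sup>2"
  have c: "c > 0" using assms(9) by (simp add: c_def)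
  have E: "measure_pmf.expectation (edge_pmf p (all_pairs U)) (\<lambda>g. real (ncl h g N)) = real (card N choose h) * p ^ (h choose 2)"
    using NU fN assms(2,5,6) by (intro expectation_ncl) auto
  have "card (all_pairs U) \<le> (card U)\<^sup>2"
    using binomial_le_pow[of 2 "card U"] by (cases "2 \<le> card U") (auto simp: card_all_pairs[OF assms(2)] not_le binomial_eq_0)
  also have "\<dots> \<le> n\<^sup>2" using assms(8) by (intro power_mono) auto
  finally have "real (card (all_pairs U)) \<le> (real n)\<^sup>2" by (metis of_nat_le_iff of_nat_power)
  then have S: "(\<Sum>e\<in>all_pairs U. c\<^sup>2) \<le> (real n)\<^sup>2 * c\<^sup>2" by (simp add: mult_right_mono)
  have "measure_pmf.prob (edge_pmf p (all_pairs U))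
      {g. w \<le> \<bar>real (ncl h g N) - measure_pmf.expectation (edge_pmf p (all_pairs U)) (\<lambda>g. real (ncl h g N))\<bar>}
    \<le> 2 * exp (- 2 * w\<^sup>2 / ((real n)\<^sup>2 * c\<^sup>2))"
  proof (rule McDiarmid_bernoulli_abs[where c = "\<lambda>_. c"])
    fix e and g :: "'a set \<Rightarrow> bool"
    show "\<bar>real (ncl h (g(e := True)) N) - real (ncl h (g(e := False)) N)\<bar> \<le> c"
    proof (cases "e \<in> all_pairs N")
      case True
      then show ?thesis unfolding c_def using fN cN by (intro ncl_bounded_differences) auto
    next
      case False
      then have "cliques h (g(e := True)) N = cliques h (g(e := False)) N" by (intro cliques_cong) auto
      then show ?thesis using c by simp
    qed
  qed (use assms c S in auto)
  moreover have "measure_pmf.prob (edge_pmf p (all_pairs U))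
       {g. \<not> \<bar>real (ncl h (?o g) (nbrs (?o g) U v)) - real (card (nbrs (?o g) U v) choose h) * p ^ (h choose 2)\<bar> \<le> w}
     \<le> measure_pmf.prob (edge_pmf p (all_pairs U))
      {g. w \<le> \<bar>real (ncl h g N) - measure_pmf.expectation (edge_pmf p (all_pairs U)) (\<lambda>g. real (ncl h g N))\<bar>}"
    unfolding nb cl E by (intro measure_pmf.finite_measure_mono) auto
  ultimately show "measure_pmf.prob (edge_pmf p (all_pairs U))
       {g. \<not> \<bar>real (ncl h (?o g) (nbrs (?o g) U v)) - real (card (nbrs (?o g) U v) choose h) * p ^ (h choose 2)\<bar> \<le> w}
     \<le> 2 * exp (- 2 * w\<^sup>2 / ((real n)\<^sup>2 * (real n ^ h / (real n)\<^sup>2)\<^sup>2))"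
    unfolding c_def by linarith
qed simp

lemma card_small_subsets_le:
  assumes "finite U" "card U \<le> n" "1 \<le> n"
  shows "card {R. R \<subseteq> U \<and> card R \<le> h} \<le> Suc h * n ^ h"
proof -
  have "{R. R \<subseteq> U \<and> card R \<le> h} = (\<Union>j\<in>{..h}. {R. R \<subseteq> U \<and> card R = j})" by auto
  then have "card {R. R \<subseteq> U \<and> card R \<le> h} \<le> (\<Sum>j\<le>h. card {R. R \<subseteq> U \<and> card R = j})"
    by (simp only: card_UN_le finite_atMost)
  also have "\<dots> \<le> (\<Sum>j\<le>h. n ^ h)"
  proof (intro sum_mono)
    fix j assume "j \<in> {..h}"
    then have "n ^ j \<le> n ^ h" using assms(3) by (intro power_increasing) auto
    moreover have "card U choose j \<le> n ^ j"
      using binomial_le_pow[of j "card U"] power_mono[OF assms(2), of j]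
      by (cases "j \<le> card U") (auto simp: not_le binomial_eq_0)
    ultimately show "card {R. R \<subseteq> U \<and> card R = j} \<le> n ^ h" using n_subsets[OF assms(1), of j] by simp
  qed
  finally show ?thesis by simp
qed

text \<open>For a fixed \<open>R\<close> the expected number of common neighbours is at least
  \<open>2 * t\<close>, so falling below \<open>t\<close> is a deviation by \<open>t\<close>. The
  factor in front comes from the union bound over \<open>R\<close>.\<close>

lemma prob_few_common_nbrs_le:
  fixes p :: real
  assumes "finite E" "finite U" "all_pairs U \<subseteq> E" "W \<subseteq> U" "0 < p" "p < 1" "card U \<le> n" "1 \<le> n" "1 \<le> h" "0 \<le> t"
    and t: "2 * t \<le> (real (card (U - W)) - real h) * p ^ h"
  shows "measure_pmf.prob (edge_pmf p E) {f. \<not> many_common_nbrs t h f U W}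
    \<le> real (Suc h * n ^ h) * (2 * exp (- 2 * t\<^sup>2 / (real h * real n)))"
proof -
  let ?R = "{R. R \<subseteq> U \<and> card R \<le> h}" and ?S = "real h * real n"
  define Y where "Y = U - W"
  have fR: "finite ?R" using assms(2) by simp
  have one: "measure_pmf.prob (edge_pmf p E) {f. \<not> t \<le> real (card (common_nbrs f Y R))} \<le> 2 * exp (- 2 * t\<^sup>2 / ?S)"
    if R: "R \<in> ?R" for R
  proof -
    have fin: "finite R" "finite Y" using R assms(2) by (auto simp: Y_def dest: finite_subset)
    let ?m = "real (card (Y - R)) * p ^ card R"
    have "card Y \<le> card (Y - R) + h"
      using diff_card_le_card_Diff[OF fin(1), of Y] R by (elim CollectE conjE) linarith
    then have "real (card Y) - real h \<le> real (card (Y - R))" by linarith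
    moreover have "p ^ h \<le> p ^ card R" using R assms(5,6) by (intro power_decreasing) auto
    ultimately have "(real (card Y) - real h) * p ^ h \<le> ?m"
      using assms(5) mult_mono[of "real (card Y) - real h" "real (card (Y - R))" "p ^ h" "p ^ card R"] by simp
    then have m: "2 * t \<le> ?m" using t by (simp add: Y_def)
    have D: "common_nbrs f Y R = {y\<in>Y - R. \<forall>e\<in>(\<lambda>s. {s, y}) ` R. f e}" for f
      by (auto simp: common_nbrs_def)
    have "measure_pmf.prob (edge_pmf p E) {f. \<not> t \<le> real (card (common_nbrs f Y R))}
      \<le> measure_pmf.prob (edge_pmf p E) {f. t \<le> \<bar>real (card {y\<in>Y - R. \<forall>e\<in>(\<lambda>s. {s, y}) ` R. f e}) - ?m\<bar>}"
      unfolding D using m by (intro measure_pmf.finite_measure_mono) auto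
    also have "\<dots> \<le> 2 * exp (- 2 * t\<^sup>2 / ?S)"
    proof (intro count_deviation)
      fix y assume y: "y \<in> Y - R"
      have "(\<lambda>s. {s, y}) ` R \<subseteq> all_pairs U" using y R by (auto simp: Y_def)
      then show "(\<lambda>s. {s, y}) ` R \<subseteq> E" using assms(3) by (rule subset_trans)
      have "inj_on (\<lambda>s. {s, y}) R" by (auto simp: inj_on_def doubleton_eq_iff)
      then show "card ((\<lambda>s. {s, y}) ` R) = card R" by (rule card_image)
    next
      show "disjoint_family_on (\<lambda>y. (\<lambda>s. {s, y}) ` R) (Y - R)"
        by (auto simp: disjoint_family_on_def doubleton_eq_iff)
      have "card (Y - R) \<le> card U" using assms(2) by (intro card_mono) (auto simp: Y_def)
      then have "card (Y - R) * card R \<le> n * h" using R assms(7) by (intro mult_mono) auto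
      then show "real (card (Y - R)) * real (card R) \<le> ?S"
        by (metis mult.commute of_nat_le_iff of_nat_mult)
      show "0 < ?S" using assms(8,9) by simp
    qed (use assms fin in auto)
    finally show ?thesis .
  qed
  have "{f. \<not> many_common_nbrs t h f U W} = (\<Union>R\<in>?R. {f. \<not> t \<le> real (card (common_nbrs f Y R))})"
    by (auto simp: many_common_nbrs_def Y_def)
  then have "measure_pmf.prob (edge_pmf p E) {f. \<not> many_common_nbrs t h f U W} \<le>
      (\<Sum>R\<in>?R. measure_pmf.prob (edge_pmf p E) {f. \<not> t \<le> real (card (common_nbrs f Y R))})"
    using measure_UNION_le[OF fR, of "\<lambda>R. {f. \<not> t \<le> real (card (common_nbrs f Y R))}" "edge_pmf p E"] by simp
  also have "\<dots> \<le> (\<Sum>R\<in>?R. 2 * exp (- 2 * t\<^sup>2 / ?S))" by (intro sum_mono one)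
  also have "\<dots> = real (card ?R) * (2 * exp (- 2 * t\<^sup>2 / ?S))" by simp
  also have "\<dots> \<le> real (Suc h * n ^ h) * (2 * exp (- 2 * t\<^sup>2 / ?S))"
    using card_small_subsets_le[OF assms(2,7,8), of h] by (intro mult_right_mono of_nat_mono) auto
  finally show ?thesis .
qed

text \<open>The quotient of the two binomials is the probability that a uniform \<open>k\<close>-set
  misses \<open>b\<close> given points. Each point costs a factor \<open>1 - k / N\<close>, with
  \<open>N \<le> n\<close> points remaining, which is at most \<open>1 - c\<close>.\<close>

lemma binomial_diff_le:
  fixes c :: real
  assumes "b \<le> n" "c * real n \<le> real k" "c \<le> 1"
  shows "real ((n - b) choose k) \<le> (1 - c) ^ b * real (n choose k)"
  using assms(1)
proof (induction b)
  case (Suc b)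
  define m where "m = n - Suc b"
  have m: "n - b = Suc m" using Suc.prems by (simp add: m_def)
  have "real (Suc m) * real (m choose k) = (real (Suc m) - real k) * real (Suc m choose k)"
  proof (cases "k \<le> Suc m")
    case True
    have "Suc m * (m choose k) = (Suc m - k) * (Suc m choose k)"
      using binomial_absorb_comp[of "Suc m" k] by simp
    then show ?thesis using True by (metis of_nat_diff of_nat_mult)
  next
    case False
    then show ?thesis by (simp add: binomial_eq_0)
  qed
  also have "\<dots> \<le> ((1 - c) * real (Suc m)) * real (Suc m choose k)"
  proof (intro mult_right_mono)
    show "real (Suc m) - real k \<le> (1 - c) * real (Suc m)"
    proof (cases "0 \<le> c")
      case True
      have "c * real (Suc m) \<le> c * real n" using Suc.prems True by (intro mult_left_mono) (auto simp: m_def)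
      then show ?thesis using assms(2) by (simp add: algebra_simps)
    next
      case False
      then have "c * real (Suc m) \<le> 0" by (simp add: mult_nonpos_nonneg)
      then show ?thesis by (simp add: left_diff_distrib)
    qed
  qed simp
  finally have "real (Suc m) * real (m choose k) \<le> real (Suc m) * ((1 - c) * real (Suc m choose k))"
    by (simp only: mult_ac)
  then have "real (m choose k) \<le> (1 - c) * real (Suc m choose k)"
    by (subst (asm) mult_le_cancel_left_pos) auto
  also have "\<dots> \<le> (1 - c) * ((1 - c) ^ b * real (n choose k))"
    using Suc.IH Suc.prems assms(3) m by (intro mult_left_mono) auto
  finally show ?case by (simp add: m_def)
qed simp

lemma subsets_card_nonempty: "finite V \<Longrightarrow> k \<le> card V \<Longrightarrow> {U. U \<subseteq> V \<and> card U = k} \<noteq> {}"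
  using obtain_subset_with_card_n by blast

text \<open>Split \<open>T\<close> into \<open>r\<close> disjoint blocks of size \<open>b\<close>: if \<open>U\<close> has fewer than \<open>r\<close> elements in \<open>T\<close>, it
  misses one of them.\<close>

lemma prob_subset_Int_small_le:
  assumes "finite V" "T \<subseteq> V" "r * b \<le> card T" "k \<le> card V" "c * real (card V) \<le> real k" "0 \<le> c" "c \<le> 1"
  shows "measure_pmf.prob (pmf_of_set {U. U \<subseteq> V \<and> card U = k}) {U. card (T \<inter> U) < r} \<le> real r * (1 - c) ^ b"
  using assms(2,3)
proof (induction r arbitrary: T)
  case (Suc r)
  let ?M = "pmf_of_set {U. U \<subseteq> V \<and> card U = k}"
  have fT: "finite T" using Suc.prems assms(1) by (auto dest: finite_subset)
  from Suc.prems obtain B where B: "B \<subseteq> T" "card B = b" "finite B"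
    using obtain_subset_with_card_n[of b T] by auto
  have BV: "B \<subseteq> V" using B Suc.prems by auto
  have miss: "measure_pmf.prob ?M {U. B \<inter> U = {}} \<le> (1 - c) ^ b"
  proof -
    have "measure_pmf.prob ?M {U. B \<inter> U = {}} =
        real (card ({U. U \<subseteq> V \<and> card U = k} \<inter> {U. B \<inter> U = {}})) / real (card {U. U \<subseteq> V \<and> card U = k})"
      using assms(1,4) by (intro measure_pmf_of_set subsets_card_nonempty) auto
    also have "{U. U \<subseteq> V \<and> card U = k} \<inter> {U. B \<inter> U = {}} = {U. U \<subseteq> V - B \<and> card U = k}" by auto
    also have "card \<dots> = (card V - b) choose k"
      using assms(1) B BV by (subst n_subsets) (auto simp: card_Diff_subset)
    also have "card {U. U \<subseteq> V \<and> card U = k} = card V choose k" using assms(1) by (rule n_subsets)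
    also have "real ((card V - b) choose k) / real (card V choose k) \<le> (1 - c) ^ b"
      using binomial_diff_le[of b "card V" c k] card_mono[OF assms(1) BV] B assms(4,5,7)
      by (simp add: pos_divide_le_eq)
    finally show ?thesis .
  qed
  have "{U. card (T \<inter> U) < Suc r} \<subseteq> {U. B \<inter> U = {}} \<union> {U. card ((T - B) \<inter> U) < r}"
  proof (intro subsetI UnCI CollectI)
    fix U assume U: "U \<in> {U. card (T \<inter> U) < Suc r}" "U \<notin> {U. card ((T - B) \<inter> U) < r}"
    have "card (T \<inter> U) = card (B \<inter> U) + card ((T - B) \<inter> U)"
      using B fT by (subst card_Un_disjoint[symmetric]) (auto intro!: arg_cong[of _ _ card])
    with U have "card (B \<inter> U) = 0" by auto
    then show "B \<inter> U = {}" using B by auto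
  qed
  then have "measure_pmf.prob ?M {U. card (T \<inter> U) < Suc r}
      \<le> measure_pmf.prob ?M ({U. B \<inter> U = {}} \<union> {U. card ((T - B) \<inter> U) < r})"
    by (intro measure_pmf.finite_measure_mono) auto
  also have "\<dots> \<le> measure_pmf.prob ?M {U. B \<inter> U = {}} + measure_pmf.prob ?M {U. card ((T - B) \<inter> U) < r}"
    by (intro measure_Un_le) auto
  also have "\<dots> \<le> (1 - c) ^ b + real r * (1 - c) ^ b"
    using Suc.prems B fT by (intro add_mono miss Suc.IH) (auto simp: card_Diff_subset)
  finally show ?case by (simp add: algebra_simps)
qed simp

text \<open>The complement of a uniform \<open>k\<close>-set is a uniform set of the complementary
  size, which reduces the claim to intersections.\<close>

lemma prob_subset_Diff_small_le:
  assumes "finite V" "T \<subseteq> V" "r * b \<le> card T" "k \<le> card V" "real k \<le> (1 - c) * real (card V)" "0 \<le> c" "c \<le> 1"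
  shows "measure_pmf.prob (pmf_of_set {U. U \<subseteq> V \<and> card U = k}) {U. card (T - U) < r} \<le> real r * (1 - c) ^ b"
proof -
  let ?A = "\<lambda>k. {U. U \<subseteq> V \<and> card U = k}"
  have "bij_betw (\<lambda>U. V - U) (?A (card V - k)) (?A k)"
    using assms(1,4)
    by (intro bij_betw_byWitness[of _ "\<lambda>U. V - U"]) (auto simp: card_Diff_subset finite_subset double_diff)
  then have "pmf_of_set (?A k) = map_pmf (\<lambda>U. V - U) (pmf_of_set (?A (card V - k)))"
    using assms(1,4) by (intro map_pmf_of_set_bij_betw[symmetric] subsets_card_nonempty) auto
  then have "measure_pmf.prob (pmf_of_set (?A k)) {U. card (T - U) < r} =
      measure_pmf.prob (pmf_of_set (?A (card V - k))) {U. card (T - (V - U)) < r}"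
    by (simp add: vimage_def)
  also have "\<dots> = measure_pmf.prob (pmf_of_set (?A (card V - k))) {U. card (T \<inter> U) < r}"
  proof -
    have "T - (V - U) = T \<inter> U" for U using assms(2) by auto
    then show ?thesis by simp
  qed
  also have "\<dots> \<le> real r * (1 - c) ^ b"
    using assms by (intro prob_subset_Int_small_le) (auto simp: of_nat_diff algebra_simps)
  finally show ?thesis .
qed

section \<open>Moments\<close>

abbreviation subset_pmf :: "'a set \<Rightarrow> nat \<Rightarrow> 'a set pmf" where
  "subset_pmf V k \<equiv> pmf_of_set {U. U \<subseteq> V \<and> card U = k}"

lemma prob_resample_coordinate_le:
  assumes "finite I" "i \<in> I" "0 \<le> \<beta>"
    and "\<And>xs. measure_pmf.prob (N i) {u. P (xs(i := u))} \<le> \<beta>"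
  shows "measure_pmf.prob (Pi_pmf I d N) {xs. P xs} \<le> \<beta>"
proof (rule prob_resample_le[OF assms(1) _ assms(3)])
  show "{i} \<subseteq> I" using assms(2) by simp
  fix xs
  have "override_on xs (\<lambda>x. if x = i then u else d) {i} = xs(i := u)" for u
    by (auto simp: override_on_def fun_eq_iff)
  then show "measure_pmf.prob (Pi_pmf {i} d N) {g. P (override_on xs g {i})} \<le> \<beta>"
    using assms(4)[of xs] by (simp add: Pi_pmf_singleton vimage_def)
qed

text \<open>The sets are revealed one at a time. Unless an event of probability at most
  \<open>card V * (1 - c) ^ b\<close> occurs, each leaves about a fraction \<open>1 / b\<close> of
  what was uncovered before; hence the factor \<open>b ^ card J\<close>. This is wasteful, but
  \<open>b\<close> will be a tiny power of \<open>card V\<close>.\<close>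

lemma prob_uncovered_small_le:
  fixes c :: real
  assumes "finite V" "finite I" "J \<subseteq> I" "k \<le> card V" "real k \<le> (1 - c) * real (card V)" "0 \<le> c" "c \<le> 1"
    and "1 \<le> b" "r * b ^ card J \<le> card V"
  shows "measure_pmf.prob (Pi_pmf I {} (\<lambda>_. subset_pmf V k)) {xs. card (V - \<Union> (xs ` J)) < r}
    \<le> real (card J) * (real (card V) * (1 - c) ^ b)"
proof -
  let ?M = "Pi_pmf I {} (\<lambda>_. subset_pmf V k)"
  have fJ: "finite J" using assms(2,3) by (rule rev_finite_subset)
  show ?thesis
    using fJ assms(3,9)
  proof (induction J arbitrary: r rule: finite_induct)
    case empty
    then have "{xs :: 'b \<Rightarrow> 'a set. card (V - \<Union> (xs ` {})) < r} = {}" by auto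
    then show ?case by (simp only: measure_empty) simp
  next
    case (insert a J)
    have r: "r \<le> card V"
    proof -
      have "r * 1 \<le> r * b ^ card (insert a J)" using assms(8) by (intro mult_left_mono) auto
      then show ?thesis using insert.prems by linarith
    qed
    have IH: "measure_pmf.prob ?M {xs. card (V - \<Union> (xs ` J)) < r * b} \<le> real (card J) * (real (card V) * (1 - c) ^ b)"
      using insert by (intro insert.IH) (auto simp: mult.assoc)
    have new: "measure_pmf.prob ?M {xs. r * b \<le> card (V - \<Union> (xs ` J)) \<and> card (V - \<Union> (xs ` J) - xs a) < r}
        \<le> real (card V) * (1 - c) ^ b"
    proof (rule prob_resample_coordinate_le)
      fix xs :: "'b \<Rightarrow> 'a set"
      let ?T = "V - \<Union> (xs ` J)"
      have J: "(xs(a := u)) ` J = xs ` J" for u using insert.hyps by auto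
      show "measure_pmf.prob (subset_pmf V k) {u. r * b \<le> card (V - \<Union> ((xs(a := u)) ` J)) \<and>
          card (V - \<Union> ((xs(a := u)) ` J) - (xs(a := u)) a) < r} \<le> real (card V) * (1 - c) ^ b"
      proof (cases "r * b \<le> card ?T")
        case True
        have "measure_pmf.prob (subset_pmf V k) {u. card (?T - u) < r} \<le> real r * (1 - c) ^ b"
          using True assms by (intro prob_subset_Diff_small_le) auto
        also have "\<dots> \<le> real (card V) * (1 - c) ^ b" using r assms by (intro mult_right_mono) auto
        finally show ?thesis unfolding J using True by simp
      next
        case False
        then show ?thesis unfolding J using assms by simp
      qed
    qed (use insert assms in auto)
    have "{xs. card (V - \<Union> (xs ` insert a J)) < r} \<subseteq> {xs. card (V - \<Union> (xs ` J)) < r * b} \<union>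
        {xs. r * b \<le> card (V - \<Union> (xs ` J)) \<and> card (V - \<Union> (xs ` J) - xs a) < r}"
    proof -
      have "V - \<Union> (xs ` insert a J) = V - \<Union> (xs ` J) - xs a" for xs :: "'b \<Rightarrow> 'a set" by auto
      then show ?thesis by auto
    qed
    then have "measure_pmf.prob ?M {xs. card (V - \<Union> (xs ` insert a J)) < r} \<le>
      measure_pmf.prob ?M ({xs. card (V - \<Union> (xs ` J)) < r * b} \<union>
        {xs. r * b \<le> card (V - \<Union> (xs ` J)) \<and> card (V - \<Union> (xs ` J) - xs a) < r})"
      by (intro measure_pmf.finite_measure_mono) auto
    also have "\<dots> \<le> real (card J) * (real (card V) * (1 - c) ^ b) + real (card V) * (1 - c) ^ b"
      by (rule order_trans[OF measure_Un_le add_mono[OF IH new]]) auto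
    finally show ?case using insert.hyps by (simp add: algebra_simps)
  qed
qed

text \<open>The exponent \<open>card I\<close> spends one factor \<open>b\<close> on each of the
  other sets, which must leave enough uncovered, and one on \<open>xs i\<close>, which must hit
  enough of the remainder.\<close>

lemma prob_exclusive_part_small_le:
  fixes c :: real
  assumes "finite V" "finite I" "i \<in> I" "k \<le> card V"
    and "c * real (card V) \<le> real k" "real k \<le> (1 - c) * real (card V)" "0 \<le> c" "c \<le> 1"
    and "1 \<le> b" "r * b ^ card I \<le> card V"
  shows "measure_pmf.prob (Pi_pmf I {} (\<lambda>_. subset_pmf V k)) {xs. card ((V - \<Union> (xs ` (I - {i}))) \<inter> xs i) < r}
    \<le> real (card I) * (real (card V) * (1 - c) ^ b)"
proof -
  let ?M = "Pi_pmf I {} (\<lambda>_. subset_pmf V k)" and ?J = "I - {i}"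
  have cI: "card I = Suc (card ?J)" using assms(2,3) by (metis card_Suc_Diff1)
  have r: "r \<le> card V"
  proof -
    have "r * 1 \<le> r * b ^ card I" using assms(9) by (intro mult_left_mono) auto
    then show ?thesis using assms(10) by linarith
  qed
  have 1: "measure_pmf.prob ?M {xs. card (V - \<Union> (xs ` ?J)) < r * b} \<le> real (card ?J) * (real (card V) * (1 - c) ^ b)"
    using assms by (intro prob_uncovered_small_le) (auto simp: cI mult.assoc simp del: card_Diff_insert)
  have 2: "measure_pmf.prob ?M {xs. r * b \<le> card (V - \<Union> (xs ` ?J)) \<and> card ((V - \<Union> (xs ` ?J)) \<inter> xs i) < r}
      \<le> real (card V) * (1 - c) ^ b"
  proof (rule prob_resample_coordinate_le[OF assms(2,3)])
    fix xs :: "'b \<Rightarrow> 'a set"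
    let ?T = "V - \<Union> (xs ` ?J)"
    have J: "(xs(i := u)) ` ?J = xs ` ?J" for u by auto
    show "measure_pmf.prob (subset_pmf V k) {u. r * b \<le> card (V - \<Union> ((xs(i := u)) ` ?J)) \<and>
        card ((V - \<Union> ((xs(i := u)) ` ?J)) \<inter> (xs(i := u)) i) < r} \<le> real (card V) * (1 - c) ^ b"
    proof (cases "r * b \<le> card ?T")
      case True
      have "measure_pmf.prob (subset_pmf V k) {u. card (?T \<inter> u) < r} \<le> real r * (1 - c) ^ b"
        using True assms by (intro prob_subset_Int_small_le) auto
      also have "\<dots> \<le> real (card V) * (1 - c) ^ b" using r assms by (intro mult_right_mono) auto
      finally show ?thesis unfolding J using True by simp
    next
      case False
      then show ?thesis unfolding J using assms by simp
    qed
  qed (use assms in auto)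
  have "{xs. card ((V - \<Union> (xs ` ?J)) \<inter> xs i) < r} \<subseteq> {xs. card (V - \<Union> (xs ` ?J)) < r * b} \<union>
      {xs. r * b \<le> card (V - \<Union> (xs ` ?J)) \<and> card ((V - \<Union> (xs ` ?J)) \<inter> xs i) < r}" by auto
  then have "measure_pmf.prob ?M {xs. card ((V - \<Union> (xs ` ?J)) \<inter> xs i) < r} \<le>
    measure_pmf.prob ?M ({xs. card (V - \<Union> (xs ` ?J)) < r * b} \<union>
      {xs. r * b \<le> card (V - \<Union> (xs ` ?J)) \<and> card ((V - \<Union> (xs ` ?J)) \<inter> xs i) < r})"
    by (intro measure_pmf.finite_measure_mono) auto
  also have "\<dots> \<le> real (card ?J) * (real (card V) * (1 - c) ^ b) + real (card V) * (1 - c) ^ b"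
    by (rule order_trans[OF measure_Un_le add_mono[OF 1 2]]) auto
  finally show ?thesis unfolding cI by (simp add: algebra_simps)
qed

text \<open>The events are peeled off one at a time. \<open>D i\<close> contains the coordinates
  resampled for event \<open>i\<close>; the conjunction of the events treated before ignores them,
  so it can play the role of \<open>A\<close>.\<close>

lemma prob_all_le_power:
  fixes M :: "('a \<Rightarrow> 'b) pmf"
  assumes "finite I" "0 \<le> q"
    and step: "\<And>i A. i \<in> I \<Longrightarrow> (\<And>f g. (\<And>e. e \<notin> D i \<Longrightarrow> f e = g e) \<Longrightarrow> A f = A g) \<Longrightarrow>
      measure_pmf.prob M {f. A f \<and> B i f} \<le> q * measure_pmf.prob M {f. A f}"
    and indep: "\<And>i j f g. i \<in> I \<Longrightarrow> j \<in> I \<Longrightarrow> i \<noteq> j \<Longrightarrow> (\<And>e. e \<notin> D i \<Longrightarrow> f e = g e) \<Longrightarrow> B j f = B j g"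
  shows "measure_pmf.prob M {f. \<forall>i\<in>I. B i f} \<le> q ^ card I"
proof -
  have "measure_pmf.prob M {f. \<forall>i\<in>J. B i f} \<le> q ^ card J" if "finite J" "J \<subseteq> I" for J
    using that
  proof (induction J rule: finite_induct)
    case (insert a J)
    have "{f. \<forall>i\<in>insert a J. B i f} = {f. (\<forall>i\<in>J. B i f) \<and> B a f}" by auto
    also have "measure_pmf.prob M \<dots> \<le> q * measure_pmf.prob M {f. \<forall>i\<in>J. B i f}"
    proof (rule step)
      fix f g :: "'a \<Rightarrow> 'b" assume eq: "\<And>e. e \<notin> D a \<Longrightarrow> f e = g e"
      have "B i f = B i g" if "i \<in> J" for i
        using that insert by (intro indep[of a i f g] eq) auto
      then show "(\<forall>i\<in>J. B i f) = (\<forall>i\<in>J. B i g)" by blast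
    qed (use insert in auto)
    also have "\<dots> \<le> q * q ^ card J" using insert assms(2) by (intro mult_left_mono) auto
    finally show ?case using insert.hyps by simp
  qed simp
  from this[OF assms(1) subset_refl] show ?thesis .
qed

text \<open>Everything that the conditional bound asks for besides the exact count.
  \<open>\<mu> d\<close> stands for the expected number of \<open>h\<close>-cliques in a
  neighbourhood of size \<open>d\<close>. All conditions involve only pairs inside \<open>U\<close>
  or between \<open>v\<close> and \<open>U\<close>, so the events of different sets can be kept
  apart.\<close>

definition typical ::
  "real \<Rightarrow> real \<Rightarrow> real \<Rightarrow> real \<Rightarrow> (nat \<Rightarrow> real) \<Rightarrow> nat \<Rightarrow> ('a set \<Rightarrow> bool) \<Rightarrow> 'a set \<Rightarrow> 'a \<Rightarrow> 'a set \<Rightarrow> bool" where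
  "typical c q t w \<mu> h f U v W \<longleftrightarrow>
     \<bar>real (ncl h f (nbrs f U v)) - \<mu> (card (nbrs f U v))\<bar> \<le> w \<and>
     c * real (card U) \<le> real (card (nbrs f U v)) \<and> real (card (nbrs f U v)) \<le> (1 - c) * real (card U) \<and>
     clique_dispersed c q h f U \<and> many_common_nbrs t h f U W"

lemma typical_cong:
  assumes "\<And>e. e \<in> all_pairs U \<Longrightarrow> f e = g e" "v \<in> U"
  shows "typical c q t w \<mu> h f (U - {v}) v W = typical c q t w \<mu> h g (U - {v}) v W"
proof -
  have sub: "all_pairs (U - {v}) \<subseteq> all_pairs U" by (rule all_pairs_mono) auto
  have nb: "nbrs f (U - {v}) v = nbrs g (U - {v}) v"
    using assms(2) by (auto simp: nbrs_def assms(1))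
  have "all_pairs (nbrs g (U - {v}) v) \<subseteq> all_pairs U" by (rule all_pairs_mono) (auto simp: nbrs_def)
  then have "cliques h f (nbrs g (U - {v}) v) = cliques h g (nbrs g (U - {v}) v)"
    by (intro cliques_cong assms(1)) blast
  moreover have "clique_dispersed c q h f (U - {v}) = clique_dispersed c q h g (U - {v})"
    using sub by (intro clique_dispersed_cong assms(1)) blast
  moreover have "many_common_nbrs t h f (U - {v}) W = many_common_nbrs t h g (U - {v}) W"
    using sub by (intro many_common_nbrs_cong assms(1)) blast
  ultimately show ?thesis unfolding typical_def nb by simp
qed

text \<open>The \<open>m\<close>-th moment of \<open>P(U has l cliques)\<close> is the probability that \<open>m\<close> independent random
  sets all have \<open>l\<close> cliques. If each of them has enough vertices of its own, resampling the pairs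
  at these vertices makes the \<open>m\<close> events independent.\<close>

lemma prob_many_subsets_le:
  fixes c c' p q t w Q \<tau> \<alpha> :: real and \<mu> :: "nat \<Rightarrow> real"
  assumes "finite V" "k \<le> card V" "c * real (card V) \<le> real k" "real k \<le> (1 - c) * real (card V)" "0 \<le> c" "c \<le> 1"
    and "0 < p" "p < 1" "2 \<le> s" "0 < t" "0 \<le> q" "0 < \<alpha>" "0 \<le> \<tau>"
    and b: "1 \<le> b" "Suc s * b ^ m \<le> card V"
    and L: "2 * w < real L * (t ^ h / fact h)"
    and Q: "q * (real L * (4 / sqrt (p * (1 - p)) / sqrt (real (s choose 2)))) \<le> Q"
    and atypical: "\<And>U v W. U \<subseteq> V \<Longrightarrow> card U = k \<Longrightarrow> v \<in> U \<Longrightarrow> W \<subseteq> U - {v} \<Longrightarrow> card W = s \<Longrightarrow>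
      measure_pmf.prob (edge_pmf p (all_pairs V)) {f. \<not> typical c' q t w \<mu> (Suc h) f (U - {v}) v W} \<le> \<tau>"
  shows "measure_pmf.prob (edge_pmf p (all_pairs V))
      {f. \<alpha> \<le> measure_pmf.prob (subset_pmf V k) {U. ncl (h + 2) f U = l}}
    \<le> (Q ^ m + real m * \<tau> + real m * (real m * (real (card V) * (1 - c) ^ b))) / \<alpha> ^ m"
proof -
  let ?M = "edge_pmf p (all_pairs V)" and ?I = "{..<m}"
  let ?N = "Pi_pmf ?I {} (\<lambda>_. subset_pmf V k)"
  let ?q2 = "real L * (4 / sqrt (p * (1 - p)) / sqrt (real (s choose 2)))"
  define excl where "excl xs i = (V - \<Union> (xs ` (?I - {i}))) \<inter> xs i" for xs :: "nat \<Rightarrow> 'a set" and i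
  have Q0: "0 \<le> Q" using assms(7,8,11) by (intro order_trans[OF _ Q]) auto
  have fE: "finite (all_pairs V)" using assms(1) by simp
  have bad: "measure_pmf.prob ?N {xs. \<exists>i\<in>?I. card (excl xs i) < Suc s}
      \<le> real m * (real m * (real (card V) * (1 - c) ^ b))"
  proof -
    have "{xs. \<exists>i\<in>?I. card (excl xs i) < Suc s} = (\<Union>i\<in>?I. {xs. card (excl xs i) < Suc s})" by auto
    then have "measure_pmf.prob ?N {xs. \<exists>i\<in>?I. card (excl xs i) < Suc s}
        \<le> (\<Sum>i\<in>?I. measure_pmf.prob ?N {xs. card (excl xs i) < Suc s})"
      using measure_UNION_le[of ?I "\<lambda>i. {xs. card (excl xs i) < Suc s}" ?N] by simp
    also have "\<dots> \<le> (\<Sum>i\<in>?I. real (card ?I) * (real (card V) * (1 - c) ^ b))"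
      unfolding excl_def using assms(1-6) b
      by (intro sum_mono prob_exclusive_part_small_le) auto
    finally show ?thesis by simp
  qed
  have good: "measure_pmf.prob ?M {f. \<forall>i\<in>?I. ncl (h + 2) f (xs i) = l} \<le> Q ^ m + real m * \<tau>"
    if xs: "xs \<in> set_pmf ?N" "xs \<notin> {xs. \<exists>i\<in>?I. card (excl xs i) < Suc s}" for xs
  proof -
    have xsV: "xs i \<subseteq> V \<and> card (xs i) = k" if "i < m" for i
    proof -
      have "xs i \<in> set_pmf (subset_pmf V k)"
        using xs(1) that set_Pi_pmf_subset'[of ?I "{}" "\<lambda>_. subset_pmf V k"] by (auto simp: PiE_dflt_def)
      then show ?thesis using subsets_card_nonempty[OF assms(1,2)] assms(1) by (auto simp: set_pmf_of_set)
    qed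
    have "\<exists>v W. v \<in> excl xs i \<and> W \<subseteq> excl xs i - {v} \<and> card W = s" if "i < m" for i
    proof -
      \<comment> \<open>One exclusive vertex serves as \<open>v\<close> and the other
        \<open>s\<close> form \<open>W\<close>.\<close>
      have "Suc s \<le> card (excl xs i)" using xs(2) that by (auto simp: not_less)
      then obtain Z where Z: "Z \<subseteq> excl xs i" "card Z = Suc s" by (meson obtain_subset_with_card_n)
      then obtain v W where "Z = insert v W" "v \<notin> W" "card W = s" by (auto simp: card_Suc_eq)
      then show ?thesis using Z by (intro exI[of _ v] exI[of _ W]) auto
    qed
    then obtain v W where vW: "\<And>i. i < m \<Longrightarrow> v i \<in> excl xs i \<and> W i \<subseteq> excl xs i - {v i} \<and> card (W i) = s"
      by metis
    have vx: "v i \<in> xs i" "W i \<subseteq> xs i - {v i}" "card (W i) = s" if "i < m" for i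
      using vW[OF that] by (auto simp: excl_def)
    have disj: "v i \<notin> xs j" "W i \<inter> xs j = {}" if "i < m" "j < m" "i \<noteq> j" for i j
      using vW[OF that(1)] that(2,3) by (auto simp: excl_def)
    define typ_i where "typ_i i f = typical c' q t w \<mu> (Suc h) f (xs i - {v i}) (v i) (W i)" for i f
    define B where "B i f \<longleftrightarrow> ncl (h + 2) f (xs i) = l \<and> typ_i i f" for i f
    define D where "D i = star (v i) (xs i - {v i}) \<union> all_pairs (W i)" for i
    have B: "measure_pmf.prob ?M {f. \<forall>i\<in>?I. B i f} \<le> Q ^ card ?I"
    proof (rule prob_all_le_power[OF _ Q0, where D = D])
      fix i and A :: "('a set \<Rightarrow> bool) \<Rightarrow> bool"
      assume i: "i \<in> ?I" and A: "\<And>f g. (\<And>e. e \<notin> D i \<Longrightarrow> f e = g e) \<Longrightarrow> A f = A g"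
      have im: "i < m" using i by simp
      have fin: "finite (xs i)" using xsV[OF im] assms(1) by (auto dest: finite_subset)
      have sub: "all_pairs (xs i) \<subseteq> all_pairs V" using xsV[OF im] by (intro all_pairs_mono) auto
      have "measure_pmf.prob ?M {f. A f \<and> B i f} \<le> q * (real L * (4 / sqrt (p * (1 - p)) / sqrt (real (card (W i) choose 2)))) *
          measure_pmf.prob ?M {f. A f}"
        unfolding B_def typ_i_def typical_def
      proof (rule prob_ncl_eq_conditional_le[OF fE fin vx(1)[OF im] sub vx(2)[OF im] _ assms(7,8,10,11) L])
        show "2 \<le> card (W i)" using vx(3)[OF im] assms(9) by simp
        show "A f = A g" if "\<And>e. e \<notin> star (v i) (xs i - {v i}) \<Longrightarrow> e \<notin> all_pairs (W i) \<Longrightarrow> f e = g e" for f g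
          by (rule A, rule that) (auto simp: D_def)
      qed
      also have "\<dots> \<le> Q * measure_pmf.prob ?M {f. A f}"
        using Q vx(3)[OF im] by (intro mult_right_mono) auto
      finally show "measure_pmf.prob ?M {f. A f \<and> B i f} \<le> Q * measure_pmf.prob ?M {f. A f}" .
    next
      fix i j and f g :: "'a set \<Rightarrow> bool"
      assume ij: "i \<in> ?I" "j \<in> ?I" "i \<noteq> j" and eq: "\<And>e. e \<notin> D i \<Longrightarrow> f e = g e"
      have im: "i < m" "j < m" using ij by auto
      \<comment> \<open>A pair of \<open>D i\<close> contains \<open>v i\<close> or lies inside
        \<open>W i\<close>. Both avoid \<open>xs j\<close>, so such a pair is not a pair of
        \<open>xs j\<close>.\<close>
      have eq': "f e = g e" if e: "e \<in> all_pairs (xs j)" for e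
      proof (rule eq)
        have "e \<subseteq> xs j" "e \<noteq> {}" using e by (auto simp: all_pairs_def)
        then have "v i \<notin> e" "\<not> e \<subseteq> W i" using disj[OF im ij(3)] by blast+
        then show "e \<notin> D i" by (auto simp: D_def all_pairs_def)
      qed
      then have "cliques (h + 2) f (xs j) = cliques (h + 2) g (xs j)" by (rule cliques_cong)
      moreover have "typ_i j f = typ_i j g"
        unfolding typ_i_def using eq' vx(1)[OF im(2)] by (rule typical_cong)
      ultimately show "B j f = B j g" unfolding B_def by simp
    qed simp
    have T: "measure_pmf.prob ?M {f. \<exists>i\<in>?I. \<not> typ_i i f} \<le> real m * \<tau>"
    proof -
      have "{f. \<exists>i\<in>?I. \<not> typ_i i f} = (\<Union>i\<in>?I. {f. \<not> typ_i i f})" by auto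
      then have "measure_pmf.prob ?M {f. \<exists>i\<in>?I. \<not> typ_i i f} \<le> (\<Sum>i\<in>?I. measure_pmf.prob ?M {f. \<not> typ_i i f})"
        using measure_UNION_le[of ?I "\<lambda>i. {f. \<not> typ_i i f}" ?M] by simp
      also have "\<dots> \<le> (\<Sum>i\<in>?I. \<tau>)"
        unfolding typ_i_def using xsV vx by (intro sum_mono atypical) auto
      finally show ?thesis by simp
    qed
    have "measure_pmf.prob ?M {f. \<forall>i\<in>?I. ncl (h + 2) f (xs i) = l}
        \<le> measure_pmf.prob ?M ({f. \<forall>i\<in>?I. B i f} \<union> {f. \<exists>i\<in>?I. \<not> typ_i i f})"
      by (intro measure_pmf.finite_measure_mono) (auto simp: B_def)
    also have "\<dots> \<le> Q ^ card ?I + real m * \<tau>"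
      by (rule order_trans[OF measure_Un_le add_mono[OF B T]]) auto
    finally show ?thesis by simp
  qed
  \<comment> \<open>The \<open>m\<close>-th power of the proportion is the probability that
    \<open>m\<close> independent sets all have \<open>l\<close> cliques.\<close>
  have "measure_pmf.prob ?M {f. \<alpha> \<le> measure_pmf.prob (subset_pmf V k) {U. ncl (h + 2) f U = l}}
      \<le> measure_pmf.prob ?M {f. \<alpha> ^ m \<le> measure_pmf.prob ?N {xs. \<forall>i\<in>?I. ncl (h + 2) f (xs i) = l}}"
  proof (intro measure_pmf.finite_measure_mono subsetI CollectI)
    fix f assume "f \<in> {f. \<alpha> \<le> measure_pmf.prob (subset_pmf V k) {U. ncl (h + 2) f U = l}}"
    then have "\<alpha> ^ m \<le> measure_pmf.prob (subset_pmf V k) {U. ncl (h + 2) f U = l} ^ m"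
      using assms(12) by (intro power_mono) auto
    then show "\<alpha> ^ m \<le> measure_pmf.prob ?N {xs. \<forall>i\<in>?I. ncl (h + 2) f (xs i) = l}"
      using prob_Pi_pmf_all[of ?I "{}" "subset_pmf V k" "\<lambda>U. ncl (h + 2) f U = l"] by simp
  qed simp
  also have "\<dots> \<le> (Q ^ m + real m * \<tau> + real m * (real m * (real (card V) * (1 - c) ^ b))) / \<alpha> ^ m"
  proof (rule prob_ge_swap_Markov[OF _ _ good bad])
    show "0 < \<alpha> ^ m" using assms(12) by simp
    show "0 \<le> Q ^ m + real m * \<tau>" using Q0 assms(13) by simp
  qed
  finally show ?thesis .
qed

section \<open>Asymptotics\<close>

lemma clique_dispersed_ge_1:
  assumes "finite V" "1 \<le> q"
  shows "clique_dispersed c q h f V"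
  unfolding clique_dispersed_def
proof (intro allI impI)
  fix k l
  have "card {U. U \<subseteq> V \<and> card U = k \<and> ncl h f U = l} \<le> card {U. U \<subseteq> V \<and> card U = k}"
    using assms(1) by (intro card_mono) auto
  then have "real (card {U. U \<subseteq> V \<and> card U = k \<and> ncl h f U = l}) \<le> real (card V choose k) * 1"
    using n_subsets[OF assms(1), of k] by simp
  also have "\<dots> \<le> real (card V choose k) * q" using assms(2) by (intro mult_left_mono) auto
  finally show "real (card {U. U \<subseteq> V \<and> card U = k \<and> ncl h f U = l}) \<le> real (card V choose k) * q" .
qed

text \<open>Each of the four parts of \<open>typical\<close> may fail with probability a quarter of
  the allowance. Asking for the exponent \<open>K + 1\<close> in the assumption absorbs both this
  quarter and the passage from \<open>n\<close> to \<open>card U'\<close>, which is at least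
  \<open>c * n / 2\<close>.\<close>

lemma eventually_atypical_le:
  fixes c p \<eta> K :: real and h n0 :: nat
  defines "c' \<equiv> min p (1 - p) / 2"
  assumes p: "0 < p" "p < 1" and c: "0 < c" and \<eta>: "0 < \<eta>" "\<eta> < 1"
    and disp: "\<forall>V :: 'a set. finite V \<longrightarrow> n0 \<le> card V \<longrightarrow>
      measure_pmf.prob (edge_pmf p (all_pairs V))
        {f. \<not> clique_dispersed c' (real (card V) powr (\<eta> - real h)) (Suc h) f V} \<le> real (card V) powr - (K + 1)"
  shows "eventually (\<lambda>n. \<forall>(V :: 'a set) k U v W.
      finite V \<longrightarrow> card V = n \<longrightarrow> c * real n \<le> real k \<longrightarrow> U \<subseteq> V \<longrightarrow> card U = k \<longrightarrow> v \<in> U \<longrightarrow> W \<subseteq> U - {v} \<longrightarrow>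
      real (card W) \<le> real n powr (1 - \<eta>) \<longrightarrow>
      measure_pmf.prob (edge_pmf p (all_pairs V))
        {f. \<not> typical c' (real (k - 1) powr (\<eta> - real h)) (p ^ Suc h * c / 16 * real n) (real n powr (real h + \<eta>))
           (\<lambda>d. real (d choose Suc h) * p ^ (Suc h choose 2)) (Suc h) f (U - {v}) v W} \<le> real n powr - K) sequentially"
proof -
  \<comment> \<open>After removal of \<open>W\<close> and of up to \<open>Suc h\<close> vertices, at
    least \<open>c * n / 8\<close> vertices of \<open>U'\<close> remain, so the expected number of
    common neighbours is at least \<open>2 * \<delta> * n\<close>.\<close>
  define \<delta> where "\<delta> = p ^ Suc h * c / 16"
  define K1 where "K1 = max 1 (K + 1)"
  have \<delta>: "0 < \<delta>" using p c by (simp add: \<delta>_def)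
  have c': "0 < c'" using p by (simp add: c'_def)
  have e1: "eventually (\<lambda>n. c * real n / 2 \<le> c * real n - 1 \<and> real n0 \<le> c * real n / 2 \<and> 1 \<le> c * real n / 2 \<and> 1 \<le> n) sequentially"
    using c by (intro eventually_conj; real_asymp)
  have e2: "eventually (\<lambda>n. real n powr (1 - \<eta>) + real (Suc h) \<le> 3 * c * real n / 8) sequentially"
    using c \<eta> by real_asymp
  have e3: "eventually (\<lambda>n. 2 * exp (- 2 * real n powr (2 * \<eta>)) \<le> real n powr - K / 4) sequentially"
    using \<eta> by real_asymp
  have e4: "eventually (\<lambda>n. 2 * exp (- 2 * c'\<^sup>2 * (c * real n / 2)) \<le> real n powr - K / 4) sequentially"
    using c c' by real_asymp
  \<comment> \<open>The exponent \<open>- (K + 1)\<close> can have either sign, and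
    \<open>card U'\<close> is only known to lie between \<open>c * n / 2\<close> and
    \<open>n\<close>; this estimate and the next cover the two cases.\<close>
  have e5: "eventually (\<lambda>n. (c * real n / 2) powr - (K + 1) \<le> real n powr - K / 4) sequentially"
    using c by real_asymp
  have e5': "eventually (\<lambda>n. real n powr - (K + 1) \<le> real n powr - K / 4) sequentially"
    by real_asymp
  have e6: "eventually (\<lambda>n. real (Suc (Suc h)) * real n ^ Suc h * (2 * exp (- 2 * \<delta>\<^sup>2 * real n / real (Suc h))) \<le> real n powr - K / 4) sequentially"
  proof -
    have "eventually (\<lambda>n. real (Suc (Suc h)) * real n powr real (Suc h) * (2 * exp (- 2 * \<delta>\<^sup>2 * real n / real (Suc h))) \<le> real n powr - K / 4) sequentially"
      using \<delta> by real_asymp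
    then show ?thesis using eventually_gt_at_top[of 0]
      by eventually_elim (simp only: powr_realpow of_nat_0_less_iff)
  qed
  show ?thesis
    using e1 e2 e3 e4 e5 e5' e6
  proof eventually_elim
    case (elim n)
    have n: "1 \<le> n" "0 < real n" using elim(1) by auto
    show ?case
    proof (intro allI impI)
      fix V U W :: "'a set" and k v
      assume V: "finite V" "card V = n" and k: "c * real n \<le> real k" and U: "U \<subseteq> V" "card U = k" and v: "v \<in> U"
        and W: "W \<subseteq> U - {v}" "real (card W) \<le> real n powr (1 - \<eta>)"
      define U' where "U' = U - {v}"
      let ?M = "edge_pmf p (all_pairs V)"
      let ?\<mu> = "\<lambda>d. real (d choose Suc h) * p ^ (Suc h choose 2)"
      define q where "q = real (k - 1) powr (\<eta> - real h)"
      define t where "t = \<delta> * real n"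
      define w where "w = real n powr (real h + \<eta>)"
      have fE: "finite (all_pairs V)" using V by simp
      have fU: "finite U" and fU': "finite U'" using U V by (auto simp: U'_def dest: finite_subset)
      have cU': "card U' = k - 1" using v U fU by (simp add: U'_def)
      have vU': "v \<notin> U'" by (simp add: U'_def)
      have sub: "all_pairs U' \<subseteq> all_pairs V" using U by (intro all_pairs_mono) (auto simp: U'_def)
      have star: "star v U' \<subseteq> all_pairs V" using U v by (auto simp: U'_def)
      have k1: "c * real n / 2 \<le> real (card U')" using elim(1) k cU' by linarith
      have U'n: "card U' \<le> n" using card_mono[OF V(1), of U'] U V by (auto simp: U'_def)
      have U'ne: "U' \<noteq> {}" using k1 elim(1) by auto
      have T1: "measure_pmf.prob ?M {f. \<not> \<bar>real (ncl (Suc h) f (nbrs f U' v)) - ?\<mu> (card (nbrs f U' v))\<bar> \<le> w} \<le> real n powr - K / 4"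
      proof -
        have "measure_pmf.prob ?M {f. \<not> \<bar>real (ncl (Suc h) f (nbrs f U' v)) - ?\<mu> (card (nbrs f U' v))\<bar> \<le> w}
          \<le> 2 * exp (- 2 * w\<^sup>2 / ((real n)\<^sup>2 * (real n ^ Suc h / (real n)\<^sup>2)\<^sup>2))"
          using U'n n p by (intro prob_ncl_nbrs_deviation_le[OF fE fU' vU' sub]) (auto simp: w_def)
        \<comment> \<open>The natural scale of the fluctuations is \<open>n ^ h\<close>; the extra
          factor \<open>n powr \<eta>\<close> in \<open>w\<close> makes the tail superpolynomially
          small.\<close>
        also have "(real n)\<^sup>2 * (real n ^ Suc h / (real n)\<^sup>2)\<^sup>2 = (real n ^ h)\<^sup>2"
          using n by (simp add: power2_eq_square field_simps)
        also have "w\<^sup>2 = (real n ^ h)\<^sup>2 * real n powr (2 * \<eta>)"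
          using n by (simp add: w_def powr_add powr_realpow power_mult_distrib powr_power mult.commute)
        also have "- 2 * ((real n ^ h)\<^sup>2 * real n powr (2 * \<eta>)) / (real n ^ h)\<^sup>2 = - 2 * real n powr (2 * \<eta>)"
          using n by simp
        finally show ?thesis using elim(3) by linarith
      qed
      have T2: "measure_pmf.prob ?M {f. \<not> (c' * real (card U') \<le> real (card (nbrs f U' v)) \<and>
          real (card (nbrs f U' v)) \<le> (1 - c') * real (card U'))} \<le> real n powr - K / 4"
      proof -
        have "measure_pmf.prob ?M {f. \<not> (c' * real (card U') \<le> real (card (nbrs f U' v)) \<and>
          real (card (nbrs f U' v)) \<le> (1 - c') * real (card U'))} \<le> 2 * exp (- 2 * c'\<^sup>2 * real (card U'))"
          unfolding c'_def using prob_degree_bad_le[OF fE fU' U'ne vU' star p] .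
        also have "\<dots> \<le> 2 * exp (- 2 * c'\<^sup>2 * (c * real n / 2))"
          using mult_left_mono[OF k1, of "2 * c'\<^sup>2"] by simp
        finally show ?thesis using elim(4) by linarith
      qed
      have T3: "measure_pmf.prob ?M {f. \<not> clique_dispersed c' q (Suc h) f U'} \<le> real n powr - K / 4"
      proof (rule prob_resample_le[OF fE sub])
        fix f :: "'a set \<Rightarrow> bool"
        have "clique_dispersed c' q (Suc h) (override_on f g (all_pairs U')) U' = clique_dispersed c' q (Suc h) g U'" for g
          by (rule clique_dispersed_cong) (simp add: override_on_def)
        then have "measure_pmf.prob (edge_pmf p (all_pairs U')) {g. \<not> clique_dispersed c' q (Suc h) (override_on f g (all_pairs U')) U'}
           = measure_pmf.prob (edge_pmf p (all_pairs U')) {g. \<not> clique_dispersed c' q (Suc h) g U'}" by simp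
        also have "\<dots> \<le> real (card U') powr - (K + 1)"
          using disp[rule_format, OF fU'] k1 elim(1) unfolding q_def cU' by simp
        also have "\<dots> \<le> real n powr - K / 4"
        proof (cases "0 \<le> K + 1")
          case True
          have "real (card U') powr - (K + 1) \<le> (c * real n / 2) powr - (K + 1)"
            using k1 elim(1) True by (intro powr_mono2') auto
          then show ?thesis using elim(5) by linarith
        next
          case False
          have "real (card U') powr - (K + 1) \<le> real n powr - (K + 1)"
            using U'n False by (intro powr_mono2) auto
          then show ?thesis using elim(6) by linarith
        qed
        finally show "measure_pmf.prob (edge_pmf p (all_pairs U')) {g. \<not> clique_dispersed c' q (Suc h) (override_on f g (all_pairs U')) U'}
          \<le> real n powr - K / 4" .
      qed simp
      have T4: "measure_pmf.prob ?M {f. \<not> many_common_nbrs t (Suc h) f U' W} \<le> real n powr - K / 4"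
      proof -
        have WU': "W \<subseteq> U'" using W by (simp add: U'_def)
        have "real (card (U' - W)) = real (card U') - real (card W)"
          using WU' fU' card_mono[OF fU' WU'] by (simp add: card_Diff_subset finite_subset of_nat_diff)
        then have "c * real n / 8 \<le> real (card (U' - W)) - real (Suc h)"
          using k1 W(2) elim(2) by linarith
        then have "c * real n / 8 * p ^ Suc h \<le> (real (card (U' - W)) - real (Suc h)) * p ^ Suc h"
          using p by (intro mult_right_mono) auto
        then have t: "2 * t \<le> (real (card (U' - W)) - real (Suc h)) * p ^ Suc h"
          by (simp add: t_def \<delta>_def mult_ac)
        have "measure_pmf.prob ?M {f. \<not> many_common_nbrs t (Suc h) f U' W}
          \<le> real (Suc (Suc h) * n ^ Suc h) * (2 * exp (- 2 * t\<^sup>2 / (real (Suc h) * real n)))"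
          using \<delta> n by (intro prob_few_common_nbrs_le[OF fE fU' sub WU' p U'n _ _ _ t]) (auto simp: t_def)
        also have "- 2 * t\<^sup>2 / (real (Suc h) * real n) = - 2 * \<delta>\<^sup>2 * real n / real (Suc h)"
          using n by (simp add: t_def power2_eq_square)
        also have "real (Suc (Suc h) * n ^ Suc h) = real (Suc (Suc h)) * real n ^ Suc h"
          by (simp only: of_nat_mult of_nat_power)
        finally show ?thesis using elim(7) by linarith
      qed
      have "measure_pmf.prob ?M {f. \<not> typical c' q t w ?\<mu> (Suc h) f U' v W}
        \<le> measure_pmf.prob ?M (({f. \<not> \<bar>real (ncl (Suc h) f (nbrs f U' v)) - ?\<mu> (card (nbrs f U' v))\<bar> \<le> w} \<union>
           {f. \<not> (c' * real (card U') \<le> real (card (nbrs f U' v)) \<and> real (card (nbrs f U' v)) \<le> (1 - c') * real (card U'))}) \<union>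
           ({f. \<not> clique_dispersed c' q (Suc h) f U'} \<union> {f. \<not> many_common_nbrs t (Suc h) f U' W}))"
        by (intro measure_pmf.finite_measure_mono) (auto simp: typical_def)
      also have "\<dots> \<le> (real n powr - K / 4 + real n powr - K / 4) + (real n powr - K / 4 + real n powr - K / 4)"
        by (intro order_trans[OF measure_Un_le] add_mono T1 T2 T3 T4) auto
      finally show "measure_pmf.prob ?M
        {f. \<not> typical c' (real (k - 1) powr (\<eta> - real h)) (p ^ Suc h * c / 16 * real n) (real n powr (real h + \<eta>))
           ?\<mu> (Suc h) f (U - {v}) v W} \<le> real n powr - K"
        by (simp add: U'_def q_def t_def w_def \<delta>_def)
    qed
  qed
qed

text \<open>The gain \<open>q\<close> from a neighbourhood times the small ball bound for the pairs inside a set of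
  \<open>n powr (1 - \<eta>)\<close> vertices.\<close>

lemma eventually_gain_le:
  fixes c p \<eta> :: real and h :: nat
  assumes p: "0 < p" "p < 1" and c: "0 < c" and \<eta>: "0 < \<eta>" "\<eta> < 1"
  defines "\<delta> \<equiv> p ^ Suc h * c / 16"
  shows "eventually (\<lambda>n. \<forall>x s L. c * real n / 2 \<le> x \<longrightarrow> x \<le> real n \<longrightarrow> real n powr (1 - \<eta>) \<le> real s + 1 \<longrightarrow>
      real L \<le> 2 * real n powr (real h + \<eta>) / ((\<delta> * real n) ^ h / fact h) + 1 \<longrightarrow>
      x powr (\<eta> - real h) * (real L * (4 / sqrt (p * (1 - p)) / sqrt (real (s choose 2))))
      \<le> real n powr (4 * \<eta> - real h - 1)) sequentially"
proof -
  define C1 where "C1 = 2 * fact h / \<delta> ^ h"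
  define C3 where "C3 = 4 / sqrt (p * (1 - p))"
  \<comment> \<open>All constants together. The degree step, the number \<open>L\<close> of
    increments and the size of \<open>W\<close> lose a factor \<open>n powr \<eta>\<close> each, and
    a fourth such factor absorbs \<open>C2\<close>; hence \<open>4 * \<eta>\<close> in the
    claim.\<close>
  define C2 where "C2 = (c / 2) powr - real h * ((C1 + 1) * (C3 * 4))"
  have \<delta>: "0 < \<delta>" using p c by (simp add: \<delta>_def)
  have C1: "0 \<le> C1" using \<delta> by (simp add: C1_def)
  have C3: "0 < C3" using p by (simp add: C3_def)
  have e1: "eventually (\<lambda>n. 4 \<le> real n powr (1 - \<eta>)) sequentially" using \<eta> by real_asymp
  have e2: "eventually (\<lambda>n. C2 \<le> real n powr \<eta>) sequentially" using \<eta> by real_asymp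
  show ?thesis
    using e1 e2 eventually_gt_at_top[of 0]
  proof eventually_elim
    case (elim n)
    have n: "1 \<le> real n" "0 < real n" using elim(3) by auto
    show ?case
    proof (intro allI impI)
      fix x :: real and s L :: nat
      assume x: "c * real n / 2 \<le> x" "x \<le> real n" and s: "real n powr (1 - \<eta>) \<le> real s + 1"
        and L: "real L \<le> 2 * real n powr (real h + \<eta>) / ((\<delta> * real n) ^ h / fact h) + 1"
      have x0: "0 < c * real n / 2" using c n by simp
      \<comment> \<open>The sign of \<open>\<eta> - h\<close> depends on whether
        \<open>h = 0\<close>, so the two parts of the exponent are bounded separately, one by
        \<open>x \<le> n\<close> and the other by \<open>x \<ge> c * n / 2\<close>.\<close>
      have q: "x powr (\<eta> - real h) \<le> real n powr \<eta> * ((c / 2) powr - real h * real n powr - real h)"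
      proof -
        have "x powr (\<eta> - real h) = x powr \<eta> * x powr - real h" by (simp add: powr_add[symmetric])
        also have "\<dots> \<le> real n powr \<eta> * (c * real n / 2) powr - real h"
          using x x0 \<eta> by (intro mult_mono powr_mono2 powr_mono2') auto
        also have "(c * real n / 2) powr - real h = (c / 2) powr - real h * real n powr - real h"
          using c n by (simp add: powr_mult[symmetric])
        finally show ?thesis .
      qed
      have L': "real L \<le> (C1 + 1) * real n powr \<eta>"
      proof -
        have "2 * real n powr (real h + \<eta>) / ((\<delta> * real n) ^ h / fact h) = C1 * real n powr \<eta>"
          using n \<delta> by (simp add: C1_def powr_add powr_realpow power_mult_distrib field_simps)
        moreover have "1 \<le> real n powr \<eta>" using n \<eta> by (simp add: ge_one_powr_ge_zero)
        ultimately show ?thesis using L by (simp add: distrib_right)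
      qed
      have s2: "real n powr (1 - \<eta>) / 4 \<le> sqrt (real (s choose 2))"
      proof -
        have s3: "3 \<le> real s" using s elim(1) by linarith
        have "even (s * (s - 1))" by auto
        then have "real (s choose 2) = real s * (real s - 1) / 2"
          using s3 by (simp add: choose_two real_of_nat_div of_nat_diff)
        moreover have "(real s / 2)\<^sup>2 \<le> real s * (real s - 1) / 2"
        proof -
          have "real s * (real s / 2) \<le> real s * (real s - 1)" using s3 by (intro mult_left_mono) auto
          then show ?thesis by (simp add: power2_eq_square)
        qed
        ultimately have "real s / 2 \<le> sqrt (real (s choose 2))" by (intro real_le_rsqrt) simp
        then show ?thesis using s s3 by linarith
      qed
      have N: "0 < real n powr (1 - \<eta>)" using n by simp
      have S: "0 < sqrt (real (s choose 2))" using s2 N by linarith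
      have K: "C3 / sqrt (real (s choose 2)) \<le> C3 * 4 * real n powr (\<eta> - 1)"
      proof -
        have "C3 / sqrt (real (s choose 2)) \<le> C3 / (real n powr (1 - \<eta>) / 4)"
          using s2 C3 mult_pos_pos[OF S, of "real n powr (1 - \<eta>) / 4"] N by (intro divide_left_mono) auto
        also have "\<dots> = C3 * 4 * real n powr - (1 - \<eta>)" by (subst powr_minus) (simp add: field_simps)
        finally show ?thesis by simp
      qed
      have "x powr (\<eta> - real h) * (real L * (C3 / sqrt (real (s choose 2))))
          \<le> (real n powr \<eta> * ((c / 2) powr - real h * real n powr - real h)) *
            (((C1 + 1) * real n powr \<eta>) * (C3 * 4 * real n powr (\<eta> - 1)))"
        using C1 C3 by (intro mult_mono q L' K) auto
      also have "\<dots> = C2 * (real n powr \<eta> * real n powr - real h * real n powr \<eta> * real n powr (\<eta> - 1))"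
        by (simp add: C2_def mult_ac)
      also have "\<dots> = C2 * real n powr (3 * \<eta> - real h - 1)"
        by (simp add: powr_add[symmetric] algebra_simps)
      also have "\<dots> \<le> real n powr \<eta> * real n powr (3 * \<eta> - real h - 1)"
        using elim(2) by (intro mult_right_mono) auto
      also have "\<dots> = real n powr (4 * \<eta> - real h - 1)" by (simp add: powr_add[symmetric] algebra_simps)
      finally show "x powr (\<eta> - real h) * (real L * (4 / sqrt (p * (1 - p)) / sqrt (real (s choose 2))))
        \<le> real n powr (4 * \<eta> - real h - 1)" by (simp only: C3_def)
    qed
  qed
qed

text \<open>Each sampled set gains \<open>Q = n powr (4 * \<eta> - h - 1)\<close> against the
  threshold \<open>\<alpha> = n powr (\<epsilon> - h - 1)\<close>. With
  \<open>8 * \<eta> \<le> \<epsilon>\<close>, the ratio of the \<open>m\<close>-th powers is at most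
  \<open>n powr (- 4 * \<eta> * m)\<close>.\<close>

lemma eventually_prob_many_subsets_le:
  fixes c p \<epsilon> K :: real and h :: nat
  assumes p: "0 < p" "p < 1" and c: "0 < c" "c < 1/2" and \<epsilon>: "0 < \<epsilon>"
    and disp: "\<And>c \<epsilon> K. 0 < c \<Longrightarrow> c < 1/2 \<Longrightarrow> 0 < \<epsilon> \<Longrightarrow> \<exists>n0. \<forall>V :: 'a set. finite V \<longrightarrow> n0 \<le> card V \<longrightarrow>
      measure_pmf.prob (edge_pmf p (all_pairs V))
        {f. \<not> clique_dispersed c (real (card V) powr (\<epsilon> + 1 - real (Suc h))) (Suc h) f V} \<le> real (card V) powr - K"
  shows "eventually (\<lambda>n. \<forall>(V :: 'a set) k l. finite V \<longrightarrow> card V = n \<longrightarrow>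
      c * real n \<le> real k \<longrightarrow> real k \<le> (1 - c) * real n \<longrightarrow>
      measure_pmf.prob (edge_pmf p (all_pairs V))
        {f. real n powr (\<epsilon> - real h - 1) \<le> measure_pmf.prob (subset_pmf V k) {U. ncl (h + 2) f U = l}}
      \<le> real n powr - K) sequentially"
proof -
  define \<eta> where "\<eta> = min \<epsilon> 1 / 8"
  have \<eta>: "0 < \<eta>" "\<eta> < 1" "8 * \<eta> \<le> \<epsilon>" using \<epsilon> by (auto simp: \<eta>_def)
  \<comment> \<open>Large enough for the gain of \<open>m\<close> sets to reach
    \<open>K + 1\<close>; the additional 1 pays for the factor \<open>m + 2\<close> from adding the
    error terms.\<close>
  define m where "m = nat \<lceil>\<bar>K + 1\<bar> / (4 * \<eta>)\<rceil> + 1"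
  have m: "1 \<le> m" "K + 1 \<le> 4 * \<eta> * real m"
  proof -
    have "\<bar>K + 1\<bar> / (4 * \<eta>) \<le> real m" unfolding m_def by linarith
    then have "\<bar>K + 1\<bar> \<le> 4 * \<eta> * real m" using \<eta> by (simp add: pos_divide_le_eq mult.commute)
    then show "K + 1 \<le> 4 * \<eta> * real m" by linarith
  qed (simp add: m_def)
  \<comment> \<open>The error terms are divided by \<open>\<alpha> ^ m\<close>, which can be nearly
    as small as \<open>n powr (- (h + 1) * m)\<close>.\<close>
  define K2 where "K2 = K + 1 + (real h + 1) * real m"
  define c' where "c' = min p (1 - p) / 2"
  define \<delta> where "\<delta> = p ^ Suc h * c / 16"
  \<comment> \<open>For blocks of size \<open>b = n powr \<theta>\<close>, the factor
    \<open>b ^ m\<close> is at most \<open>n powr (\<eta> / 2)\<close>, less than what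
    \<open>W\<close> of size \<open>n powr (1 - \<eta>)\<close> leaves free, while
    \<open>(1 - c) ^ b\<close> is still superpolynomially small.\<close>
  define \<theta> where "\<theta> = \<eta> / (2 * real m)"
  have \<delta>: "0 < \<delta>" using p c by (simp add: \<delta>_def)
  have c': "0 < c'" "c' < 1/2" using p by (auto simp: c'_def)
  have \<theta>: "0 < \<theta>" "\<theta> * real m = \<eta> / 2" using \<eta> m by (auto simp: \<theta>_def)
  have "\<exists>n0. \<forall>V :: 'a set. finite V \<longrightarrow> n0 \<le> card V \<longrightarrow>
      measure_pmf.prob (edge_pmf p (all_pairs V))
        {f. \<not> clique_dispersed c' (real (card V) powr (\<eta> - real h)) (Suc h) f V} \<le> real (card V) powr - (K2 + 1)"
    using disp[OF c' \<eta>(1), of "K2 + 1"] by simp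
  then obtain n0 where n0: "\<forall>V :: 'a set. finite V \<longrightarrow> n0 \<le> card V \<longrightarrow>
      measure_pmf.prob (edge_pmf p (all_pairs V))
        {f. \<not> clique_dispersed c' (real (card V) powr (\<eta> - real h)) (Suc h) f V} \<le> real (card V) powr - (K2 + 1)"
    by blast
  note typ_ev = eventually_atypical_le[OF p c(1) \<eta>(1,2), of n0 h K2, folded c'_def, OF n0]
  note gain_ev = eventually_gain_le[OF p c(1) \<eta>(1,2), of h, folded \<delta>_def]
  have e1: "eventually (\<lambda>n. c * real n / 2 \<le> c * real n - 1 \<and> 4 \<le> real n powr (1 - \<eta>) \<and> 1 \<le> real n powr \<theta>) sequentially"
    using c \<eta> \<theta> by (intro eventually_conj; real_asymp)
  have e2: "eventually (\<lambda>n. (real n powr (1 - \<eta>) + 1) * real n powr (\<eta> / 2) \<le> real n) sequentially"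
    using \<eta> by real_asymp
  have e3: "eventually (\<lambda>n. real m * (real m * (real n * exp (- c * (real n powr \<theta> - 1)))) \<le> real n powr - K2) sequentially"
    using c \<theta> m by real_asymp
  have e4: "eventually (\<lambda>n. real m + 2 \<le> real n) sequentially" by real_asymp
  show ?thesis
    using typ_ev gain_ev e1 e2 e3 e4
  proof eventually_elim
    case (elim n)
    note typ_n = elim(1) and gain_n = elim(2)
    have n: "1 \<le> real n" "0 < real n" using elim(6) by auto
    show ?case
    proof (intro allI impI)
      fix V :: "'a set" and k l
      assume V: "finite V" "card V = n" and k: "c * real n \<le> real k" "real k \<le> (1 - c) * real n"
      define s where "s = nat \<lfloor>real n powr (1 - \<eta>)\<rfloor>"
      define b where "b = nat \<lfloor>real n powr \<theta>\<rfloor>"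
      define w where "w = real n powr (real h + \<eta>)"
      define t where "t = \<delta> * real n"
      \<comment> \<open>The added 1 makes the window strictly shorter than \<open>L\<close>
        increments, as the LYM bound requires.\<close>
      define L where "L = nat \<lfloor>2 * w / (t ^ h / fact h)\<rfloor> + 1"
      define q where "q = real (k - 1) powr (\<eta> - real h)"
      define Q where "Q = real n powr (4 * \<eta> - real h - 1)"
      define \<alpha> where "\<alpha> = real n powr (\<epsilon> - real h - 1)"
      let ?\<mu> = "\<lambda>d. real (d choose Suc h) * p ^ (Suc h choose 2)"
      have s: "real s \<le> real n powr (1 - \<eta>)" "real n powr (1 - \<eta>) \<le> real s + 1" "2 \<le> s"
        using elim(3) unfolding s_def by linarith+
      have b: "real b \<le> real n powr \<theta>" "real n powr \<theta> - 1 \<le> real b" "1 \<le> b"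
        using elim(3) unfolding b_def by linarith+
      have t: "0 < t" using \<delta> n by (simp add: t_def)
      have \<Delta>: "0 < t ^ h / fact h" using t by simp
      have w: "0 \<le> w" by (simp add: w_def)
      have L: "2 * w < real L * (t ^ h / fact h)" "real L \<le> 2 * w / (t ^ h / fact h) + 1"
      proof -
        have "0 \<le> 2 * w / (t ^ h / fact h)" using w \<Delta> by (intro divide_nonneg_pos) auto
        then show "real L \<le> 2 * w / (t ^ h / fact h) + 1" unfolding L_def by linarith
        have "2 * w / (t ^ h / fact h) < real L" unfolding L_def by linarith
        then show "2 * w < real L * (t ^ h / fact h)" using \<Delta> by (simp only: pos_divide_less_eq)
      qed
      have kn: "k \<le> n"
      proof -
        have "(1 - c) * real n \<le> 1 * real n" using c n by (intro mult_right_mono) auto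
        then show ?thesis using k(2) by simp
      qed
      have k1: "c * real n / 2 \<le> real (k - 1)" "real (k - 1) \<le> real n"
        using k(1) elim(3) kn by linarith+
      have Q: "q * (real L * (4 / sqrt (p * (1 - p)) / sqrt (real (s choose 2)))) \<le> Q"
        unfolding q_def Q_def using gain_n k1 s(2) L(2) unfolding w_def t_def by blast
      have sb: "Suc s * b ^ m \<le> card V"
      proof -
        have "real b ^ m \<le> (real n powr \<theta>) ^ m" using b by (intro power_mono) auto
        also have "\<dots> = real n powr (\<theta> * real m)" using n by (simp add: powr_power mult.commute)
        also note \<theta>(2)
        finally have "real (Suc s) * real b ^ m \<le> (real n powr (1 - \<eta>) + 1) * real n powr (\<eta> / 2)"
          using s(1) by (intro mult_mono) auto
        then have "real (Suc s * b ^ m) \<le> real n"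
          using elim(4) unfolding of_nat_mult of_nat_power by (rule order_trans)
        then show ?thesis unfolding V(2) by (simp only: of_nat_le_iff)
      qed
      have \<alpha>: "0 < \<alpha>" using n by (simp add: \<alpha>_def)
      have "measure_pmf.prob (edge_pmf p (all_pairs V)) {f. \<alpha> \<le> measure_pmf.prob (subset_pmf V k) {U. ncl (h + 2) f U = l}}
        \<le> (Q ^ m + real m * real n powr - K2 + real m * (real m * (real (card V) * (1 - c) ^ b))) / \<alpha> ^ m"
      proof (rule prob_many_subsets_le[where q = q and L = L and s = s and t = t and w = w and c' = c' and \<mu> = ?\<mu>])
        fix U v W assume "U \<subseteq> V" "card U = k" "v \<in> U" "W \<subseteq> U - {v}" "card W = s"
        then show "measure_pmf.prob (edge_pmf p (all_pairs V)) {f. \<not> typical c' q t w ?\<mu> (Suc h) f (U - {v}) v W} \<le> real n powr - K2"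
          unfolding q_def t_def w_def \<delta>_def using typ_n V k(1) s(1) by blast
      qed (use V k kn c p s b t \<alpha> L(1) Q sb in \<open>auto simp: q_def\<close>)
      also have "\<dots> \<le> (real m + 2) * real n powr - (K + 1)"
      proof -
        have "(1 - c) ^ b \<le> exp (- c) ^ b" using c exp_ge_add_one_self[of "- c"] by (intro power_mono) auto
        also have "\<dots> = exp (- c * real b)" by (simp add: exp_of_nat_mult[symmetric] mult.commute)
        also have "\<dots> \<le> exp (- c * (real n powr \<theta> - 1))" using b(2) c by (simp add: mult_left_mono)
        finally have "real m * (real m * (real n * (1 - c) ^ b)) \<le> real m * (real m * (real n * exp (- c * (real n powr \<theta> - 1))))"
          by (intro mult_left_mono) auto
        then have 1: "real m * (real m * (real (card V) * (1 - c) ^ b)) \<le> real n powr - K2"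
          using elim(5) V by simp
        have \<alpha>m: "\<alpha> ^ m = real n powr ((\<epsilon> - real h - 1) * real m)" using n by (simp add: \<alpha>_def powr_power mult.commute)
        have Qm: "Q ^ m = real n powr ((4 * \<eta> - real h - 1) * real m)" using n by (simp add: Q_def powr_power mult.commute)
        have "(Q ^ m + real m * real n powr - K2 + real m * (real m * (real (card V) * (1 - c) ^ b))) / \<alpha> ^ m
           \<le> (Q ^ m + (real m + 1) * real n powr - K2) / \<alpha> ^ m"
          using 1 \<alpha> by (intro divide_right_mono) (auto simp: distrib_right)
        also have "\<dots> = Q ^ m / \<alpha> ^ m + (real m + 1) * (real n powr - K2 / \<alpha> ^ m)"
          by (simp add: add_divide_distrib)
        also have "\<dots> \<le> real n powr - (K + 1) + (real m + 1) * real n powr - (K + 1)"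
        proof (intro add_mono mult_left_mono)
          have "Q ^ m / \<alpha> ^ m = real n powr ((4 * \<eta> - real h - 1) * real m - (\<epsilon> - real h - 1) * real m)"
            unfolding \<alpha>m Qm by (simp only: powr_diff)
          also have "(4 * \<eta> - real h - 1) * real m - (\<epsilon> - real h - 1) * real m = (4 * \<eta> - \<epsilon>) * real m"
            by (simp add: algebra_simps)
          also have "real n powr \<dots> \<le> real n powr - (K + 1)"
          proof (rule powr_mono[OF _ n(1)])
            have "(4 * \<eta> - \<epsilon>) * real m \<le> - (4 * \<eta>) * real m" using \<eta> by (intro mult_right_mono) auto
            then show "(4 * \<eta> - \<epsilon>) * real m \<le> - (K + 1)" using m(2) by simp
          qed
          finally show "Q ^ m / \<alpha> ^ m \<le> real n powr - (K + 1)" .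
          have "real n powr - K2 / \<alpha> ^ m = real n powr (- K2 - (\<epsilon> - real h - 1) * real m)"
            unfolding \<alpha>m by (simp only: powr_diff)
          also have "- K2 - (\<epsilon> - real h - 1) * real m = - (K + 1) - \<epsilon> * real m"
            by (simp add: K2_def algebra_simps)
          also have "real n powr \<dots> \<le> real n powr - (K + 1)"
            using \<epsilon> n by (intro powr_mono) auto
          finally show "real n powr - K2 / \<alpha> ^ m \<le> real n powr - (K + 1)" .
        qed simp
        also have "\<dots> = (real m + 2) * real n powr - (K + 1)" by (simp add: algebra_simps)
        finally show ?thesis .
      qed
      also have "\<dots> \<le> real n * real n powr - (K + 1)" using elim(6) by (intro mult_right_mono) auto
      also have "\<dots> = real n powr - K"
        using n powr_add[of "real n" 1 "- (K + 1)"] by simp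
      finally show "measure_pmf.prob (edge_pmf p (all_pairs V))
          {f. real n powr (\<epsilon> - real h - 1) \<le> measure_pmf.prob (subset_pmf V k) {U. ncl (h + 2) f U = l}}
        \<le> real n powr - K" by (simp only: \<alpha>_def)
    qed
  qed
qed

text \<open>As \<open>q \<ge> 0\<close>, a violated bound exhibits a set with exactly
  \<open>l\<close> cliques, so \<open>l\<close> is at most \<open>n ^ h\<close>. This leaves
  polynomially many pairs \<open>(k, l)\<close> for the union bound.\<close>

lemma not_clique_dispersedE:
  assumes V: "finite V" and q: "0 \<le> q" and f: "\<not> clique_dispersed c q h f V" and c: "0 \<le> c"
  obtains k l where "k \<le> card V" "l \<le> card V ^ h" "c * real (card V) \<le> real k" "real k \<le> (1 - c) * real (card V)"
    "q \<le> measure_pmf.prob (subset_pmf V k) {U. ncl h f U = l}"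
proof -
  let ?n = "card V"
  from f obtain k l where k: "c * real ?n \<le> real k" "real k \<le> (1 - c) * real ?n"
    and less: "real (?n choose k) * q < real (card {U. U \<subseteq> V \<and> card U = k \<and> ncl h f U = l})"
    unfolding clique_dispersed_def by (auto simp: not_le)
  have "(1 - c) * real ?n \<le> 1 * real ?n" using c by (intro mult_right_mono) auto
  then have kn: "k \<le> ?n" using k(2) by simp
  have "0 \<le> real (?n choose k) * q" using q by simp
  with less have "{U. U \<subseteq> V \<and> card U = k \<and> ncl h f U = l} \<noteq> {}" by force
  then obtain U where U: "U \<subseteq> V" "ncl h f U = l" by blast
  have "l \<le> card U choose h" using ncl_le[of U h f] U V by (auto dest: finite_subset)
  also have "\<dots> \<le> card U ^ h"
    using binomial_le_pow[of h "card U"] by (cases "h \<le> card U") (auto simp: not_le binomial_eq_0)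
  also have "\<dots> \<le> ?n ^ h" using U V by (intro power_mono card_mono) auto
  finally have l: "l \<le> ?n ^ h" .
  have "measure_pmf.prob (subset_pmf V k) {U. ncl h f U = l} =
      real (card ({U. U \<subseteq> V \<and> card U = k} \<inter> {U. ncl h f U = l})) / real (card {U. U \<subseteq> V \<and> card U = k})"
    using V kn by (intro measure_pmf_of_set subsets_card_nonempty) auto
  also have "{U. U \<subseteq> V \<and> card U = k} \<inter> {U. ncl h f U = l} = {U. U \<subseteq> V \<and> card U = k \<and> ncl h f U = l}" by auto
  also have "card {U. U \<subseteq> V \<and> card U = k} = ?n choose k" using V by (rule n_subsets)
  finally have "q \<le> measure_pmf.prob (subset_pmf V k) {U. ncl h f U = l}"
    using less kn by (simp add: pos_le_divide_eq mult.commute)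
  with kn l k that show ?thesis by blast
qed

text \<open>For single vertices the permitted proportion \<open>n powr \<epsilon>\<close> is at
  least 1, so the induction starts trivially. In the step, the moment bound for fixed
  \<open>k\<close> and \<open>l\<close> is summed over all relevant pairs.\<close>

theorem clique_dispersed_whp:
  fixes c p \<epsilon> K :: real
  assumes p: "0 < p" "p < 1" and "0 < c" "c < 1/2" "0 < \<epsilon>"
  shows "\<exists>n0. \<forall>V :: 'a set. finite V \<longrightarrow> n0 \<le> card V \<longrightarrow>
      measure_pmf.prob (edge_pmf p (all_pairs V))
        {f. \<not> clique_dispersed c (real (card V) powr (\<epsilon> + 1 - real (Suc h))) (Suc h) f V} \<le> real (card V) powr - K"
  using assms(3-5)
proof (induction h arbitrary: c \<epsilon> K)
  case 0
  have "measure_pmf.prob (edge_pmf p (all_pairs V))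
      {f. \<not> clique_dispersed c (real (card V) powr (\<epsilon> + 1 - real (Suc 0))) (Suc 0) f V} \<le> real (card V) powr - K"
    if V: "finite V" "1 \<le> card V" for V :: "'a set"
  proof -
    have "1 \<le> real (card V) powr (\<epsilon> + 1 - real (Suc 0))" using V(2) 0(3) by (intro ge_one_powr_ge_zero) auto
    then have "{f. \<not> clique_dispersed c (real (card V) powr (\<epsilon> + 1 - real (Suc 0))) (Suc 0) f V} = {}"
      using clique_dispersed_ge_1[OF V(1)] by blast
    then show ?thesis by (simp only: measure_empty powr_ge_zero)
  qed
  then show ?case by blast
next
  case (Suc h)
  \<comment> \<open>The union bound runs over at most \<open>n powr (h + 4)\<close> pairs
    \<open>(k, l)\<close>.\<close>
  let ?K = "K + real h + 5"
  have "eventually (\<lambda>n. \<forall>(V :: 'a set) k l. finite V \<longrightarrow> card V = n \<longrightarrow>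
      c * real n \<le> real k \<longrightarrow> real k \<le> (1 - c) * real n \<longrightarrow>
      measure_pmf.prob (edge_pmf p (all_pairs V))
        {f. real n powr (\<epsilon> - real h - 1) \<le> measure_pmf.prob (subset_pmf V k) {U. ncl (h + 2) f U = l}}
      \<le> real n powr - ?K) sequentially"
    by (rule eventually_prob_many_subsets_le[OF p Suc.prems]) (rule Suc.IH)
  moreover have "eventually (\<lambda>n :: nat. 4 \<le> n) sequentially" by (rule eventually_ge_at_top)
  ultimately have "eventually (\<lambda>n. \<forall>V :: 'a set. finite V \<longrightarrow> card V = n \<longrightarrow>
      measure_pmf.prob (edge_pmf p (all_pairs V))
        {f. \<not> clique_dispersed c (real n powr (\<epsilon> + 1 - real (Suc (Suc h)))) (Suc (Suc h)) f V} \<le> real n powr - K) sequentially"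
  proof eventually_elim
    case (elim n)
    have n: "1 \<le> n" "4 \<le> real n" using elim(2) by auto
    show ?case
    proof (intro allI impI)
      fix V :: "'a set" assume V: "finite V" "card V = n"
      let ?M = "edge_pmf p (all_pairs V)" and ?q = "real n powr (\<epsilon> - real h - 1)"
      let ?A = "\<lambda>(k, l). {f. ?q \<le> measure_pmf.prob (subset_pmf V k) {U. ncl (h + 2) f U = l}}"
      let ?I = "{k. k \<le> n \<and> c * real n \<le> real k \<and> real k \<le> (1 - c) * real n} \<times> {..n ^ (h + 2)}"
      have fin: "finite ?I" by (rule finite_subset[of _ "{..n} \<times> {..n ^ (h + 2)}"]) auto
      have "card ?I \<le> card ({..n} \<times> {..n ^ (h + 2)})" by (intro card_mono) auto
      also have "\<dots> = (n + 1) * (n ^ (h + 2) + 1)" by (simp add: card_cartesian_product)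
      also have "\<dots> \<le> (2 * n) * (2 * n ^ (h + 2))" using n by (intro mult_mono) (auto simp: Suc_le_eq)
      finally have "real (card ?I) \<le> real ((2 * n) * (2 * n ^ (h + 2)))" by (simp only: of_nat_le_iff)
      also have "\<dots> = 4 * (real n * real n ^ (h + 2))" by (simp only: of_nat_mult of_nat_power of_nat_numeral)
      also have "\<dots> \<le> real n * (real n * real n ^ (h + 2))" using n by (intro mult_right_mono) auto
      also have "\<dots> = real n ^ (h + 4)" by (simp add: power_add power4_eq_xxxx power2_eq_square)
      also have "\<dots> = real n powr real (h + 4)" using n by (subst powr_realpow) auto
      also have "real (h + 4) = real h + 4" by simp
      finally have I: "real (card ?I) \<le> real n powr (real h + 4)" .
      have "{f. \<not> clique_dispersed c (real n powr (\<epsilon> + 1 - real (Suc (Suc h)))) (Suc (Suc h)) f V} \<subseteq> (\<Union>x\<in>?I. ?A x)"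
      proof
        fix f assume "f \<in> {f. \<not> clique_dispersed c (real n powr (\<epsilon> + 1 - real (Suc (Suc h)))) (Suc (Suc h)) f V}"
        then have "\<not> clique_dispersed c ?q (h + 2) f V" by (simp add: algebra_simps)
        from not_clique_dispersedE[OF V(1) _ this] Suc.prems obtain k l
          where "k \<le> n" "l \<le> n ^ (h + 2)" "c * real n \<le> real k" "real k \<le> (1 - c) * real n"
            "?q \<le> measure_pmf.prob (subset_pmf V k) {U. ncl (h + 2) f U = l}"
          unfolding V(2) by auto
        then have "(k, l) \<in> ?I \<and> f \<in> ?A (k, l)" by simp
        then show "f \<in> (\<Union>x\<in>?I. ?A x)" by blast
      qed
      then have "measure_pmf.prob ?M {f. \<not> clique_dispersed c (real n powr (\<epsilon> + 1 - real (Suc (Suc h)))) (Suc (Suc h)) f V}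
          \<le> measure_pmf.prob ?M (\<Union>x\<in>?I. ?A x)"
        by (rule measure_pmf.finite_measure_mono) simp
      also have "\<dots> \<le> (\<Sum>x\<in>?I. measure_pmf.prob ?M (?A x))"
        by (rule measure_UNION_le[OF fin]) simp
      also have "\<dots> \<le> (\<Sum>x\<in>?I. real n powr - ?K)"
      proof (intro sum_mono)
        fix x assume "x \<in> ?I"
        then obtain k l where x: "x = (k, l)" "c * real n \<le> real k" "real k \<le> (1 - c) * real n" by blast
        show "measure_pmf.prob ?M (?A x) \<le> real n powr - ?K"
          unfolding x(1) prod.case by (rule elim(1)[rule_format, OF V x(2,3)])
      qed
      also have "\<dots> = real (card ?I) * real n powr - ?K" by simp
      also have "\<dots> \<le> real n powr (real h + 4) * real n powr - ?K" using I by (intro mult_right_mono) auto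
      also have "\<dots> = real n powr (- K - 1)"
        by (subst powr_add[symmetric], rule arg_cong[of _ _ "(powr) (real n)"]) simp
      also have "\<dots> \<le> real n powr - K" using n by (intro powr_mono) auto
      finally show "measure_pmf.prob ?M
        {f. \<not> clique_dispersed c (real n powr (\<epsilon> + 1 - real (Suc (Suc h)))) (Suc (Suc h)) f V} \<le> real n powr - K" .
    qed
  qed
  then obtain N where N: "\<forall>n\<ge>N. \<forall>V :: 'a set. finite V \<longrightarrow> card V = n \<longrightarrow>
      measure_pmf.prob (edge_pmf p (all_pairs V))
        {f. \<not> clique_dispersed c (real n powr (\<epsilon> + 1 - real (Suc (Suc h)))) (Suc (Suc h)) f V} \<le> real n powr - K"
    unfolding eventually_sequentially by (elim exE)
  show ?case
    by (intro exI[of _ N] allI impI) (rule N[rule_format, OF _ _ refl])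
qed

section \<open>Transfer to the random graph and choice of the two functions\<close>

lemma ball_all_pairs: "(\<forall>e\<in>all_pairs T. P e) \<longleftrightarrow> (\<forall>x\<in>T. \<forall>y\<in>T. x \<noteq> y \<longrightarrow> P {x, y})"
proof (intro iffI ballI impI)
  fix x y assume "\<forall>e\<in>all_pairs T. P e" "x \<in> T" "y \<in> T" "x \<noteq> y"
  then show "P {x, y}" using bspec[of "all_pairs T" P "{x, y}"] by simp
next
  fix e assume P: "\<forall>x\<in>T. \<forall>y\<in>T. x \<noteq> y \<longrightarrow> P {x, y}" and "e \<in> all_pairs T"
  then obtain x y where "e = {x, y}" "x \<noteq> y" "x \<in> T" "y \<in> T" unfolding all_pairs_iff by blast
  then show "P e" using P by blast
qed

lemma dispersed_iff_clique_dispersed: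
  assumes "finite V"
  shows "dispersed c q h (V, {e \<in> all_pairs V. f e}) \<longleftrightarrow> clique_dispersed c q h f V"
proof -
  have "clique_copies h (induced (V, {e \<in> all_pairs V. f e}) U) = cliques h f U" if U: "U \<subseteq> V" for U
  proof (intro set_eqI)
    fix T
    show "T \<in> clique_copies h (induced (V, {e \<in> all_pairs V. f e}) U) \<longleftrightarrow> T \<in> cliques h f U"
    proof (cases "T \<subseteq> U")
      case True
      have "finite T" using True U assms by (meson finite_subset)
      moreover have "{x, y} \<in> {e \<in> {e \<in> all_pairs V. f e}. e \<subseteq> U} \<longleftrightarrow> f {x, y}"
        if "x \<in> T" "y \<in> T" "x \<noteq> y" for x y using that True U by auto
      ultimately show ?thesis
        using True by (simp add: clique_copies_def induced_def cliques_def ball_all_pairs)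
    qed (simp add: clique_copies_def induced_def cliques_def)
  qed
  then have "{U. U \<subseteq> V \<and> card U = k \<and> card (clique_copies h (induced (V, {e \<in> all_pairs V. f e}) U)) = l}
      = {U. U \<subseteq> V \<and> card U = k \<and> ncl h f U = l}" for k l by auto
  then show ?thesis unfolding dispersed_def clique_dispersed_def Let_def by simp
qed

lemma prob_random_graph_dispersed:
  "measure_pmf.prob (random_graph n p) {G. dispersed c q h G} =
   1 - measure_pmf.prob (edge_pmf p (all_pairs {1..n})) {f. \<not> clique_dispersed c q h f {1..n}}"
proof -
  have "measure_pmf.prob (random_graph n p) {G. dispersed c q h G} =
      measure_pmf.prob (edge_pmf p (all_pairs {1..n})) {f. clique_dispersed c q h f {1..n}}"
    unfolding random_graph_def
    by (simp add: vimage_def dispersed_iff_clique_dispersed)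
  then show ?thesis
    using measure_pmf.prob_neg[of "edge_pmf p (all_pairs {1..n})" "\<lambda>f. clique_dispersed c q h f {1..n}"] by simp
qed

text \<open>\<open>J n\<close> is the largest index \<open>j \<le> n\<close> whose threshold
  \<open>N j\<close> has been passed. The restriction \<open>j \<le> n\<close> keeps the maximum
  finite, and it exists as soon as \<open>N 0 \<le> n\<close>; the thresholds need not be
  monotone.\<close>

lemma eventually_diagonal:
  assumes "\<And>j. eventually (P j) sequentially"
  obtains J :: "nat \<Rightarrow> nat" and N where "filterlim J at_top sequentially" "\<And>n. N \<le> n \<Longrightarrow> P (J n) n"
proof -
  from assms have "\<forall>j. \<exists>N. \<forall>n\<ge>N. P j n" by (simp add: eventually_sequentially)
  then obtain N where N: "\<And>j n. N j \<le> n \<Longrightarrow> P j n" by metis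
  define S where "S n = {j. j \<le> n \<and> N j \<le> n}" for n
  define J where "J n = Max (S n)" for n
  have fin: "finite (S n)" for n by (rule finite_subset[of _ "{..n}"]) (auto simp: S_def)
  show ?thesis
  proof
    show "filterlim J at_top sequentially"
      unfolding filterlim_at_top eventually_sequentially
    proof (intro allI exI impI)
      fix Z n assume "max Z (N Z) \<le> n"
      then have "Z \<in> S n" by (simp add: S_def)
      then show "Z \<le> J n" unfolding J_def using fin by (rule Max_ge[rotated])
    qed
    fix n assume "N 0 \<le> n"
    then have "0 \<in> S n" by (simp add: S_def)
    then have "J n \<in> S n" unfolding J_def using fin by (intro Max_in) auto
    then show "P (J n) n" using N by (simp add: S_def)
  qed
qed

text \<open>At \<open>n = 0\<close> the inequality would fail by the convention
  \<open>0 powr x = 0\<close>: the empty set is one set of size 0, whereas the permitted number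
  would be 0. Hence the restriction to \<open>n \<ge> 1\<close>.\<close>

theorem theorem5p2:
  fixes c p :: real and h :: nat
  assumes "0 < c" and "c < 1/2" and "0 < p" and "p < 1"
  shows "\<exists>\<alpha> \<phi> :: nat \<Rightarrow> real.
           \<alpha> \<longlonglongrightarrow> 0 \<and> filterlim \<phi> at_top sequentially \<and>
           (\<forall>n\<ge>1. measure_pmf.prob (random_graph n p)
                    {G. dispersed c (real n powr (\<alpha> n + 1 - real h)) h G}
                  \<ge> 1 - real n powr (- \<phi> n))"
proof -
  let ?bad = "\<lambda>n x. measure_pmf.prob (edge_pmf p (all_pairs {1..n})) {f. \<not> clique_dispersed c (real n powr (x + 1 - real h)) h f {1..n}}"
  have trivial: "?bad n x \<le> real n powr - y" if "1 \<le> n" "real h \<le> x + 1" for n x y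
  proof -
    have "1 \<le> real n powr (x + 1 - real h)" using that by (intro ge_one_powr_ge_zero) auto
    then have "{f. \<not> clique_dispersed c (real n powr (x + 1 - real h)) h f {1..n}} = {}"
      using clique_dispersed_ge_1[of "{1..n}"] by blast
    then show ?thesis by (simp only: measure_empty powr_ge_zero)
  qed
  have ev: "eventually (\<lambda>n. ?bad n (1 / real (Suc j)) \<le> real n powr - real j) sequentially" for j
  proof (cases h)
    case 0
    then show ?thesis using trivial[of _ "1 / real (Suc j)" "real j"]
      by (intro eventually_mono[OF eventually_ge_at_top[of 1]]) simp
  next
    case (Suc h')
    from clique_dispersed_whp[OF assms(3,4,1,2), of "1 / real (Suc j)" h' "real j"]
    obtain n0 where n0: "\<And>V :: nat set. finite V \<Longrightarrow> n0 \<le> card V \<Longrightarrow>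
      measure_pmf.prob (edge_pmf p (all_pairs V))
        {f. \<not> clique_dispersed c (real (card V) powr (1 / real (Suc j) + 1 - real h)) h f V} \<le> real (card V) powr - real j"
      unfolding Suc by auto
    show ?thesis
      unfolding eventually_sequentially using n0[of "{1.._}"] by auto
  qed
  obtain J N where J: "filterlim J at_top sequentially"
    and N: "\<And>n. N \<le> n \<Longrightarrow> ?bad n (1 / real (Suc (J n))) \<le> real n powr - real (J n)"
    by (rule eventually_diagonal[of "\<lambda>j n. ?bad n (1 / real (Suc j)) \<le> real n powr - real j", OF ev]) (rule that)
  \<comment> \<open>Below \<open>N\<close> the value \<open>h\<close> turns the permitted proportion
    into \<open>n \<ge> 1\<close>, so the bound is vacuous there; finitely many values do not affect
    the limit.\<close>
  define \<alpha> where "\<alpha> n = (if N \<le> n then 1 / real (Suc (J n)) else real h)" for n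
  define \<phi> where "\<phi> n = real (J n)" for n
  have "(\<lambda>n. 1 / real (Suc (J n))) \<longlonglongrightarrow> 0"
    using filterlim_compose[OF LIMSEQ_inverse_real_of_nat J] by (simp add: inverse_eq_divide)
  then have "\<alpha> \<longlonglongrightarrow> 0"
    by (rule Lim_transform_eventually) (auto simp: \<alpha>_def eventually_sequentially intro!: exI[of _ N])
  moreover have "filterlim \<phi> at_top sequentially"
    unfolding \<phi>_def by (rule filterlim_compose[OF filterlim_real_sequentially J])
  moreover have "?bad n (\<alpha> n) \<le> real n powr - \<phi> n" if "1 \<le> n" for n
    using N[of n] trivial[OF that, of "real h" "\<phi> n"] by (auto simp: \<alpha>_def \<phi>_def)
  then have "\<forall>n\<ge>1. measure_pmf.prob (random_graph n p)
      {G. dispersed c (real n powr (\<alpha> n + 1 - real h)) h G} \<ge> 1 - real n powr (- \<phi> n)"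
    unfolding prob_random_graph_dispersed by simp
  ultimately show ?thesis by blast
qed

end
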